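(* Let $\{\alpha_n\}_{n=0}^\infty$ be the Verblunsky coefficients of a nontrivial probability measure $\mu$ on $\partial\mathbb{D}$ and suppose $\sum_{n=0}^\infty|\alpha_n|^2<\infty$. Let $\mathcal{C}$ be the CMV matrix for $\{\alpha_n\}_{n=0}^\infty$ and $\mathcal{C}_0$ the CMV matrix for $\alpha_j\equiv0$, viewed as unitary operators on $\ell^2(\{0,1,2,\dots\})$. Then the strong limits $$\operatorname*{s-lim}_{n\to\pm\infty}\,\mathcal{C}^n\mathcal{C}_0^{-n}=\Omega^\pm$$ exist, and the range of each of $\Omega^{\pm}$ is the range of the spectral projection $\chi_S(\mathcal{C})$, where $S\subset\partial\mathbb{D}$ is a set with $\mu_{\mathrm{s}}(S)=0$ and $|\partial\mathbb{D}\setminus S|=0$.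
   Context: $\mathbb{D}=\{|z|<1\}$; $|\cdot|$ of a subset of $\partial\mathbb{D}$ is Lebesgue measure. A probability measure on $\partial\mathbb{D}$ is nontrivial if it is not a finite combination of delta functions. Write $d\mu=w(\theta)\frac{d\theta}{2\pi}+d\mu_{\mathrm{s}}$ with $d\mu_{\mathrm{s}}$ singular. With $\Phi_n$ the monic orthogonal polynomials in $L^2(\partial\mathbb{D},d\mu)$, the Verblunsky coefficients are $\alpha_n=-\overline{\Phi_{n+1}(0)}\in\mathbb{D}$; they determine $\mu$. The CMV matrix for $\{\alpha_n\}$ is $\mathcal{C}=\mathcal{L}\mathcal{M}$ with $\mathcal{L}=\Theta_0\oplus\Theta_2\oplus\Theta_4\oplus\cdots$ and $\mathcal{M}=1\oplus\Theta_1\oplus\Theta_3\oplus\cdots$ (the $1$ being a $1\times1$ block), where $\Theta_j=\begin{pmatrix}\bar\alpha_j&\rho_j\\ \rho_j&-\alpha_j\end{pmatrix}$ and $\rho_j=(1-|\alpha_j|^2)^{1/2}$; it is the matrix of multiplication by $z$ on $L^2(\partial\mathbb{D},d\mu)$ in the basis obtained by orthonormalizing $1,z,z^{-1},z^2,z^{-2},\dots$. *)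

theory Defs
  imports "HOL-Analysis.Analysis" "HOL-Probability.Probability_Measure"
    "HOL-Computational_Algebra.Polynomial"
begin

section \<open>The Hilbert space of square-summable complex sequences\<close>

typedef ell2 = "{f :: nat \<Rightarrow> complex. summable (\<lambda>i. (cmod (f i))\<^sup>2)}"
  morphisms ell2_nth Abs_ell2
  by (rule exI[of _ "\<lambda>_. 0"]) simp

lemma ell2_summable: "summable (\<lambda>i. (cmod (ell2_nth x i))\<^sup>2)"
  using ell2_nth[of x] by simp

lemma ell2_nth_Abs: "summable (\<lambda>i. (cmod (f i))\<^sup>2) \<Longrightarrow> ell2_nth (Abs_ell2 f) = f"
  by (simp add: Abs_ell2_inverse)

lemma ell2_eqI: "(\<And>i. ell2_nth x i = ell2_nth y i) \<Longrightarrow> x = y"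
  by (metis ell2_nth_inject ext)

lemma cmod_add_square_le: "(cmod (a + b))\<^sup>2 \<le> 2 * (cmod a)\<^sup>2 + 2 * (cmod b)\<^sup>2"
proof -
  have "(cmod (a + b))\<^sup>2 \<le> (cmod a + cmod b)\<^sup>2"
    by (intro power_mono norm_triangle_ineq) simp
  also have "\<dots> \<le> 2 * (cmod a)\<^sup>2 + 2 * (cmod b)\<^sup>2"
    using sum_squares_bound[of "cmod a" "cmod b"] by (simp add: power2_sum)
  finally show ?thesis .
qed

lemma square_summable_add:
  assumes "summable (\<lambda>i. (cmod (f i))\<^sup>2)" "summable (\<lambda>i. (cmod (g i))\<^sup>2)"
  shows "summable (\<lambda>i. (cmod (f i + g i))\<^sup>2)"
proof (rule summable_comparison_test')
  show "summable (\<lambda>i. 2 * (cmod (f i))\<^sup>2 + 2 * (cmod (g i))\<^sup>2)"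
    by (intro summable_add summable_mult assms)
  show "norm ((cmod (f i + g i))\<^sup>2) \<le> 2 * (cmod (f i))\<^sup>2 + 2 * (cmod (g i))\<^sup>2"
    if "i \<ge> 0" for i
    using cmod_add_square_le[of "f i" "g i"] by simp
qed

lemma square_summable_mult:
  "summable (\<lambda>i. (cmod (f i))\<^sup>2) \<Longrightarrow> summable (\<lambda>i. (cmod (c * f i))\<^sup>2)"
  by (simp add: norm_mult power_mult_distrib summable_mult)

definition scaleC :: "complex \<Rightarrow> ell2 \<Rightarrow> ell2" where
  "scaleC c x = Abs_ell2 (\<lambda>i. c * ell2_nth x i)"

text \<open>The inner product is antilinear in its first argument.\<close>
definition cinner :: "ell2 \<Rightarrow> ell2 \<Rightarrow> complex" where
  "cinner x y = (\<Sum>i. cnj (ell2_nth x i) * ell2_nth y i)"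

lemma summable_cinner: "summable (\<lambda>i. cnj (ell2_nth x i) * ell2_nth y i)"
proof (rule summable_comparison_test')
  show "summable (\<lambda>i. (cmod (ell2_nth x i))\<^sup>2 + (cmod (ell2_nth y i))\<^sup>2)"
    by (intro summable_add ell2_summable)
  show "norm (cnj (ell2_nth x i) * ell2_nth y i)
      \<le> (cmod (ell2_nth x i))\<^sup>2 + (cmod (ell2_nth y i))\<^sup>2" if "i \<ge> 0" for i
  proof -
    have "0 \<le> cmod (ell2_nth x i) * cmod (ell2_nth y i)" by simp
    then have "cmod (ell2_nth x i) * cmod (ell2_nth y i)
        \<le> (cmod (ell2_nth x i))\<^sup>2 + (cmod (ell2_nth y i))\<^sup>2"
      using sum_squares_bound[of "cmod (ell2_nth x i)" "cmod (ell2_nth y i)"]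
      by linarith
    then show ?thesis by (simp only: norm_mult complex_mod_cnj)
  qed
qed

instantiation ell2 :: real_inner
begin

definition zero_ell2 :: ell2 where "0 = Abs_ell2 (\<lambda>_. 0)"
definition plus_ell2 :: "ell2 \<Rightarrow> ell2 \<Rightarrow> ell2" where
  "x + y = Abs_ell2 (\<lambda>i. ell2_nth x i + ell2_nth y i)"
definition uminus_ell2 :: "ell2 \<Rightarrow> ell2" where
  "- x = Abs_ell2 (\<lambda>i. - ell2_nth x i)"
definition minus_ell2 :: "ell2 \<Rightarrow> ell2 \<Rightarrow> ell2" where
  "x - y = Abs_ell2 (\<lambda>i. ell2_nth x i - ell2_nth y i)"
definition scaleR_ell2 :: "real \<Rightarrow> ell2 \<Rightarrow> ell2" where
  "r *\<^sub>R x = scaleC (of_real r) x"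
definition inner_ell2 :: "ell2 \<Rightarrow> ell2 \<Rightarrow> real" where
  "x \<bullet> y = Re (cinner x y)"
definition norm_ell2 :: "ell2 \<Rightarrow> real" where
  "norm x = sqrt (\<Sum>i. (cmod (ell2_nth x i))\<^sup>2)"
definition sgn_ell2 :: "ell2 \<Rightarrow> ell2" where
  "sgn (x :: ell2) = inverse (norm x) *\<^sub>R x"
definition dist_ell2 :: "ell2 \<Rightarrow> ell2 \<Rightarrow> real" where
  "dist (x :: ell2) y = norm (x - y)"
definition uniformity_ell2 :: "(ell2 \<times> ell2) filter" where
  "uniformity = (INF e\<in>{0 <..}. principal {(x :: ell2, y). dist x y < e})"
definition open_ell2 :: "ell2 set \<Rightarrow> bool" where
  "open (U :: ell2 set) = (\<forall>x\<in>U. eventually (\<lambda>(x', y). x' = x \<longrightarrow> y \<in> U) uniformity)"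

lemma ell2_nth_zero: "ell2_nth 0 i = 0"
  by (simp add: zero_ell2_def ell2_nth_Abs)

lemma ell2_nth_add: "ell2_nth (x + y) i = ell2_nth x i + ell2_nth y i"
  by (simp add: plus_ell2_def ell2_nth_Abs square_summable_add ell2_summable)

lemma ell2_nth_uminus: "ell2_nth (- x) i = - ell2_nth x i"
  by (simp add: uminus_ell2_def ell2_nth_Abs ell2_summable)

lemma ell2_nth_diff: "ell2_nth (x - y) i = ell2_nth x i - ell2_nth y i"
  using square_summable_add[of "ell2_nth x" "\<lambda>i. - ell2_nth y i"]
  by (simp add: minus_ell2_def ell2_nth_Abs ell2_summable)

lemma ell2_nth_scaleC: "ell2_nth (scaleC c x) i = c * ell2_nth x i"
  using square_summable_mult[OF ell2_summable]
  by (simp add: scaleC_def ell2_nth_Abs)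

lemma ell2_nth_scaleR: "ell2_nth (r *\<^sub>R x) i = of_real r * ell2_nth x i"
  by (simp add: scaleR_ell2_def ell2_nth_scaleC)

lemmas ell2_nth_simps =
  ell2_nth_zero ell2_nth_add ell2_nth_uminus ell2_nth_diff ell2_nth_scaleC ell2_nth_scaleR

lemma cinner_self: "cinner x x = of_real (\<Sum>i. (cmod (ell2_nth x i))\<^sup>2)"
proof -
  have "cinner x x = (\<Sum>i. of_real ((cmod (ell2_nth x i))\<^sup>2))"
    unfolding cinner_def
    by (rule suminf_cong) (simp only: mult.commute[of "cnj _"] complex_norm_square)
  also have "\<dots> = of_real (\<Sum>i. (cmod (ell2_nth x i))\<^sup>2)"
    by (rule suminf_of_real[symmetric]) (rule ell2_summable)
  finally show ?thesis .
qed

instance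
proof
  fix x y z :: ell2 and a b r :: real
  show "x + y + z = x + (y + z)" "x + y = y + x" "0 + x = x" "- x + x = 0" "x - y = x + - y"
    by (rule ell2_eqI, simp add: ell2_nth_simps)+
  show "a *\<^sub>R (x + y) = a *\<^sub>R x + a *\<^sub>R y" "(a + b) *\<^sub>R x = a *\<^sub>R x + b *\<^sub>R x"
    "a *\<^sub>R b *\<^sub>R x = (a * b) *\<^sub>R x" "1 *\<^sub>R x = x"
    by (rule ell2_eqI, simp add: ell2_nth_simps algebra_simps)+
  show "sgn (x :: ell2) = inverse (norm x) *\<^sub>R x" by (rule sgn_ell2_def)
  show "dist x y = norm (x - y)" by (rule dist_ell2_def)
  show "uniformity = (INF e\<in>{0 <..}. principal {(x :: ell2, y). dist x y < e})"
    by (rule uniformity_ell2_def)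
  show "open (U :: ell2 set) = (\<forall>x\<in>U. eventually (\<lambda>(x', y). x' = x \<longrightarrow> y \<in> U) uniformity)"
    for U :: "ell2 set"
    by (rule open_ell2_def)
  have cnj_eq: "cinner y x = cnj (cinner x y)" for x y
    unfolding cinner_def
    by (subst bounded_linear.suminf[OF bounded_linear_cnj summable_cinner])
      (simp only: complex_cnj_mult complex_cnj_cnj mult.commute)
  show "x \<bullet> y = y \<bullet> x"
    unfolding inner_ell2_def by (subst cnj_eq) simp
  have "cinner (x + y) z = cinner x z + cinner y z"
    unfolding cinner_def
    by (subst suminf_add[OF summable_cinner summable_cinner])
      (simp add: ell2_nth_simps algebra_simps)
  then show "(x + y) \<bullet> z = x \<bullet> z + y \<bullet> z"
    by (simp add: inner_ell2_def)
  have "cinner (r *\<^sub>R x) y = of_real r * cinner x y"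
    unfolding cinner_def
    by (subst suminf_mult[OF summable_cinner, symmetric])
      (simp add: ell2_nth_simps algebra_simps)
  then show "r *\<^sub>R x \<bullet> y = r * (x \<bullet> y)"
    by (simp add: inner_ell2_def)
  have nn: "0 \<le> (\<Sum>i. (cmod (ell2_nth x i))\<^sup>2)"
    by (rule suminf_nonneg) (simp_all add: ell2_summable)
  then show "0 \<le> x \<bullet> x"
    by (simp add: inner_ell2_def cinner_self)
  have "(\<Sum>i. (cmod (ell2_nth x i))\<^sup>2) = 0 \<longleftrightarrow> (\<forall>i. (cmod (ell2_nth x i))\<^sup>2 = 0)"
    by (rule suminf_eq_zero_iff) (simp_all add: ell2_summable)
  also have "\<dots> \<longleftrightarrow> x = 0"
    using ell2_eqI[of x 0] by (auto simp: ell2_nth_simps)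
  finally show "(x \<bullet> x = 0) = (x = 0)"
    by (simp add: inner_ell2_def cinner_self)
  show "norm x = sqrt (x \<bullet> x)"
    by (simp add: inner_ell2_def cinner_self norm_ell2_def)
qed

end

definition clinear_op :: "(ell2 \<Rightarrow> ell2) \<Rightarrow> bool" where
  "clinear_op T \<longleftrightarrow>
     (\<forall>x y. T (x + y) = T x + T y) \<and> (\<forall>c x. T (scaleC c x) = scaleC c (T x))"

definition unitary_op :: "(ell2 \<Rightarrow> ell2) \<Rightarrow> bool" where
  "unitary_op U \<longleftrightarrow> clinear_op U \<and> bij U \<and> (\<forall>x. norm (U x) = norm x)"

definition op_power_int :: "(ell2 \<Rightarrow> ell2) \<Rightarrow> int \<Rightarrow> ell2 \<Rightarrow> ell2" where
  "op_power_int U k = (if k \<ge> 0 then U ^^ nat k else inv U ^^ nat (- k))"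

definition strong_limit :: "('i \<Rightarrow> ell2 \<Rightarrow> ell2) \<Rightarrow> (ell2 \<Rightarrow> ell2) \<Rightarrow> 'i filter \<Rightarrow> bool" where
  "strong_limit T \<Omega> F \<longleftrightarrow> (\<forall>x. ((\<lambda>n. T n x) \<longlongrightarrow> \<Omega> x) F)"

text \<open>The operator of an infinite matrix. It is only meaningful for matrices that map
  square-summable sequences to square-summable sequences.\<close>
definition matrix_op :: "(nat \<Rightarrow> nat \<Rightarrow> complex) \<Rightarrow> ell2 \<Rightarrow> ell2" where
  "matrix_op A x = Abs_ell2 (\<lambda>i. \<Sum>j. A i j * ell2_nth x j)"

section \<open>Measures on the unit circle\<close>

definition circle_borel :: "complex measure" where
  "circle_borel = restrict_space borel (sphere 0 1)"

text \<open>Arc length, so the whole circle has measure \<open>2 * pi\<close>.\<close>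
definition circle_lebesgue :: "complex measure" where
  "circle_lebesgue = distr (restrict_space lborel {0..<2 * pi}) circle_borel cis"

definition circle_prob :: "complex measure \<Rightarrow> bool" where
  "circle_prob \<mu> \<longleftrightarrow> sets \<mu> = sets circle_borel \<and> prob_space \<mu>"

definition nontrivial_measure :: "complex measure \<Rightarrow> bool" where
  "nontrivial_measure \<mu> \<longleftrightarrow>
     \<not> (\<exists>F c. finite F \<and> F \<subseteq> sphere 0 1 \<and>
          (\<forall>A\<in>sets \<mu>. measure \<mu> A = (\<Sum>z\<in>F. c z * indicator A z)))"

definition circle_singular :: "complex measure \<Rightarrow> bool" where
  "circle_singular \<nu> \<longleftrightarrow>
     (\<exists>N\<in>sets circle_borel. emeasure circle_lebesgue N = 0 \<and> emeasure \<nu> (sphere 0 1 - N) = 0)"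

text \<open>\<open>d\<mu> = w(\<theta>) d\<theta>/(2\<pi>) + d\<nu>\<close> with \<open>\<nu>\<close> singular, where \<open>z = exp(i\<theta>)\<close>.\<close>
definition circle_decomposition ::
  "complex measure \<Rightarrow> (real \<Rightarrow> real) \<Rightarrow> complex measure \<Rightarrow> bool" where
  "circle_decomposition \<mu> w \<nu> \<longleftrightarrow>
     w \<in> borel_measurable borel \<and> (\<forall>\<theta>. 0 \<le> w \<theta>) \<and>
     sets \<nu> = sets circle_borel \<and> circle_singular \<nu> \<and>
     (\<forall>A\<in>sets circle_borel.
        emeasure \<mu> A =
          (\<integral>\<^sup>+\<theta>\<in>{0..<2 * pi}. ennreal (w \<theta> / (2 * pi)) * indicator A (cis \<theta>) \<partial>lborel)
          + emeasure \<nu> A)"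

definition monic_orthogonal_polys :: "complex measure \<Rightarrow> (nat \<Rightarrow> complex poly) \<Rightarrow> bool" where
  "monic_orthogonal_polys \<mu> \<Phi> \<longleftrightarrow>
     (\<forall>n. degree (\<Phi> n) = n \<and> lead_coeff (\<Phi> n) = 1) \<and>
     (\<forall>m n. m \<noteq> n \<longrightarrow> (\<integral>z. cnj (poly (\<Phi> m) z) * poly (\<Phi> n) z \<partial>\<mu>) = 0)"

definition monic_OPUC :: "complex measure \<Rightarrow> nat \<Rightarrow> complex poly" where
  "monic_OPUC \<mu> = (THE \<Phi>. monic_orthogonal_polys \<mu> \<Phi>)"

definition verblunsky :: "complex measure \<Rightarrow> nat \<Rightarrow> complex" where
  "verblunsky \<mu> n = - cnj (poly (monic_OPUC \<mu> (Suc n)) 0)"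

section \<open>CMV matrices\<close>

definition Theta :: "complex \<Rightarrow> nat \<Rightarrow> nat \<Rightarrow> complex" where
  "Theta a r s =
     (if r = 0 \<and> s = 0 then cnj a
      else if r = 1 \<and> s = 1 then - a
      else of_real (sqrt (1 - (cmod a)\<^sup>2)))"

text \<open>The block-diagonal matrix with the \<open>2 \<times> 2\<close> blocks \<open>B 0, B 1, \<dots>\<close>.\<close>
definition direct_sum2 :: "(nat \<Rightarrow> nat \<Rightarrow> nat \<Rightarrow> complex) \<Rightarrow> nat \<Rightarrow> nat \<Rightarrow> complex" where
  "direct_sum2 B i j = (if i div 2 = j div 2 then B (i div 2) (i mod 2) (j mod 2) else 0)"

definition one_plus :: "(nat \<Rightarrow> nat \<Rightarrow> complex) \<Rightarrow> nat \<Rightarrow> nat \<Rightarrow> complex" where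
  "one_plus A i j =
     (if i = 0 \<and> j = 0 then 1 else if i = 0 \<or> j = 0 then 0 else A (i - 1) (j - 1))"

definition cmv_L :: "(nat \<Rightarrow> complex) \<Rightarrow> nat \<Rightarrow> nat \<Rightarrow> complex" where
  "cmv_L \<alpha> = direct_sum2 (\<lambda>k. Theta (\<alpha> (2 * k)))"

definition cmv_M :: "(nat \<Rightarrow> complex) \<Rightarrow> nat \<Rightarrow> nat \<Rightarrow> complex" where
  "cmv_M \<alpha> = one_plus (direct_sum2 (\<lambda>k. Theta (\<alpha> (2 * k + 1))))"

text \<open>The matrix product; for each \<open>i\<close> only finitely many terms are nonzero.\<close>
definition cmv_matrix :: "(nat \<Rightarrow> complex) \<Rightarrow> nat \<Rightarrow> nat \<Rightarrow> complex" where
  "cmv_matrix \<alpha> i k = (\<Sum>j. cmv_L \<alpha> i j * cmv_M \<alpha> j k)"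

definition cmv_op :: "(nat \<Rightarrow> complex) \<Rightarrow> ell2 \<Rightarrow> ell2" where
  "cmv_op \<alpha> = matrix_op (cmv_matrix \<alpha>)"

text \<open>CMV operators are unitary; in particular the matrices map square-summable sequences to
  square-summable sequences, so that \<open>cmv_op\<close> is meaningful.\<close>

lemma pair_sums:
  fixes u v :: "nat \<Rightarrow> real"
  assumes "v sums s" "\<And>i. 0 \<le> u i"
    and eq: "\<And>k. u (2 * k) + u (2 * k + 1) = v (2 * k) + v (2 * k + 1)"
  shows "u sums s"
proof -
  have grp: "sum g {k * 2..<k * 2 + 2} = g (2 * k) + g (2 * k + 1)" for g :: "nat \<Rightarrow> real" and k
    by (simp add: numeral_2_eq_2 mult.commute)
  have v: "(\<lambda>k. v (2 * k) + v (2 * k + 1)) sums s"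
    using sums_group[OF assms(1), of 2] by (simp only: grp)
  have psum: "sum u {..<2 * n} = (\<Sum>k<n. u (2 * k) + u (2 * k + 1))" for n
    by (induction n) (simp_all add: numeral_2_eq_2 algebra_simps)
  have "summable u"
  proof (rule summableI_nonneg_bounded[where x = s])
    fix n
    have "sum u {..<n} \<le> sum u {..<2 * n}"
      by (rule sum_mono2) (use assms(2) in auto)
    also have "\<dots> = (\<Sum>k<n. v (2 * k) + v (2 * k + 1))"
      by (simp only: psum eq)
    also have "\<dots> \<le> s"
      using sum_le_suminf[OF sums_summable[OF v], of "{..<n}"] sums_unique[OF v]
        assms(2)[of "2 * _"] assms(2)[of "2 * _ + 1"]
      by (simp add: eq[symmetric] del: One_nat_def)
    finally show "sum u {..<n} \<le> s" .
  qed (rule assms)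
  then obtain s' where s': "u sums s'" by (auto simp: summable_def)
  have "(\<lambda>k. u (2 * k) + u (2 * k + 1)) sums s'"
    using sums_group[OF s', of 2] by (simp only: grp)
  then have "s' = s"
    using v by (simp only: eq sums_unique2)
  with s' show ?thesis by simp
qed

lemma direct_sum2_row_sums:
  "(\<lambda>j. direct_sum2 B i j * f j) sums
     (B (i div 2) (i mod 2) 0 * f (2 * (i div 2)) + B (i div 2) (i mod 2) 1 * f (2 * (i div 2) + 1))"
proof -
  have "(\<lambda>j. direct_sum2 B i j * f j) sums
      (\<Sum>j\<in>{2 * (i div 2), 2 * (i div 2) + 1}. direct_sum2 B i j * f j)"
    by (rule sums_finite) (auto simp: direct_sum2_def)
  then show ?thesis
    by (simp add: direct_sum2_def)
qed

lemma one_plus_row_sums: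
  "(\<lambda>j. one_plus A 0 j * f j) sums f 0"
  "(\<lambda>j. A i j * f (Suc j)) sums s \<Longrightarrow> (\<lambda>j. one_plus A (Suc i) j * f j) sums s"
proof -
  show "(\<lambda>j. one_plus A 0 j * f j) sums f 0"
    using sums_finite[of "{0}" "\<lambda>j. one_plus A 0 j * f j"] by (simp add: one_plus_def)
  show "(\<lambda>j. A i j * f (Suc j)) sums s \<Longrightarrow> (\<lambda>j. one_plus A (Suc i) j * f j) sums s"
    using sums_Suc_iff[of "\<lambda>j. one_plus A (Suc i) j * f j" s] by (simp add: one_plus_def)
qed

lemma Theta_isometry:
  assumes "cmod a \<le> 1"
  shows "(cmod (Theta a 0 0 * x + Theta a 0 1 * y))\<^sup>2 + (cmod (Theta a 1 0 * x + Theta a 1 1 * y))\<^sup>2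
     = (cmod x)\<^sup>2 + (cmod y)\<^sup>2"
proof -
  define r where "r = sqrt (1 - (cmod a)\<^sup>2)"
  have "(cmod a)\<^sup>2 \<le> 1" using assms by (simp add: power_le_one)
  then have r: "r\<^sup>2 = 1 - (Re a)\<^sup>2 - (Im a)\<^sup>2"
    by (simp add: r_def cmod_power2)
  have T: "Theta a 0 0 = cnj a" "Theta a 0 1 = of_real r" "Theta a 1 0 = of_real r" "Theta a 1 1 = - a"
    by (simp_all add: Theta_def r_def)
  show ?thesis
    unfolding T cmod_power2
    using r by simp algebra
qed

lemma Theta_inverse:
  assumes "cmod a \<le> 1"
  shows "Theta (cnj a) 0 0 * (Theta a 0 0 * x + Theta a 0 1 * y)
       + Theta (cnj a) 0 1 * (Theta a 1 0 * x + Theta a 1 1 * y) = x"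
    "Theta (cnj a) 1 0 * (Theta a 0 0 * x + Theta a 0 1 * y)
       + Theta (cnj a) 1 1 * (Theta a 1 0 * x + Theta a 1 1 * y) = y"
proof -
  define r where "r = complex_of_real (sqrt (1 - (cmod a)\<^sup>2))"
  have "(cmod a)\<^sup>2 \<le> 1" using assms by (simp add: power_le_one)
  then have r: "r * r = 1 - a * cnj a"
    by (simp add: r_def complex_norm_square[symmetric] of_real_mult[symmetric] del: of_real_mult of_real_power)
  show "Theta (cnj a) 0 0 * (Theta a 0 0 * x + Theta a 0 1 * y)
       + Theta (cnj a) 0 1 * (Theta a 1 0 * x + Theta a 1 1 * y) = x"
    "Theta (cnj a) 1 0 * (Theta a 0 0 * x + Theta a 0 1 * y)
       + Theta (cnj a) 1 1 * (Theta a 1 0 * x + Theta a 1 1 * y) = y"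
    using r by (simp_all add: Theta_def r_def[symmetric]) algebra+
qed

definition seq_apply :: "(nat \<Rightarrow> nat \<Rightarrow> complex) \<Rightarrow> (nat \<Rightarrow> complex) \<Rightarrow> nat \<Rightarrow> complex" where
  "seq_apply A f i = (\<Sum>j. A i j * f j)"

lemma seq_apply_L:
  "seq_apply (cmv_L \<alpha>) f (2 * k) =
     Theta (\<alpha> (2 * k)) 0 0 * f (2 * k) + Theta (\<alpha> (2 * k)) 0 1 * f (2 * k + 1)"
  "seq_apply (cmv_L \<alpha>) f (2 * k + 1) =
     Theta (\<alpha> (2 * k)) 1 0 * f (2 * k) + Theta (\<alpha> (2 * k)) 1 1 * f (2 * k + 1)"
  unfolding seq_apply_def cmv_L_def
  by (simp_all add: sums_unique[OF direct_sum2_row_sums, symmetric])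

lemma seq_apply_M:
  "seq_apply (cmv_M \<alpha>) f 0 = f 0"
  "seq_apply (cmv_M \<alpha>) f (Suc (2 * k)) =
     Theta (\<alpha> (2 * k + 1)) 0 0 * f (Suc (2 * k)) + Theta (\<alpha> (2 * k + 1)) 0 1 * f (Suc (2 * k + 1))"
  "seq_apply (cmv_M \<alpha>) f (Suc (2 * k + 1)) =
     Theta (\<alpha> (2 * k + 1)) 1 0 * f (Suc (2 * k)) + Theta (\<alpha> (2 * k + 1)) 1 1 * f (Suc (2 * k + 1))"
  unfolding seq_apply_def cmv_M_def
  by (simp_all add: sums_unique[OF one_plus_row_sums(1), symmetric]
      sums_unique[OF one_plus_row_sums(2)[OF direct_sum2_row_sums], symmetric])

lemma even_odd_cases: obtains k where "i = 2 * k" | k where "i = 2 * k + (1 :: nat)"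
  by (metis oddE evenE)

lemma seq_apply_cmv:
  "seq_apply (cmv_matrix \<alpha>) f = seq_apply (cmv_L \<alpha>) (seq_apply (cmv_M \<alpha>) f)"
proof
  fix i :: nat
  let ?e = "2 * (i div 2)"
  let ?B = "\<lambda>k. Theta (\<alpha> (2 * k))"
  have row: "(\<lambda>j. cmv_L \<alpha> i j * g j) sums
      (?B (i div 2) (i mod 2) 0 * g ?e + ?B (i div 2) (i mod 2) 1 * g (?e + 1))" for g
    unfolding cmv_L_def by (rule direct_sum2_row_sums)
  have "summable (\<lambda>k. cmv_M \<alpha> j k * f k)" for j
    unfolding cmv_M_def
    by (cases j)
      (auto intro: sums_summable one_plus_row_sums(1) one_plus_row_sums(2)[OF direct_sum2_row_sums])
  then have M: "(\<lambda>k. cmv_M \<alpha> j k * f k) sums seq_apply (cmv_M \<alpha>) f j" for j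
    unfolding seq_apply_def by (rule summable_sums)
  have sums: "(\<lambda>k. cmv_matrix \<alpha> i k * f k) sums
      (?B (i div 2) (i mod 2) 0 * seq_apply (cmv_M \<alpha>) f ?e
       + ?B (i div 2) (i mod 2) 1 * seq_apply (cmv_M \<alpha>) f (?e + 1))"
    unfolding cmv_matrix_def sums_unique[OF row, symmetric] distrib_right mult.assoc
    by (intro sums_add sums_mult M)
  show "seq_apply (cmv_matrix \<alpha>) f i = seq_apply (cmv_L \<alpha>) (seq_apply (cmv_M \<alpha>) f) i"
    unfolding seq_apply_def[of "cmv_matrix \<alpha>"] seq_apply_def[of "cmv_L \<alpha>"]
    by (simp only: sums_unique[OF sums, symmetric] sums_unique[OF row, symmetric])
qed

context
  fixes \<alpha> :: "nat \<Rightarrow> complex"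
  assumes \<alpha>: "\<And>j. cmod (\<alpha> j) \<le> 1"
begin

lemma seq_apply_L_inverse: "seq_apply (cmv_L (cnj \<circ> \<alpha>)) (seq_apply (cmv_L \<alpha>) f) = f"
proof
  fix i
  show "seq_apply (cmv_L (cnj \<circ> \<alpha>)) (seq_apply (cmv_L \<alpha>) f) i = f i"
    by (cases i rule: even_odd_cases; simp only: seq_apply_L Theta_inverse[OF \<alpha>] o_apply)
qed

lemma seq_apply_M_inverse: "seq_apply (cmv_M (cnj \<circ> \<alpha>)) (seq_apply (cmv_M \<alpha>) f) = f"
proof
  fix i
  show "seq_apply (cmv_M (cnj \<circ> \<alpha>)) (seq_apply (cmv_M \<alpha>) f) i = f i"
  proof (cases i)
    case (Suc k)
    show ?thesis
      unfolding Suc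
      by (cases k rule: even_odd_cases; simp only: seq_apply_M Theta_inverse[OF \<alpha>] o_apply)
  qed (simp only: seq_apply_M)
qed

lemma seq_apply_L_isometry:
  assumes "(\<lambda>i. (cmod (f i))\<^sup>2) sums s"
  shows "(\<lambda>i. (cmod (seq_apply (cmv_L \<alpha>) f i))\<^sup>2) sums s"
  by (rule pair_sums[OF assms]) (simp_all only: seq_apply_L Theta_isometry[OF \<alpha>] zero_le_power2)

lemma seq_apply_M_isometry:
  assumes "(\<lambda>i. (cmod (f i))\<^sup>2) sums s"
  shows "(\<lambda>i. (cmod (seq_apply (cmv_M \<alpha>) f i))\<^sup>2) sums s"
proof -
  have "(\<lambda>i. (cmod (f (Suc i)))\<^sup>2) sums (s - (cmod (f 0))\<^sup>2)"
    using assms sums_Suc_iff[of "\<lambda>i. (cmod (f i))\<^sup>2" "s - (cmod (f 0))\<^sup>2"] by simp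
  then have "(\<lambda>i. (cmod (seq_apply (cmv_M \<alpha>) f (Suc i)))\<^sup>2) sums (s - (cmod (f 0))\<^sup>2)"
    by (rule pair_sums) (simp_all only: seq_apply_M Theta_isometry[OF \<alpha>] zero_le_power2)
  then show ?thesis
    using sums_Suc_iff[of "\<lambda>i. (cmod (seq_apply (cmv_M \<alpha>) f i))\<^sup>2" "s - (cmod (f 0))\<^sup>2"]
    by (simp add: seq_apply_M)
qed

lemma cmv_sums:
  "(\<lambda>i. (cmod (seq_apply (cmv_matrix \<alpha>) (ell2_nth x) i))\<^sup>2) sums (\<Sum>i. (cmod (ell2_nth x i))\<^sup>2)"
  unfolding seq_apply_cmv
  by (intro seq_apply_L_isometry seq_apply_M_isometry summable_sums ell2_summable)

lemma ell2_nth_cmv_op: "ell2_nth (cmv_op \<alpha> x) i = (\<Sum>j. cmv_matrix \<alpha> i j * ell2_nth x j)"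
  using ell2_nth_Abs[OF sums_summable[OF cmv_sums[of x]]]
  by (simp add: cmv_op_def matrix_op_def seq_apply_def)

lemma ell2_nth_cmv_op_LM:
  "ell2_nth (cmv_op \<alpha> x) = seq_apply (cmv_L \<alpha>) (seq_apply (cmv_M \<alpha>) (ell2_nth x))"
  by (rule ext) (simp only: ell2_nth_cmv_op seq_apply_cmv[symmetric] seq_apply_def)

lemma norm_cmv_op: "norm (cmv_op \<alpha> x) = norm x"
  unfolding norm_ell2_def ell2_nth_cmv_op_LM seq_apply_cmv[symmetric]
  using sums_unique[OF cmv_sums[of x]] by simp

end

lemma seq_apply_L_M_linear:
  "seq_apply (cmv_L \<alpha>) (\<lambda>i. f i + g i) = (\<lambda>i. seq_apply (cmv_L \<alpha>) f i + seq_apply (cmv_L \<alpha>) g i)"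
  "seq_apply (cmv_L \<alpha>) (\<lambda>i. c * f i) = (\<lambda>i. c * seq_apply (cmv_L \<alpha>) f i)"
  "seq_apply (cmv_M \<alpha>) (\<lambda>i. f i + g i) = (\<lambda>i. seq_apply (cmv_M \<alpha>) f i + seq_apply (cmv_M \<alpha>) g i)"
  "seq_apply (cmv_M \<alpha>) (\<lambda>i. c * f i) = (\<lambda>i. c * seq_apply (cmv_M \<alpha>) f i)"
proof -
  have L: "seq_apply (cmv_L \<alpha>) (\<lambda>i. f i + g i) i = seq_apply (cmv_L \<alpha>) f i + seq_apply (cmv_L \<alpha>) g i"
    "seq_apply (cmv_L \<alpha>) (\<lambda>i. c * f i) i = c * seq_apply (cmv_L \<alpha>) f i" for f g i
    by (cases i rule: even_odd_cases; simp only: seq_apply_L; simp only: algebra_simps)+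
  have M: "seq_apply (cmv_M \<alpha>) (\<lambda>i. f i + g i) i = seq_apply (cmv_M \<alpha>) f i + seq_apply (cmv_M \<alpha>) g i \<and>
    seq_apply (cmv_M \<alpha>) (\<lambda>i. c * f i) i = c * seq_apply (cmv_M \<alpha>) f i" for f g i
  proof (cases i)
    case (Suc k)
    show ?thesis
      unfolding Suc
      by (cases k rule: even_odd_cases; simp only: seq_apply_M; simp add: algebra_simps)
  qed (simp add: seq_apply_M)
  show "seq_apply (cmv_L \<alpha>) (\<lambda>i. f i + g i) = (\<lambda>i. seq_apply (cmv_L \<alpha>) f i + seq_apply (cmv_L \<alpha>) g i)"
    "seq_apply (cmv_L \<alpha>) (\<lambda>i. c * f i) = (\<lambda>i. c * seq_apply (cmv_L \<alpha>) f i)"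
    "seq_apply (cmv_M \<alpha>) (\<lambda>i. f i + g i) = (\<lambda>i. seq_apply (cmv_M \<alpha>) f i + seq_apply (cmv_M \<alpha>) g i)"
    "seq_apply (cmv_M \<alpha>) (\<lambda>i. c * f i) = (\<lambda>i. c * seq_apply (cmv_M \<alpha>) f i)"
    using L M by (simp_all add: fun_eq_iff)
qed

lemma cmv_op_unitary:
  assumes "\<And>j. cmod (\<alpha> j) \<le> 1"
  shows "unitary_op (cmv_op \<alpha>)"
proof -
  have cnj: "cmod ((cnj \<circ> \<alpha>) j) \<le> 1" for j using assms by simp
  have cc: "cnj \<circ> (cnj \<circ> \<alpha>) = \<alpha>" by (simp add: fun_eq_iff)
  have nth: "ell2_nth (x + y) = (\<lambda>i. ell2_nth x i + ell2_nth y i)"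
    "ell2_nth (scaleC c x) = (\<lambda>i. c * ell2_nth x i)" for x y c
    by (simp_all only: fun_eq_iff ell2_nth_simps simp_thms)
  have lin: "clinear_op (cmv_op \<alpha>)"
    unfolding clinear_op_def
    by (intro conjI allI ell2_eqI)
      (simp_all only: ell2_nth_cmv_op_LM[OF assms] nth seq_apply_L_M_linear)
  have "inj (cmv_op \<alpha>)"
  proof (rule injI)
    fix x y assume "cmv_op \<alpha> x = cmv_op \<alpha> y"
    then have "seq_apply (cmv_L \<alpha>) (seq_apply (cmv_M \<alpha>) (ell2_nth x))
        = seq_apply (cmv_L \<alpha>) (seq_apply (cmv_M \<alpha>) (ell2_nth y))"
      by (simp only: ell2_nth_cmv_op_LM[OF assms, symmetric])
    from arg_cong[OF this, of "\<lambda>f. seq_apply (cmv_M (cnj \<circ> \<alpha>)) (seq_apply (cmv_L (cnj \<circ> \<alpha>)) f)"]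
    have "ell2_nth x = ell2_nth y"
      by (simp only: seq_apply_L_inverse[OF assms] seq_apply_M_inverse[OF assms])
    then show "x = y" by (simp only: ell2_nth_inject)
  qed
  moreover have "surj (cmv_op \<alpha>)"
  proof (rule surjI)
    fix y :: ell2
    let ?f = "seq_apply (cmv_M (cnj \<circ> \<alpha>)) (seq_apply (cmv_L (cnj \<circ> \<alpha>)) (ell2_nth y))"
    have "summable (\<lambda>i. (cmod (?f i))\<^sup>2)"
      by (rule sums_summable)
        (rule seq_apply_M_isometry[OF cnj seq_apply_L_isometry[OF cnj summable_sums[OF ell2_summable]]])
    then show "cmv_op \<alpha> (Abs_ell2 ?f) = y"
      using seq_apply_L_inverse[of "cnj \<circ> \<alpha>", OF cnj] seq_apply_M_inverse[of "cnj \<circ> \<alpha>", OF cnj]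
      unfolding cc
      by (intro ell2_eqI) (simp only: ell2_nth_cmv_op_LM[OF assms] ell2_nth_Abs)
  qed
  ultimately show ?thesis
    using lin norm_cmv_op[OF assms] by (simp add: unitary_op_def bij_def)
qed

section \<open>Spectral projections of unitary operators\<close>

definition orth_projection :: "(ell2 \<Rightarrow> ell2) \<Rightarrow> bool" where
  "orth_projection P \<longleftrightarrow>
     clinear_op P \<and> (\<forall>x. P (P x) = P x) \<and> (\<forall>x y. cinner (P x) y = cinner x (P y))"

definition projection_valued_measure :: "(complex set \<Rightarrow> ell2 \<Rightarrow> ell2) \<Rightarrow> bool" where
  "projection_valued_measure E \<longleftrightarrow>
     (\<forall>A\<in>sets circle_borel. orth_projection (E A)) \<and>
     E (sphere 0 1) = id \<and>
     (\<forall>A B. A \<in> sets circle_borel \<longrightarrow> B \<in> sets circle_borel \<longrightarrow> E (A \<inter> B) = E A \<circ> E B) \<and>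
     (\<forall>A :: nat \<Rightarrow> complex set. range A \<subseteq> sets circle_borel \<longrightarrow> disjoint_family A \<longrightarrow>
        (\<forall>x. (\<lambda>n. E (A n) x) sums E (\<Union>n. A n) x))"

text \<open>The scalar spectral measure \<open>A \<mapsto> \<langle>x, E(A) x\<rangle>\<close>.\<close>
definition scalar_spectral_measure ::
  "(complex set \<Rightarrow> ell2 \<Rightarrow> ell2) \<Rightarrow> ell2 \<Rightarrow> complex measure" where
  "scalar_spectral_measure E x =
     measure_of (sphere 0 1) (sets circle_borel) (\<lambda>A. ennreal (Re (cinner x (E A x))))"

text \<open>\<open>U = \<integral> z dE(z)\<close>, read weakly; by polarization the quadratic forms suffice.\<close>
definition spectral_resolution ::
  "(ell2 \<Rightarrow> ell2) \<Rightarrow> (complex set \<Rightarrow> ell2 \<Rightarrow> ell2) \<Rightarrow> bool" where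
  "spectral_resolution U E \<longleftrightarrow>
     projection_valued_measure E \<and>
     (\<forall>x. cinner x (U x) = (\<integral>z. z \<partial>scalar_spectral_measure E x))"

text \<open>\<open>\<chi>\<^sub>S(U)\<close> for a unitary operator \<open>U\<close> and a Borel subset \<open>S\<close> of the circle.\<close>
definition spectral_projection :: "(ell2 \<Rightarrow> ell2) \<Rightarrow> complex set \<Rightarrow> ell2 \<Rightarrow> ell2" where
  "spectral_projection U S = (THE P. \<exists>E. spectral_resolution U E \<and> P = E S)"

end

(* Multiplication by z on L^2(mu) is the CMV operator C in the CMV basis, and C_0 is the same for
   normalized Lebesgue measure m.  There z^k corresponds to a basis vector and C_0^-n moves it to the
   basis vector of z^(k-n), so C^n C_0^-n takes z^k to z^k phi*_{2(n-k)} for large n, and to z^k times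
   the conjugate of phi*_{2(k-n)-1} for n near -oo.  Since <phi*_m, phi*_n> is the product of the rho_j
   with m <= j < n, square-summability makes phi*_n converge in L^2(mu) to some F, so the limits are
   h |-> F h and h |-> cnj(F) h.  The k-th moment of |F|^2 mu vanishes for k > 0, because phi*_{n+k} is
   orthogonal to z^k phi*_n; hence |F|^2 mu = m.  So both maps are isometries onto the functions in
   L^2(mu) supported on {F ~= 0}, and that set is S up to a mu-null set, because F = 0 mu-a.e. on
   m-null sets and m(F = 0) = 0. *)
theory Submission
  imports Defs
begin

section \<open>Geometry of the sequence space\<close>

text \<open>One fact is used three times: a finite measure on the circle is determined by its
  integer moments. It makes the CMV functions total in L^2(mu): a function orthogonal to all of them
  stays so after multiplication by any integer power of z, because the CMV matrix is invertible, so
  all its moments against mu vanish. It turns the moment computation for |F|^2 mu into an identity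
  of measures. And it identifies chi_S(C): \<open>spectral_projection\<close> is a definite
  description, and \<open>spectral_resolution\<close> prescribes only the first moment of each
  scalar measure. The higher moments are recovered in two moves: the projections of any resolution
  commute with U, and therefore the scalar measure of x + U x is |1 + z|^2 times that of x, which
  allows the exponent to be raised by one. Both limits can be handled together because only |F|
  matters for the isometry and for the range, and F and its conjugate have the same modulus.\<close>

lemma cinner_cnj: "cnj (cinner x y) = cinner y x"
  unfolding cinner_def
  by (subst bounded_linear.suminf[OF bounded_linear_cnj summable_cinner]) (simp add: mult.commute)

lemma cinner_add_right: "cinner x (y + z) = cinner x y + cinner x z"
  unfolding cinner_def
  by (subst suminf_add[OF summable_cinner summable_cinner])
    (simp add: ell2_nth_simps algebra_simps)

lemma cinner_scaleC_right: "cinner x (scaleC c y) = c * cinner x y"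
  unfolding cinner_def
  by (subst suminf_mult[OF summable_cinner, symmetric]) (simp add: ell2_nth_simps algebra_simps)

lemma cinner_add_left: "cinner (x + y) z = cinner x z + cinner y z"
  by (metis cinner_cnj cinner_add_right complex_cnj_add)

lemma cinner_scaleC_left: "cinner (scaleC c x) y = cnj c * cinner x y"
  by (metis cinner_cnj cinner_scaleC_right complex_cnj_mult)

lemma scaleC_diff_right: "scaleC a (x - y) = scaleC a x - scaleC a y"
  and scaleC_one: "scaleC 1 x = x"
  and scaleC_minus_one: "scaleC (- 1) x = - x"
  by (rule ell2_eqI, simp add: ell2_nth_simps algebra_simps)+

lemma cinner_diff_right: "cinner x (y - z) = cinner x y - cinner x z"
  using cinner_add_right[of x y "scaleC (- 1) z"] cinner_scaleC_right[of x "- 1" z]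
  by (simp add: scaleC_minus_one)

lemma cinner_zero_right [simp]: "cinner x 0 = 0"
  and cinner_zero_left [simp]: "cinner 0 x = 0"
  by (simp_all add: cinner_def ell2_nth_simps)

lemma cinner_norm: "cinner x x = of_real ((norm x)\<^sup>2)"
proof -
  have "0 \<le> (\<Sum>i. (cmod (ell2_nth x i))\<^sup>2)"
    by (rule suminf_nonneg) (simp_all add: ell2_summable)
  then show ?thesis by (simp add: cinner_self norm_ell2_def)
qed

lemma cinner_ext: "(\<And>y. cinner y x = cinner y z) \<Longrightarrow> x = z"
  by (metis cinner_diff_right cinner_norm diff_self of_real_eq_0_iff power_eq_0_iff
      norm_eq_zero right_minus_eq)

lemma norm_scaleC: "norm (scaleC c x) = cmod c * norm x"
proof -
  have "complex_of_real ((norm (scaleC c x))\<^sup>2) = of_real ((cmod c * norm x)\<^sup>2)"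
    by (simp add: cinner_norm[symmetric] cinner_scaleC_left cinner_scaleC_right
        complex_norm_square power_mult_distrib mult_ac del: of_real_power)
  then have "(norm (scaleC c x))\<^sup>2 = (cmod c * norm x)\<^sup>2"
    by (simp only: of_real_eq_iff)
  then show ?thesis by (simp add: power2_eq_iff_nonneg)
qed

lemma Re_cinner: "Re (cinner x y) = x \<bullet> y"
  by (simp add: inner_ell2_def)

text \<open>With \<open>Re_cinner\<close>, this reduces statements about the complex inner product
  to the real inner product of the type class, whose limit and polarization rules then
  apply.\<close>

lemma Im_cinner: "Im (cinner x y) = x \<bullet> scaleC (- \<i>) y"
  by (simp add: inner_ell2_def cinner_scaleC_right)

lemma tendsto_scaleC:
  assumes "(f \<longlongrightarrow> x) F"
  shows "((\<lambda>n. scaleC c (f n)) \<longlongrightarrow> scaleC c x) F"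
proof -
  have "((\<lambda>n. norm (f n - x)) \<longlongrightarrow> 0) F"
    by (rule tendsto_norm_zero[OF LIM_zero[OF assms]])
  then have "((\<lambda>n. norm (scaleC c (f n) - scaleC c x)) \<longlongrightarrow> 0) F"
    using tendsto_mult_right_zero by (simp add: norm_scaleC flip: scaleC_diff_right)
  then show ?thesis
    by (rule LIM_zero_cancel[OF tendsto_norm_zero_cancel])
qed

lemma tendsto_cinner:
  assumes "(f \<longlongrightarrow> x) F" "(g \<longlongrightarrow> y) F"
  shows "((\<lambda>n. cinner (f n) (g n)) \<longlongrightarrow> cinner x y) F"
  by (intro tendsto_complex_iff[THEN iffD2] conjI;
      unfold Re_cinner Im_cinner; intro tendsto_inner tendsto_scaleC assms)

section \<open>Complex-linear operators on the sequence space\<close>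

lemma clinear_op_add: "clinear_op T \<Longrightarrow> T (x + y) = T x + T y"
  and clinear_op_scaleC: "clinear_op T \<Longrightarrow> T (scaleC c x) = scaleC c (T x)"
  by (simp_all add: clinear_op_def)

lemma clinear_op_diff: "clinear_op T \<Longrightarrow> T (x - y) = T x - T y"
  using clinear_op_add[of T x "scaleC (- 1) y"] clinear_op_scaleC[of T "- 1" y]
  by (simp add: scaleC_minus_one)

lemma clinear_op_zero: "clinear_op T \<Longrightarrow> T 0 = 0"
  using clinear_op_diff[of T 0 0] by simp

lemma clinear_op_sum: "clinear_op T \<Longrightarrow> T (sum f A) = (\<Sum>i\<in>A. T (f i))"
  by (induction A rule: infinite_finite_induct) (simp_all add: clinear_op_add clinear_op_zero)

lemma clinear_op_comp: "clinear_op S \<Longrightarrow> clinear_op T \<Longrightarrow> clinear_op (S \<circ> T)"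
  by (simp add: clinear_op_def)

text \<open>Real polarization (\<open>dot_norm\<close>) gives the real part; the imaginary part is
  the real part with \<open>- \<i>\<close> moved into the second argument.\<close>

lemma isometry_cinner:
  assumes "clinear_op U" "\<And>x. norm (U x) = norm x"
  shows "cinner (U x) (U y) = cinner x y"
proof -
  have inner: "U x \<bullet> U y = x \<bullet> y" for x y
    using assms by (simp add: dot_norm flip: clinear_op_add[OF assms(1)])
  show ?thesis
    by (rule complex_eqI)
      (simp_all only: Re_cinner Im_cinner inner clinear_op_scaleC[OF assms(1), symmetric])
qed

text \<open>Over complex scalars the quadratic form determines the operator. For the difference
  \<open>D\<close>, the form at \<open>x + y\<close> kills the sum of the two cross terms, and the
  form at \<open>\<i> x + y\<close> kills their difference.\<close>

lemma clinear_op_eqI: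
  assumes P: "clinear_op P" and Q: "clinear_op Q"
    and eq: "\<And>x. cinner x (P x) = cinner x (Q x)"
  shows "P = Q"
proof (rule ext)
  fix x
  define D where "D z = P z - Q z" for z
  have Dadd: "D (x + y) = D x + D y" and Dsc: "D (scaleC c x) = scaleC c (D x)" for x y c
    by (simp_all add: D_def clinear_op_add[OF P] clinear_op_add[OF Q] clinear_op_scaleC[OF P]
        clinear_op_scaleC[OF Q] scaleC_diff_right)
  have D0: "cinner z (D z) = 0" for z by (simp add: D_def cinner_diff_right eq)
  have "cinner y (D x) = 0" for y
  proof -
    have a: "cinner y (D x) + cinner x (D y) = 0"
      using D0[of "x + y"] by (simp add: Dadd cinner_add_left cinner_add_right D0 add.commute)
    have "cinner y (D (scaleC \<i> x)) + cinner (scaleC \<i> x) (D y) = 0"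
      using D0[of "scaleC \<i> x + y"] D0[of "scaleC \<i> x"]
      by (simp add: Dadd cinner_add_left cinner_add_right D0 add.commute)
    then have "\<i> * (cinner y (D x) - cinner x (D y)) = 0"
      by (simp add: Dsc cinner_scaleC_left cinner_scaleC_right algebra_simps)
    then show ?thesis using a by simp
  qed
  then have "D x = 0" by (intro cinner_ext) simp
  then show "P x = Q x" by (simp add: D_def)
qed

section \<open>Unit vectors, and strong convergence tested on them\<close>

definition ell2_unit :: "nat \<Rightarrow> ell2" where
  "ell2_unit j = Abs_ell2 (\<lambda>i. if i = j then 1 else 0)"

lemma ell2_nth_unit: "ell2_nth (ell2_unit j) i = (if i = j then 1 else 0)"
proof -
  have "summable (\<lambda>i. (cmod (if i = j then 1 else 0))\<^sup>2)"
    by (rule sums_summable[OF sums_finite[of "{j}"]]) auto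
  then show ?thesis by (simp add: ell2_unit_def ell2_nth_Abs)
qed

lemma ell2_nth_sum: "ell2_nth (sum f A) i = (\<Sum>j\<in>A. ell2_nth (f j) i)"
  by (induction A rule: infinite_finite_induct) (simp_all add: ell2_nth_simps)

lemma ell2_truncation_tendsto:
  "(\<lambda>n. \<Sum>j<n. scaleC (ell2_nth x j) (ell2_unit j)) \<longlonglongrightarrow> x"
proof -
  let ?s = "\<lambda>n. \<Sum>j<n. scaleC (ell2_nth x j) (ell2_unit j)"
  let ?u = "\<lambda>i. (cmod (ell2_nth x i))\<^sup>2"
  have s: "ell2_nth (?s n) i = (if i < n then ell2_nth x i else 0)" for n i
    by (simp add: ell2_nth_sum ell2_nth_simps ell2_nth_unit if_distrib cong: if_cong)
  have "norm (x - ?s n) = sqrt (suminf ?u - sum ?u {..<n})" for n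
  proof -
    have "(\<lambda>i. (cmod (ell2_nth (x - ?s n) i))\<^sup>2) = (\<lambda>i. ?u i - (if i \<in> {..<n} then ?u i else 0))"
      by (auto simp: ell2_nth_simps s)
    moreover have "(\<lambda>i. ?u i - (if i \<in> {..<n} then ?u i else 0)) sums (suminf ?u - sum ?u {..<n})"
      by (intro sums_diff summable_sums ell2_summable sums_If_finite_set) simp
    ultimately show ?thesis by (simp add: norm_ell2_def sums_unique[symmetric])
  qed
  moreover have "(\<lambda>n. sqrt (suminf ?u - sum ?u {..<n})) \<longlonglongrightarrow> sqrt (suminf ?u - suminf ?u)"
    by (intro tendsto_intros summable_LIMSEQ ell2_summable)
  ultimately have "(\<lambda>n. norm (x - ?s n)) \<longlonglongrightarrow> 0" by simp
  then have "(\<lambda>n. norm (?s n - x)) \<longlonglongrightarrow> 0" by (simp add: norm_minus_commute)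
  then show ?thesis
    by (rule LIM_zero_cancel[OF tendsto_norm_zero_cancel])
qed

text \<open>Convergence passes to finite combinations, which are dense. Since every
  \<open>W n\<close> and the limit are isometries, the truncation error is carried along with the
  same size for all \<open>n\<close>, which accounts for two of the three thirds of
  \<open>e\<close>.\<close>

lemma strong_limit_unitI:
  assumes lin: "\<And>n. clinear_op (W n)" and iso: "\<And>n x. norm (W n x) = norm x"
    and lin': "clinear_op \<Omega>" and iso': "\<And>x. norm (\<Omega> x) = norm x"
    and unit: "\<And>j. ((\<lambda>n. W n (ell2_unit j)) \<longlongrightarrow> \<Omega> (ell2_unit j)) F"
  shows "strong_limit W \<Omega> F"
  unfolding strong_limit_def
proof (intro allI tendstoI)
  fix x and e :: real assume e: "0 < e"
  let ?s = "\<lambda>n. \<Sum>j<n. scaleC (ell2_nth x j) (ell2_unit j)"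
  obtain N where N: "norm (?s N - x) < e / 3"
    using LIMSEQ_D[OF ell2_truncation_tendsto[of x], of "e / 3"] e by auto
  have "((\<lambda>n. W n (?s N)) \<longlongrightarrow> \<Omega> (?s N)) F"
    unfolding clinear_op_sum[OF lin] clinear_op_sum[OF lin'] clinear_op_scaleC[OF lin]
      clinear_op_scaleC[OF lin']
    by (intro tendsto_sum tendsto_scaleC unit)
  then have "\<forall>\<^sub>F n in F. norm (W n (?s N) - \<Omega> (?s N)) < e / 3"
    using e by (simp add: tendsto_iff dist_norm del: less_divide_eq_numeral1)
  then show "\<forall>\<^sub>F n in F. dist (W n x) (\<Omega> x) < e"
  proof eventually_elim
    case (elim n)
    have "W n x - \<Omega> x = (W n (?s N) - \<Omega> (?s N)) + (\<Omega> (?s N - x) - W n (?s N - x))"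
      by (simp add: clinear_op_diff[OF lin] clinear_op_diff[OF lin'])
    also have "norm \<dots> \<le> norm (W n (?s N) - \<Omega> (?s N)) + (norm (\<Omega> (?s N - x)) + norm (W n (?s N - x)))"
      using norm_triangle_ineq norm_triangle_ineq4 order_trans add_left_mono by blast
    also have "\<dots> < e" using elim N by (simp add: iso iso')
    finally show ?case by (simp add: dist_norm)
  qed
qed

section \<open>Unitary operators and their integer powers\<close>

lemma unitary_op_cinner: "unitary_op U \<Longrightarrow> cinner (U x) (U y) = cinner x y"
  by (rule isometry_cinner) (simp_all add: unitary_op_def)

lemma unitary_op_inv:
  assumes "unitary_op U"
  shows "unitary_op (inv U)"
proof -
  have lin: "clinear_op U" and bij: "bij U" and iso: "\<And>x. norm (U x) = norm x"
    using assms by (auto simp: unitary_op_def)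
  have U: "U (inv U x) = x" for x using bij by (simp add: bij_is_surj surj_f_inv_f)
  have "clinear_op (inv U)"
    unfolding clinear_op_def
    by (intro conjI allI; rule inj_onD[OF bij_is_inj[OF bij]])
      (simp_all add: U clinear_op_add[OF lin] clinear_op_scaleC[OF lin])
  moreover have "norm (inv U x) = norm x" for x using iso[of "inv U x"] by (simp add: U)
  ultimately show ?thesis using bij by (simp add: unitary_op_def bij_imp_bij_inv)
qed

lemma unitary_op_comp: "unitary_op U \<Longrightarrow> unitary_op V \<Longrightarrow> unitary_op (U \<circ> V)"
  by (auto simp: unitary_op_def clinear_op_comp bij_comp)

lemma unitary_op_funpow: "unitary_op U \<Longrightarrow> unitary_op (U ^^ n)"
proof (induction n)
  case 0
  then show ?case by (simp add: unitary_op_def clinear_op_def id_def[symmetric])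
qed (simp add: unitary_op_comp)

lemma unitary_op_power_int: "unitary_op U \<Longrightarrow> unitary_op (op_power_int U k)"
  by (simp add: op_power_int_def unitary_op_funpow unitary_op_inv)

lemma op_power_int_orbit:
  assumes "bij U" and f: "\<And>k :: int. U (f k) = f (k + 1)"
  shows "op_power_int U n (f k) = f (k + n)"
proof -
  have inv: "inv U (f k) = f (k - 1)" for k
    using f[of "k - 1"] assms(1) by (simp add: bij_is_inj inv_f_eq)
  have "(U ^^ m) (f k) = f (k + int m)" for m
    by (induction m) (simp_all add: f algebra_simps)
  moreover have "(inv U ^^ m) (f k) = f (k - int m)" for m
    by (induction m) (simp_all add: inv algebra_simps)
  ultimately show ?thesis by (simp add: op_power_int_def)
qed

section \<open>Trigonometric moments determine a finite measure on the circle\<close>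

definition circle_finite :: "complex measure \<Rightarrow> bool" where
  "circle_finite \<nu> \<longleftrightarrow> sets \<nu> = sets circle_borel \<and> finite_measure \<nu>"

lemma space_circle_borel: "space circle_borel = sphere 0 1"
  by (simp add: circle_borel_def space_restrict_space)

lemma sets_circle_borel: "A \<in> sets circle_borel \<longleftrightarrow> A \<in> sets borel \<and> A \<subseteq> sphere 0 1"
  unfolding circle_borel_def
  by (subst sets_restrict_space_iff) auto

lemma circle_finite_space: "circle_finite \<nu> \<Longrightarrow> space \<nu> = sphere 0 1"
  by (metis circle_finite_def sets_eq_imp_space_eq space_circle_borel)

lemma circle_continuous_measurable:
  fixes f :: "complex \<Rightarrow> 'a :: topological_space"
  assumes "circle_finite \<nu>" "continuous_on (sphere 0 1) f"
  shows "f \<in> borel_measurable \<nu>"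
proof -
  have "f \<in> borel_measurable circle_borel"
    unfolding circle_borel_def by (rule borel_measurable_continuous_on_restrict) fact
  then show ?thesis
    using assms(1) measurable_cong_sets unfolding circle_finite_def by blast
qed

lemma circle_continuous_bounded:
  fixes f :: "complex \<Rightarrow> 'a :: real_normed_vector"
  assumes "continuous_on (sphere 0 1) f"
  obtains B where "\<And>z. z \<in> sphere 0 1 \<Longrightarrow> norm (f z) \<le> B"
proof -
  have "bounded (f ` sphere 0 1)"
    by (intro compact_imp_bounded compact_continuous_image assms) simp
  then show ?thesis using that by (force simp: bounded_iff)
qed

lemma circle_continuous_integrable:
  fixes f :: "complex \<Rightarrow> 'a :: {banach, second_countable_topology}"
  assumes "circle_finite \<nu>" "continuous_on (sphere 0 1) f"
  shows "integrable \<nu> f"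
proof -
  interpret finite_measure \<nu> using assms(1) by (simp add: circle_finite_def)
  obtain B where "\<And>z. z \<in> sphere 0 1 \<Longrightarrow> norm (f z) \<le> B"
    using circle_continuous_bounded[OF assms(2)] by blast
  then show ?thesis
    by (intro integrable_const_bound[of _ B] AE_I2 circle_continuous_measurable assms)
      (simp add: circle_finite_space[OF assms(1)])
qed

lemma continuous_on_circle_powi [continuous_intros]: "continuous_on (sphere 0 1) (\<lambda>z::complex. z powi k)"
  by (rule continuous_on_power_int) (auto intro: continuous_intros)

lemma circle_cnj: "z \<in> sphere 0 1 \<Longrightarrow> cnj z = inverse z"
  using complex_norm_square[of z] by (intro inverse_unique[symmetric]) (simp add: mult.commute)

lemma circle_cnj_powi: "z \<in> sphere 0 1 \<Longrightarrow> cnj (z powi k) = z powi (- k)"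
  using circle_cnj[of z] by (simp add: power_int_minus power_int_inverse complex_cnj_power_int)

text \<open>The moments are propagated to all polynomial functions by carrying along an arbitrary
  multiplier \<open>h\<close>, so that no normal form of trigonometric polynomials is needed.\<close>
lemma circle_moments_polynomial:
  assumes 1: "circle_finite \<nu>1" and 2: "circle_finite \<nu>2"
    and p: "real_polynomial_function p"
    and h: "continuous_on (sphere 0 1) h"
    and eq: "\<And>k. (\<integral>z. z powi k * h z \<partial>\<nu>1) = (\<integral>z. z powi k * h z \<partial>\<nu>2)"
  shows "(\<integral>z. z powi k * (of_real (p z) * h z) \<partial>\<nu>1) = (\<integral>z. z powi k * (of_real (p z) * h z) \<partial>\<nu>2)"
  using p h eq
proof (induction p arbitrary: h k rule: real_polynomial_function.induct)
  case (linear f)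
  \<comment> \<open>A real-linear functional is \<open>Re z * f 1 + Im z * f \<i>\<close>; these are
    its coefficients with respect to \<open>z\<close> and \<open>cnj z\<close>. On the circle
    \<open>cnj z\<close> is \<open>inverse z\<close>, so multiplication by \<open>f\<close> combines
    the moments of orders \<open>k + 1\<close> and \<open>k - 1\<close>.\<close>
  define a b where "a = complex_of_real (f 1) / 2 - \<i> * of_real (f \<i>) / 2"
    and "b = complex_of_real (f 1) / 2 + \<i> * of_real (f \<i>) / 2"
  have f: "complex_of_real (f z) = a * z + b * inverse z" if "z \<in> sphere 0 1" for z
  proof -
    have "z = Re z *\<^sub>R 1 + Im z *\<^sub>R \<i>" by (simp add: complex_eq_iff)
    then have "f z = f (Re z *\<^sub>R 1 + Im z *\<^sub>R \<i>)" by simp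
    also have "\<dots> = Re z * f 1 + Im z * f \<i>"
      using linear(1) by (simp add: linear_add linear_scale bounded_linear.linear)
    finally have "complex_of_real (f z) = a * z + b * cnj z"
      by (simp add: a_def b_def complex_eq_iff algebra_simps)
    then show ?thesis using circle_cnj[OF that] by simp
  qed
  have exp: "z powi k * (of_real (f z) * h z) = a * (z powi (k + 1) * h z) + b * (z powi (k - 1) * h z)"
    if "z \<in> sphere 0 1" for z
  proof -
    have "z \<noteq> 0" using that by auto
    then show ?thesis
      by (simp add: f[OF that] power_int_add power_int_diff field_simps)
  qed
  have "(\<integral>z. z powi k * (of_real (f z) * h z) \<partial>\<nu>)
      = a * (\<integral>z. z powi (k + 1) * h z \<partial>\<nu>) + b * (\<integral>z. z powi (k - 1) * h z \<partial>\<nu>)"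
    if "circle_finite \<nu>" for \<nu>
  proof -
    have "(\<integral>z. z powi k * (of_real (f z) * h z) \<partial>\<nu>)
        = (\<integral>z. a * (z powi (k + 1) * h z) + b * (z powi (k - 1) * h z) \<partial>\<nu>)"
      by (intro Bochner_Integration.integral_cong refl exp) (simp add: circle_finite_space[OF that])
    also have "\<dots> = a * (\<integral>z. z powi (k + 1) * h z \<partial>\<nu>) + b * (\<integral>z. z powi (k - 1) * h z \<partial>\<nu>)"
      by (subst Bochner_Integration.integral_add)
        (auto intro!: circle_continuous_integrable[OF that] continuous_intros linear)
    finally show ?thesis .
  qed
  then show ?case by (simp add: 1 2 linear)
next
  case (const c)
  then show ?case
    by (simp add: mult.left_commute[of _ "complex_of_real c"])
next
  case (add f g)
  have cont: "continuous_on (sphere 0 1) f" "continuous_on (sphere 0 1) g"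
    using add.hyps by (auto simp: real_polynomial_function_eq intro: continuous_on_polymonial_function)
  have "(\<integral>z. z powi k * (of_real (f z + g z) * h z) \<partial>\<nu>)
      = (\<integral>z. z powi k * (of_real (f z) * h z) \<partial>\<nu>) + (\<integral>z. z powi k * (of_real (g z) * h z) \<partial>\<nu>)"
    if "circle_finite \<nu>" for \<nu>
    by (subst Bochner_Integration.integral_add[symmetric])
      (auto intro!: circle_continuous_integrable[OF that] continuous_intros cont add.prems simp: algebra_simps)
  then show ?case using add.IH add.prems by (simp add: 1 2)
next
  case (mult f g)
  have "continuous_on (sphere 0 1) g"
    using mult.hyps by (auto simp: real_polynomial_function_eq intro: continuous_on_polymonial_function)
  then have "continuous_on (sphere 0 1) (\<lambda>z. of_real (g z) * h z)"
    by (intro continuous_intros mult.prems)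
  \<comment> \<open>The factor \<open>g\<close> is absorbed into the multiplier: the induction
    hypothesis for \<open>g\<close> supplies the equality of moments that the one for
    \<open>f\<close> requires with multiplier \<open>g * h\<close>.\<close>
  from mult.IH(1)[OF this mult.IH(2)[OF mult.prems]] show ?case
    by (simp add: mult.assoc)
qed

lemma circle_moments_continuous:
  fixes f :: "complex \<Rightarrow> real"
  assumes 1: "circle_finite \<nu>1" and 2: "circle_finite \<nu>2"
    and eq: "\<And>k :: int. (\<integral>z. z powi k \<partial>\<nu>1) = (\<integral>z. z powi k \<partial>\<nu>2)"
    and f: "continuous_on (sphere 0 1) f"
  shows "(\<integral>z. f z \<partial>\<nu>1) = (\<integral>z. f z \<partial>\<nu>2)"
proof (rule ccontr)
  assume ne: "(\<integral>z. f z \<partial>\<nu>1) \<noteq> (\<integral>z. f z \<partial>\<nu>2)"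
  \<comment> \<open>The extra 1 makes \<open>M\<close> positive and leaves a strict gap: the two
    approximation errors add up to at most \<open>e * (M - 1)\<close>.\<close>
  define M where "M = measure \<nu>1 (space \<nu>1) + measure \<nu>2 (space \<nu>2) + 1"
  define e where "e = \<bar>(\<integral>z. f z \<partial>\<nu>1) - (\<integral>z. f z \<partial>\<nu>2)\<bar> / M"
  have M: "M > 0" by (simp add: M_def add_nonneg_pos)
  then have e: "e > 0" using ne by (simp add: e_def)
  obtain p where p: "real_polynomial_function p" and pf: "\<And>z. z \<in> sphere 0 1 \<Longrightarrow> \<bar>f z - p z\<bar> < e"
    using Stone_Weierstrass_real_polynomial_function[OF compact_sphere f e] by blast
  have cp: "continuous_on (sphere 0 1) p"
    using p by (simp add: real_polynomial_function_eq continuous_on_polymonial_function)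
  have "(\<integral>z. z powi 0 * (complex_of_real (p z) * 1) \<partial>\<nu>1) = (\<integral>z. z powi 0 * (complex_of_real (p z) * 1) \<partial>\<nu>2)"
    by (rule circle_moments_polynomial[OF 1 2 p]) (simp_all add: eq)
  then have peq: "(\<integral>z. p z \<partial>\<nu>1) = (\<integral>z. p z \<partial>\<nu>2)" by simp
  have bd: "\<bar>(\<integral>z. f z \<partial>\<nu>) - (\<integral>z. p z \<partial>\<nu>)\<bar> \<le> e * measure \<nu> (space \<nu>)" if \<nu>: "circle_finite \<nu>" for \<nu>
  proof -
    interpret finite_measure \<nu> using \<nu> by (simp add: circle_finite_def)
    have "\<bar>(\<integral>z. f z \<partial>\<nu>) - (\<integral>z. p z \<partial>\<nu>)\<bar> = \<bar>\<integral>z. f z - p z \<partial>\<nu>\<bar>"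
      by (subst Bochner_Integration.integral_diff) (auto intro!: circle_continuous_integrable \<nu> f cp)
    also have "\<dots> \<le> (\<integral>z. \<bar>f z - p z\<bar> \<partial>\<nu>)"
      by (rule integral_abs_bound)
    also have "\<dots> \<le> (\<integral>z. e \<partial>\<nu>)"
      by (intro integral_mono circle_continuous_integrable \<nu> continuous_intros f cp less_imp_le pf)
        (simp add: circle_finite_space[OF \<nu>])
    finally show ?thesis by (simp add: mult.commute)
  qed
  have "\<bar>(\<integral>z. f z \<partial>\<nu>1) - (\<integral>z. f z \<partial>\<nu>2)\<bar> \<le> e * measure \<nu>1 (space \<nu>1) + e * measure \<nu>2 (space \<nu>2)"
    using bd[OF 1] bd[OF 2] peq by linarith
  also have "\<dots> = e * (M - 1)" by (simp add: M_def algebra_simps)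
  also have "\<dots> < e * M" using e by simp
  also have "\<dots> = \<bar>(\<integral>z. f z \<partial>\<nu>1) - (\<integral>z. f z \<partial>\<nu>2)\<bar>" using M by (simp add: e_def)
  finally show False by simp
qed

text \<open>The indicator of a closed set is a limit of continuous functions of the distance to it,
  so both measures agree on closed sets. They are pushed forward to the plane because there the
  closed sets are an intersection-stable generator.\<close>

lemma circle_measure_eqI:
  assumes 1: "circle_finite \<nu>1" and 2: "circle_finite \<nu>2"
    and eq: "\<And>k :: int. (\<integral>z. z powi k \<partial>\<nu>1) = (\<integral>z. z powi k \<partial>\<nu>2)"
  shows "\<nu>1 = \<nu>2"
proof -
  let ?D = "\<lambda>\<nu>. distr \<nu> borel (\<lambda>z :: complex. z)"
  have id: "(\<lambda>z. z) \<in> measurable \<nu> borel" if "circle_finite \<nu>" for \<nu>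
    by (rule circle_continuous_measurable[OF that]) (rule continuous_intros)
  have "emeasure (?D \<nu>1) A = emeasure (?D \<nu>2) A" if A: "closed A" for A
  \<comment> \<open>The empty set is separated because \<open>infdist\<close> to it is 0, which
    would make every \<open>g n\<close> constantly 1.\<close>
  proof (cases "A = {}")
    case False
    define g where "g n z = max 0 (1 - real n * infdist z A)" for n z
    have g: "(\<lambda>n. \<integral>z. g n z \<partial>\<nu>) \<longlonglongrightarrow> measure (?D \<nu>) A" if \<nu>: "circle_finite \<nu>" for \<nu>
    proof -
      interpret finite_measure \<nu> using \<nu> by (simp add: circle_finite_def)
      have "(\<lambda>n. \<integral>z. g n z \<partial>\<nu>) \<longlonglongrightarrow> (\<integral>z. indicator A z \<partial>\<nu>)"
      proof (rule integral_dominated_convergence[where w = "\<lambda>_. 1"])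
        show "g n \<in> borel_measurable \<nu>" for n
          unfolding g_def by (rule circle_continuous_measurable[OF \<nu>]) (intro continuous_intros)
        show "(indicator A :: complex \<Rightarrow> real) \<in> borel_measurable \<nu>"
          using measurable_compose[OF id[OF \<nu>] borel_measurable_indicator[of A borel]] A by simp
        show "AE z in \<nu>. norm (g n z) \<le> 1" for n
          by (auto simp: g_def infdist_nonneg)
        show "AE z in \<nu>. (\<lambda>n. g n z) \<longlonglongrightarrow> indicator A z"
        proof (intro AE_I2)
          fix z
          show "(\<lambda>n. g n z) \<longlonglongrightarrow> indicator A z"
          proof (cases "z \<in> A")
            case True
            then show ?thesis by (simp add: g_def)
          next
            case z: False
            then have pos: "infdist z A > 0"
              using in_closed_iff_infdist_zero[OF A False, of z] infdist_nonneg[of z A] by linarith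
            then obtain N where N: "1 < real N * infdist z A"
              using reals_Archimedean3 by blast
            have "g n z = 0" if "n \<ge> N" for n
            proof -
              have "real N * infdist z A \<le> real n * infdist z A"
                using that by (intro mult_right_mono infdist_nonneg) simp
              with N show ?thesis by (simp add: g_def)
            qed
            then show ?thesis using z
              by (intro tendsto_eventually) (auto simp: eventually_sequentially)
          qed
        qed
      qed simp
      also have "(\<integral>z. indicator A z \<partial>\<nu>) = measure (?D \<nu>) A"
        using A id[OF \<nu>] by (simp add: measure_distr Int_commute)
      finally show ?thesis .
    qed
    have "(\<integral>z. g n z \<partial>\<nu>1) = (\<integral>z. g n z \<partial>\<nu>2)" for n
      unfolding g_def by (rule circle_moments_continuous[OF 1 2 eq]) (intro continuous_intros)
    then have "measure (?D \<nu>1) A = measure (?D \<nu>2) A"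
      using g[OF 1] g[OF 2] LIMSEQ_unique by (metis (no_types, lifting) ext)
    moreover have "finite_measure (?D \<nu>1)" "finite_measure (?D \<nu>2)"
      using 1 2 id by (auto simp: circle_finite_def intro: finite_measure.finite_measure_distr)
    ultimately show ?thesis by (simp add: finite_measure.emeasure_eq_measure)
  qed simp
  note closed_eq = this
  have D: "?D \<nu>1 = ?D \<nu>2"
  proof (rule measure_eqI_generator_eq[where \<Omega> = UNIV and E = "{A. closed A}" and A = "\<lambda>_. UNIV"])
    show "Int_stable {A :: complex set. closed A}"
      by (auto simp: Int_stable_def)
    show "sets (?D \<nu>1) = sigma_sets UNIV {A. closed A}" "sets (?D \<nu>2) = sigma_sets UNIV {A. closed A}"
      by (simp_all add: borel_eq_closed)
    show "emeasure (?D \<nu>1) UNIV \<noteq> \<infinity>"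
      using finite_measure.emeasure_finite[OF finite_measure.finite_measure_distr[OF _ id[OF 1]]] 1
      by (simp add: circle_finite_def)
  qed (auto simp: closed_eq)
  show ?thesis
  proof (rule measure_eqI)
    show "sets \<nu>1 = sets \<nu>2" using 1 2 by (simp add: circle_finite_def)
    fix A assume "A \<in> sets \<nu>1"
    then have A: "A \<in> sets borel" "A \<subseteq> sphere 0 1"
      using 1 by (auto simp: circle_finite_def sets_circle_borel)
    have "emeasure (?D \<nu>) A = emeasure \<nu> A" if "circle_finite \<nu>" for \<nu>
      using A by (simp add: emeasure_distr[OF id[OF that]] circle_finite_space[OF that] Int_absorb2)
    then show "emeasure \<nu>1 A = emeasure \<nu>2 A" using D 1 2 by metis
  qed
qed

text \<open>The positive and negative parts of \<open>Re g\<close> are densities of two finite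
  measures with equal moments, so they coincide almost everywhere, and disjoint parts that coincide
  are zero. The imaginary part is the real part of \<open>- \<i> * g\<close>.\<close>

lemma circle_total:
  fixes g :: "complex \<Rightarrow> complex"
  assumes \<nu>: "circle_finite \<nu>" and g: "integrable \<nu> g"
    and moments: "\<And>k :: int. (\<integral>z. z powi k * g z \<partial>\<nu>) = 0"
  shows "AE z in \<nu>. g z = 0"
proof -
  have sp: "space \<nu> = sphere 0 1" by (rule circle_finite_space[OF \<nu>])
  interpret finite_measure \<nu> using \<nu> by (simp add: circle_finite_def)
  have powi: "(\<lambda>z. z powi k) \<in> borel_measurable \<nu>" for k :: int
    by (intro circle_continuous_measurable[OF \<nu>] continuous_intros)
  have norm_powi: "cmod (z powi k) = 1" if "z \<in> sphere 0 1" for z and k :: int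
    using that by (simp add: norm_power_int)
  have Re0: "AE z in \<nu>. Re (g z) = 0"
    if g: "integrable \<nu> g" and moments: "\<And>k :: int. (\<integral>z. z powi k * g z \<partial>\<nu>) = 0" for g
  proof -
    have gm [measurable]: "g \<in> borel_measurable \<nu>" using g by simp
    have int: "integrable \<nu> (\<lambda>z. z powi k * h z)" if "integrable \<nu> h" for h :: "complex \<Rightarrow> complex" and k :: int
      by (rule Bochner_Integration.integrable_bound[OF that])
        (use that powi sp in \<open>auto simp: norm_mult norm_powi intro!: AE_I2\<close>)
    \<comment> \<open>Only \<open>s = 1\<close> and \<open>s = - 1\<close> are used: the positive
      and the negative part of \<open>Re g\<close>.\<close>
    define D where "D s = density \<nu> (\<lambda>z. ennreal (max 0 (s * Re (g z))))" for s :: real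
    have intm: "integrable \<nu> (\<lambda>z. max 0 (s * Re (g z)))" for s
      by (rule Bochner_Integration.integrable_bound[of _ "\<lambda>z. s * Re (g z)"])
        (use g in auto)
    have D: "circle_finite (D s)" for s
    proof -
      have "emeasure (D s) (space (D s)) = (\<integral>\<^sup>+z. ennreal (max 0 (s * Re (g z))) \<partial>\<nu>)"
        unfolding D_def by (subst emeasure_density) (auto intro!: nn_integral_cong)
      also have "\<dots> = ennreal (\<integral>z. max 0 (s * Re (g z)) \<partial>\<nu>)"
        by (rule nn_integral_eq_integral[OF intm]) simp
      finally have "emeasure (D s) (space (D s)) = ennreal (\<integral>z. max 0 (s * Re (g z)) \<partial>\<nu>)" .
      then have "finite_measure (D s)" by (intro finite_measureI) simp
      then show ?thesis using \<nu> by (simp add: circle_finite_def D_def)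
    qed
    have mom: "(\<integral>z. z powi k \<partial>D s) = (\<integral>z. z powi k * of_real (max 0 (s * Re (g z))) \<partial>\<nu>)" for s k
      unfolding D_def by (subst integral_density)
        (use powi in \<open>auto simp: scaleR_conv_of_real mult.commute\<close>)
    have "(\<integral>z. z powi k \<partial>D 1) - (\<integral>z. z powi k \<partial>D (- 1)) = 0" for k
    proof -
      have "(\<integral>z. z powi k \<partial>D 1) - (\<integral>z. z powi k \<partial>D (- 1))
          = (\<integral>z. z powi k * of_real (max 0 (1 * Re (g z))) - z powi k * of_real (max 0 (- 1 * Re (g z))) \<partial>\<nu>)"
        unfolding mom using integrable_of_real[OF intm, of 1] integrable_of_real[OF intm, of "- 1"]
        by (subst Bochner_Integration.integral_diff) (auto intro!: int)
      \<comment> \<open>The vanishing moments concern \<open>g\<close>, not \<open>Re g\<close>. The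
        conjugate of \<open>g\<close> is reached through the moment of order \<open>- k\<close>,
        since on the circle conjugation inverts powers of z.\<close>
      also have "\<dots> = (\<integral>z. (z powi k * g z + cnj (z powi (- k) * g z)) / 2 \<partial>\<nu>)"
      proof (rule Bochner_Integration.integral_cong)
        fix z assume "z \<in> space \<nu>"
        then have "cnj (z powi (- k)) = z powi k" using sp circle_cnj_powi[of z "- k"] by simp
        moreover have "complex_of_real (max 0 (1 * Re (g z))) - of_real (max 0 (- 1 * Re (g z))) = (g z + cnj (g z)) / 2"
          by (simp add: complex_add_cnj max_def)
        ultimately show "z powi k * of_real (max 0 (1 * Re (g z))) - z powi k * of_real (max 0 (- 1 * Re (g z)))
            = (z powi k * g z + cnj (z powi (- k) * g z)) / 2"
          by (simp only: right_diff_distrib[symmetric] complex_cnj_mult) (simp add: algebra_simps)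
      qed simp
      also have "\<dots> = ((\<integral>z. z powi k * g z \<partial>\<nu>) + cnj (\<integral>z. z powi (- k) * g z \<partial>\<nu>)) / 2"
        using int[OF g] by (simp add: Bochner_Integration.integral_add del: complex_cnj_mult
            Bochner_Integration.integral_cnj flip: Bochner_Integration.integral_cnj)
      finally show ?thesis by (simp add: moments)
    qed
    then have "D 1 = D (- 1)"
      by (intro circle_measure_eqI D) simp
    then have "AE z in \<nu>. ennreal (max 0 (1 * Re (g z))) = ennreal (max 0 (- 1 * Re (g z)))"
      unfolding D_def by (intro density_unique) auto
    then show ?thesis
      by eventually_elim (auto simp: max_def split: if_splits)
  qed
  have "AE z in \<nu>. Re (- \<i> * g z) = 0"
  proof (rule Re0)
    show "(\<integral>z. z powi k * (- \<i> * g z) \<partial>\<nu>) = 0" for k :: int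
    proof -
      have "(\<lambda>z. z powi k * (- \<i> * g z)) = (\<lambda>z. - \<i> * (z powi k * g z))"
        by (simp add: fun_eq_iff)
      then show ?thesis by (simp only: integral_mult_right_zero moments mult_zero_right)
    qed
  qed (use g in simp)
  with Re0[OF g moments] show ?thesis
    by eventually_elim (simp add: complex_eq_iff)
qed

section \<open>Square-integrable functions\<close>

text \<open>Elements are functions, not classes modulo null sets. Equality almost everywhere is
  accounted for later by \<open>coeff_map_eq_iff\<close>.\<close>

definition L2 :: "'a measure \<Rightarrow> ('a \<Rightarrow> complex) \<Rightarrow> bool" where
  "L2 M f \<longleftrightarrow> f \<in> borel_measurable M \<and> integrable M (\<lambda>x. (cmod (f x))\<^sup>2)"

definition l2_inner :: "'a measure \<Rightarrow> ('a \<Rightarrow> complex) \<Rightarrow> ('a \<Rightarrow> complex) \<Rightarrow> complex" where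
  "l2_inner M f g = (\<integral>x. cnj (f x) * g x \<partial>M)"

definition l2_sq :: "'a measure \<Rightarrow> ('a \<Rightarrow> complex) \<Rightarrow> real" where
  "l2_sq M f = (\<integral>x. (cmod (f x))\<^sup>2 \<partial>M)"

lemma borel_measurable_cnj [measurable]:
  "f \<in> borel_measurable M \<Longrightarrow> (\<lambda>x. cnj (f x)) \<in> borel_measurable M"
  by (rule measurable_compose[OF _ borel_measurable_continuous_onI[OF continuous_on_cnj[OF continuous_on_id]]])

lemma L2_measurable: "L2 M f \<Longrightarrow> f \<in> borel_measurable M"
  and L2_integrable: "L2 M f \<Longrightarrow> integrable M (\<lambda>x. (cmod (f x))\<^sup>2)"
  by (simp_all add: L2_def)

lemma L2_add: "L2 M f \<Longrightarrow> L2 M g \<Longrightarrow> L2 M (\<lambda>x. f x + g x)"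
  unfolding L2_def
proof (elim conjE, intro conjI)
  assume f: "f \<in> borel_measurable M" "integrable M (\<lambda>x. (cmod (f x))\<^sup>2)"
    and g: "g \<in> borel_measurable M" "integrable M (\<lambda>x. (cmod (g x))\<^sup>2)"
  show "integrable M (\<lambda>x. (cmod (f x + g x))\<^sup>2)"
  proof (rule Bochner_Integration.integrable_bound)
    show "integrable M (\<lambda>x. 2 * (cmod (f x))\<^sup>2 + 2 * (cmod (g x))\<^sup>2)"
      using f g by simp
  qed (use f g cmod_add_square_le in auto)
qed simp

lemma L2_mult_bounded:
  assumes "L2 M f" "h \<in> borel_measurable M" "\<And>x. x \<in> space M \<Longrightarrow> cmod (h x) \<le> B"
  shows "L2 M (\<lambda>x. h x * f x)"
  unfolding L2_def
proof
  show "integrable M (\<lambda>x. (cmod (h x * f x))\<^sup>2)"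
  proof (rule Bochner_Integration.integrable_bound)
    show "integrable M (\<lambda>x. B\<^sup>2 * (cmod (f x))\<^sup>2)"
      using assms by (simp add: L2_def)
    show "AE x in M. norm ((cmod (h x * f x))\<^sup>2) \<le> norm (B\<^sup>2 * (cmod (f x))\<^sup>2)"
      using assms(3) by (auto simp: norm_mult power_mult_distrib intro!: AE_I2 mult_right_mono power_mono)
  qed (use assms in \<open>auto simp: L2_def\<close>)
qed (use assms in \<open>auto simp: L2_def\<close>)

lemma L2_scale: "L2 M f \<Longrightarrow> L2 M (\<lambda>x. c * f x)"
  by (rule L2_mult_bounded[of _ _ _ "cmod c"]) auto

lemma L2_diff: "L2 M f \<Longrightarrow> L2 M g \<Longrightarrow> L2 M (\<lambda>x. f x - g x)"
  using L2_add[of M f "\<lambda>x. (- 1) * g x"] L2_scale[of M g "- 1"] by simp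

lemma L2_cnj: "L2 M f \<Longrightarrow> L2 M (\<lambda>x. cnj (f x))"
  by (auto simp: L2_def)

lemma L2_zero: "L2 M (\<lambda>_. 0)"
  by (simp add: L2_def)

lemma L2_sum: "(\<And>i. i \<in> A \<Longrightarrow> L2 M (f i)) \<Longrightarrow> L2 M (\<lambda>x. \<Sum>i\<in>A. f i x)"
  by (induction A rule: infinite_finite_induct) (auto intro: L2_add L2_zero)

lemma L2_indicator: "L2 M f \<Longrightarrow> A \<in> sets M \<Longrightarrow> L2 M (\<lambda>x. indicator A x * f x)"
  by (rule L2_mult_bounded[of _ _ _ 1]) (auto simp: indicator_def)

lemma L2_inner_integrable: "L2 M f \<Longrightarrow> L2 M g \<Longrightarrow> integrable M (\<lambda>x. cnj (f x) * g x)"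
proof (rule Bochner_Integration.integrable_bound)
  assume f: "L2 M f" and g: "L2 M g"
  then show "integrable M (\<lambda>x. (cmod (f x))\<^sup>2 + (cmod (g x))\<^sup>2)"
    by (simp add: L2_def)
  have "cmod a * cmod b \<le> (cmod a)\<^sup>2 + (cmod b)\<^sup>2" for a b
    using sum_squares_bound[of "cmod a" "cmod b"] mult_nonneg_nonneg[OF norm_ge_zero[of a] norm_ge_zero[of b]]
    by linarith
  then show "AE x in M. norm (cnj (f x) * g x) \<le> norm ((cmod (f x))\<^sup>2 + (cmod (g x))\<^sup>2)"
    by (simp add: norm_mult)
qed (auto simp: L2_def)

lemma l2_inner_add_right:
  "L2 M f \<Longrightarrow> L2 M g \<Longrightarrow> L2 M h \<Longrightarrow> l2_inner M f (\<lambda>x. g x + h x) = l2_inner M f g + l2_inner M f h"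
  unfolding l2_inner_def
  by (subst Bochner_Integration.integral_add[symmetric]) (simp_all add: L2_inner_integrable distrib_left)

lemma l2_inner_scale_right: "l2_inner M f (\<lambda>x. c * g x) = c * l2_inner M f g"
  unfolding l2_inner_def by (simp add: mult.left_commute[of _ c])

lemma l2_inner_cnj: "cnj (l2_inner M f g) = l2_inner M g f"
  using Bochner_Integration.integral_cnj[of M "\<lambda>x. cnj (f x) * g x"]
  by (simp add: l2_inner_def mult.commute del: Bochner_Integration.integral_cnj)

lemma l2_inner_add_left:
  "L2 M f \<Longrightarrow> L2 M g \<Longrightarrow> L2 M h \<Longrightarrow> l2_inner M (\<lambda>x. f x + g x) h = l2_inner M f h + l2_inner M g h"
  using arg_cong[OF l2_inner_add_right[of M h f g], of cnj] by (simp only: complex_cnj_add l2_inner_cnj)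

lemma l2_inner_scale_left: "l2_inner M (\<lambda>x. c * f x) g = cnj c * l2_inner M f g"
  using arg_cong[OF l2_inner_scale_right[of M g c f], of cnj] by (simp only: complex_cnj_mult l2_inner_cnj)

lemma l2_inner_diff_right:
  "L2 M f \<Longrightarrow> L2 M g \<Longrightarrow> L2 M h \<Longrightarrow> l2_inner M f (\<lambda>x. g x - h x) = l2_inner M f g - l2_inner M f h"
  using l2_inner_add_right[of M f g "\<lambda>x. (- 1) * h x"] l2_inner_scale_right[of M f "- 1" h] L2_scale[of M h "- 1"]
  by simp

lemma l2_inner_zero: "l2_inner M f (\<lambda>_. 0) = 0" "l2_inner M (\<lambda>_. 0) f = 0"
  by (simp_all add: l2_inner_def)

lemma l2_inner_sum_right:
  assumes "L2 M f" "\<And>i. i \<in> A \<Longrightarrow> L2 M (g i)"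
  shows "l2_inner M f (\<lambda>x. \<Sum>i\<in>A. g i x) = (\<Sum>i\<in>A. l2_inner M f (g i))"
  using assms(2)
  by (induction A rule: infinite_finite_induct)
    (simp_all add: l2_inner_zero l2_inner_add_right[OF assms(1) _ L2_sum])

lemma l2_inner_self: "l2_inner M f f = of_real (l2_sq M f)"
  unfolding l2_inner_def l2_sq_def
  by (simp add: complex_norm_square mult.commute flip: integral_complex_of_real of_real_power)

lemma l2_sq_nonneg: "0 \<le> l2_sq M f"
  by (simp add: l2_sq_def)

lemma l2_sq_scale: "l2_sq M (\<lambda>x. c * f x) = (cmod c)\<^sup>2 * l2_sq M f"
  by (simp add: l2_sq_def norm_mult power_mult_distrib)

lemma l2_sq_add:
  assumes "L2 M f" "L2 M g"
  shows "l2_sq M (\<lambda>x. f x + g x) = l2_sq M f + l2_sq M g + 2 * Re (l2_inner M f g)"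
proof -
  have "of_real (l2_sq M (\<lambda>x. f x + g x))
      = of_real (l2_sq M f) + of_real (l2_sq M g) + (l2_inner M f g + cnj (l2_inner M f g))"
    using assms by (simp add: l2_inner_self[symmetric] l2_inner_add_left l2_inner_add_right L2_add
        l2_inner_cnj)
  from arg_cong[OF this, of Re] show ?thesis by simp
qed

lemma l2_sq_diff:
  assumes "L2 M f" "L2 M g"
  shows "l2_sq M (\<lambda>x. f x - g x) = l2_sq M f + l2_sq M g - 2 * Re (l2_inner M f g)"
  using l2_sq_add[OF assms(1) L2_scale[OF assms(2), of "- 1"]] l2_sq_scale[of M "- 1" g]
    l2_inner_scale_right[of M f "- 1" g]
  by simp

lemma l2_sq_eq_0_iff: "L2 M f \<Longrightarrow> l2_sq M f = 0 \<longleftrightarrow> (AE x in M. f x = 0)"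
  unfolding l2_sq_def L2_def by (subst integral_nonneg_eq_0_iff_AE) auto

lemma l2_Cauchy_Schwarz:
  assumes f: "L2 M f" and g: "L2 M g"
  shows "(cmod (l2_inner M f g))\<^sup>2 \<le> l2_sq M f * l2_sq M g"
proof (cases "l2_sq M f = 0")
  case True
  then have "AE x in M. f x = 0" using l2_sq_eq_0_iff[OF f] by simp
  then have "l2_inner M f g = (\<integral>x. 0 \<partial>M)"
    unfolding l2_inner_def using f g by (intro integral_cong_AE) (auto simp: L2_def)
  then show ?thesis using True by simp
next
  case False
  then have pos: "l2_sq M f > 0" using l2_sq_nonneg[of M f] by simp
  define c where "c = l2_inner M f g"
  \<comment> \<open>\<open>t * f\<close> is the orthogonal projection of \<open>g\<close> onto the
    line of \<open>f\<close>; the inequality says that the remainder has nonnegative square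
    norm.\<close>
  define t where "t = c / of_real (l2_sq M f)"
  have "0 \<le> l2_sq M (\<lambda>x. g x - t * f x)" by (rule l2_sq_nonneg)
  also have "\<dots> = l2_sq M g + (cmod t)\<^sup>2 * l2_sq M f - 2 * Re (t * l2_inner M g f)"
    by (simp add: l2_sq_diff[OF g L2_scale[OF f]] l2_sq_scale l2_inner_scale_right)
  also have "t * l2_inner M g f = of_real ((cmod c)\<^sup>2 / l2_sq M f)"
    by (simp add: t_def l2_inner_cnj[of M f g, symmetric] c_def[symmetric] complex_norm_square
        del: of_real_power)
  also have "(cmod t)\<^sup>2 * l2_sq M f = (cmod c)\<^sup>2 / l2_sq M f"
    using pos by (simp add: t_def norm_divide power_divide power2_eq_square)
  finally have "(cmod c)\<^sup>2 / l2_sq M f \<le> l2_sq M g" by simp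
  then show ?thesis using pos by (simp add: c_def field_simps)
qed

lemma l2_tendsto_inner:
  assumes "L2 M f" "L2 M g" "\<And>n. L2 M (u n)" "(\<lambda>n. l2_sq M (\<lambda>x. u n x - g x)) \<longlonglongrightarrow> 0"
  shows "(\<lambda>n. l2_inner M f (u n)) \<longlonglongrightarrow> l2_inner M f g"
proof -
  have "(\<lambda>n. (cmod (l2_inner M f (u n) - l2_inner M f g))\<^sup>2) \<longlonglongrightarrow> 0"
  proof (rule tendsto_sandwich[OF _ _ tendsto_const])
    show "\<forall>\<^sub>F n in sequentially. (cmod (l2_inner M f (u n) - l2_inner M f g))\<^sup>2
        \<le> l2_sq M f * l2_sq M (\<lambda>x. u n x - g x)"
      using l2_Cauchy_Schwarz[OF assms(1) L2_diff[OF assms(3,2)]]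
      by (simp add: l2_inner_diff_right[OF assms(1,3,2)])
    show "(\<lambda>n. l2_sq M f * l2_sq M (\<lambda>x. u n x - g x)) \<longlonglongrightarrow> 0"
      using tendsto_mult_left[OF assms(4), of "l2_sq M f"] by simp
  qed simp
  then have "(\<lambda>n. cmod (l2_inner M f (u n) - l2_inner M f g)) \<longlonglongrightarrow> 0"
    using tendsto_real_sqrt by fastforce
  then show ?thesis by (rule LIM_zero_cancel[OF tendsto_norm_zero_cancel])
qed

text \<open>The classical argument: a subsequence with geometrically small steps converges almost
  everywhere, and Fatou's lemma bounds the distance of the whole sequence to its limit.\<close>

lemma (in finite_measure) L2_complete:
  assumes u: "\<And>n. L2 M (u n)"
    and cauchy: "\<And>e. 0 < e \<Longrightarrow> \<exists>N. \<forall>m\<ge>N. \<forall>n\<ge>N. l2_sq M (\<lambda>x. u m x - u n x) < e"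
  obtains f where "L2 M f" "(\<lambda>n. l2_sq M (\<lambda>x. u n x - f x)) \<longlonglongrightarrow> 0"
proof -
  have um [measurable]: "u n \<in> borel_measurable M" for n using u by (simp add: L2_def)
  have "\<forall>i. \<exists>N. \<forall>m\<ge>N. \<forall>n\<ge>N. l2_sq M (\<lambda>x. u m x - u n x) < (1 / 4) ^ i"
    by (intro allI cauchy) simp
  then obtain K where K: "\<And>i m n. m \<ge> K i \<Longrightarrow> n \<ge> K i \<Longrightarrow> l2_sq M (\<lambda>x. u m x - u n x) < (1 / 4) ^ i"
    by metis
  \<comment> \<open>Cumulative sums guarantee that \<open>r i\<close> lies beyond every threshold
    \<open>K j\<close> with \<open>j \<le> i\<close>, although \<open>K\<close> itself need not be
    monotone.\<close>
  define r where "r i = (\<Sum>j\<le>i. K j)" for i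
  have r: "K j \<le> r i" if "j \<le> i" for i j
    unfolding r_def using that by (intro member_le_sum) auto
  define d where "d i x = u (r (Suc i)) x - u (r i) x" for i x
  have dL2: "L2 M (d i)" for i unfolding d_def by (intro L2_diff u)
  have dm [measurable]: "d i \<in> borel_measurable M" for i using dL2 by (simp add: L2_def)
  define V where "V = measure M (space M)"
  \<comment> \<open>Cauchy-Schwarz against the constant 1 converts the square-norm bound into a
    bound on the integral, at the cost of the square root of the total mass
    \<open>V\<close>.\<close>
  have d1: "(\<integral>\<^sup>+x. ennreal (cmod (d i x)) \<partial>M) \<le> ennreal (sqrt V * (1 / 2) ^ i)" for i
  proof -
    let ?a = "\<lambda>x. complex_of_real (cmod (d i x))"
    have a: "L2 M ?a" "L2 M (\<lambda>_. 1)" using dL2 by (simp_all add: L2_def)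
    have int: "integrable M (\<lambda>x. cmod (d i x))"
      using integrable_norm[OF L2_inner_integrable[OF a(2,1)]] by simp
    have "l2_inner M (\<lambda>_. 1) ?a = of_real (\<integral>x. cmod (d i x) \<partial>M)"
      by (simp add: l2_inner_def)
    then have "(\<integral>x. cmod (d i x) \<partial>M)\<^sup>2 = (cmod (l2_inner M (\<lambda>_. 1) ?a))\<^sup>2"
      by simp
    also have "\<dots> \<le> l2_sq M (\<lambda>_. 1) * l2_sq M ?a"
      by (rule l2_Cauchy_Schwarz[OF a(2,1)])
    also have "l2_sq M ?a = l2_sq M (d i)" by (simp add: l2_sq_def)
    also have "l2_sq M (\<lambda>_. 1) = V" by (simp add: l2_sq_def V_def)
    also have "V * l2_sq M (d i) \<le> V * (1 / 4) ^ i"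
      using K[of i "r (Suc i)" "r i"] r[of i i] r[of i "Suc i"] by (intro mult_left_mono) (simp_all add: V_def d_def[abs_def])
    also have "\<dots> = (sqrt V * (1 / 2) ^ i)\<^sup>2"
    proof -
      have "(1 / 4 :: real) ^ i = ((1 / 2) ^ i)\<^sup>2"
        by (simp add: power2_eq_square flip: power_mult_distrib)
      then show ?thesis by (simp add: V_def power_mult_distrib)
    qed
    finally have "(\<integral>x. cmod (d i x) \<partial>M) \<le> sqrt V * (1 / 2) ^ i"
      by (rule power2_le_imp_le) (simp add: V_def)
    then show ?thesis
      by (subst nn_integral_eq_integral[OF int]) (auto intro: ennreal_leI)
  qed
  have "(\<integral>\<^sup>+x. (\<Sum>i. ennreal (cmod (d i x))) \<partial>M) = (\<Sum>i. \<integral>\<^sup>+x. ennreal (cmod (d i x)) \<partial>M)"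
    by (rule nn_integral_suminf) simp
  also have "\<dots> \<le> (\<Sum>i. ennreal (sqrt V * (1 / 2) ^ i))"
    by (intro suminf_le d1) auto
  also have "\<dots> < \<infinity>"
    by (subst suminf_ennreal2) (auto intro!: summable_mult summable_geometric simp: V_def)
  finally have "AE x in M. (\<Sum>i. ennreal (cmod (d i x))) \<noteq> \<infinity>"
    by (intro nn_integral_noteq_infinite) auto
  then have conv: "AE x in M. convergent (\<lambda>i. u (r i) x)"
  proof eventually_elim
    case (elim x)
    have "summable (\<lambda>i. cmod (d i x))"
      by (rule summable_suminf_not_top) (use elim in auto)
    then have "summable (\<lambda>i. d i x)" by (rule summable_norm_cancel)
    then have "convergent (\<lambda>n. \<Sum>i<n. d i x)" by (simp add: summable_iff_convergent)
    moreover have "(\<Sum>i<n. d i x) = u (r n) x - u (r 0) x" for n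
      unfolding d_def by (rule sum_lessThan_telescope)
    ultimately have "convergent (\<lambda>n. (u (r n) x - u (r 0) x) + u (r 0) x)"
      by (intro convergent_add convergent_const) simp
    then show ?case by simp
  qed
  define f where "f x = lim (\<lambda>i. u (r i) x)" for x
  have fm [measurable]: "f \<in> borel_measurable M" unfolding f_def by measurable
  have lim: "AE x in M. (\<lambda>i. u (r i) x) \<longlonglongrightarrow> f x"
    using conv by eventually_elim (simp add: f_def convergent_LIMSEQ_iff)
  \<comment> \<open>The limit is taken only along \<open>r i\<close>, while \<open>n\<close> stays
    fixed; Fatou's lemma then gives a bound for every \<open>n\<close> past
    \<open>K j\<close>.\<close>
  have bound: "(\<integral>\<^sup>+x. ennreal ((cmod (u n x - f x))\<^sup>2) \<partial>M) \<le> ennreal ((1 / 4) ^ j)" if n: "n \<ge> K j" for n j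
  proof -
    have "(\<integral>\<^sup>+x. ennreal ((cmod (u n x - f x))\<^sup>2) \<partial>M)
        = (\<integral>\<^sup>+x. liminf (\<lambda>i. ennreal ((cmod (u n x - u (r i) x))\<^sup>2)) \<partial>M)"
    proof (rule nn_integral_cong_AE)
      show "AE x in M. ennreal ((cmod (u n x - f x))\<^sup>2) = liminf (\<lambda>i. ennreal ((cmod (u n x - u (r i) x))\<^sup>2))"
        using lim
        by eventually_elim (intro lim_imp_Liminf[symmetric] tendsto_ennrealI tendsto_intros, simp_all)
    qed
    also have "\<dots> \<le> liminf (\<lambda>i. \<integral>\<^sup>+x. ennreal ((cmod (u n x - u (r i) x))\<^sup>2) \<partial>M)"
      by (rule nn_integral_liminf) simp
    also have "\<dots> \<le> liminf (\<lambda>i. ennreal ((1 / 4) ^ j))"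
    proof (rule Liminf_mono)
      show "\<forall>\<^sub>F i in sequentially. (\<integral>\<^sup>+x. ennreal ((cmod (u n x - u (r i) x))\<^sup>2) \<partial>M) \<le> ennreal ((1 / 4) ^ j)"
        using eventually_ge_at_top[of j]
      proof eventually_elim
        case (elim i)
        have "(\<integral>\<^sup>+x. ennreal ((cmod (u n x - u (r i) x))\<^sup>2) \<partial>M) = ennreal (l2_sq M (\<lambda>x. u n x - u (r i) x))"
          unfolding l2_sq_def using L2_diff[OF u u] by (intro nn_integral_eq_integral) (auto simp: L2_def)
        also have "\<dots> \<le> ennreal ((1 / 4) ^ j)"
          by (intro ennreal_leI less_imp_le K n r elim)
        finally show ?case .
      qed
    qed
    finally show ?thesis by (simp add: Liminf_const)
  qed
  have diffL2: "L2 M (\<lambda>x. u n x - f x)" if "n \<ge> K j" for n j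
    unfolding L2_def
  proof
    show "integrable M (\<lambda>x. (cmod (u n x - f x))\<^sup>2)"
    proof (rule integrableI_bounded)
      have "(\<integral>\<^sup>+x. ennreal (norm ((cmod (u n x - f x))\<^sup>2)) \<partial>M) \<le> ennreal ((1 / 4) ^ j)"
        using bound[OF that] by simp
      also have "\<dots> < \<infinity>" by simp
      finally show "(\<integral>\<^sup>+x. ennreal (norm ((cmod (u n x - f x))\<^sup>2)) \<partial>M) < \<infinity>" .
    qed simp
  qed simp
  have le: "l2_sq M (\<lambda>x. u n x - f x) \<le> (1 / 4) ^ j" if "n \<ge> K j" for n j
    using bound[OF that] diffL2[OF that] unfolding l2_sq_def
    by (subst (asm) nn_integral_eq_integral) (auto simp: L2_def)
  have "L2 M f"
    using L2_diff[OF u[of "K 0"] diffL2[OF order_refl, of 0]] by simp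
  moreover have "(\<lambda>n. l2_sq M (\<lambda>x. u n x - f x)) \<longlonglongrightarrow> 0"
  proof (rule LIMSEQ_I)
    fix e :: real assume "e > 0"
    then obtain j where j: "(1 / 4 :: real) ^ j < e"
      using real_arch_pow_inv[of e "1 / 4"] by auto
    show "\<exists>no. \<forall>n\<ge>no. norm (l2_sq M (\<lambda>x. u n x - f x) - 0) < e"
      using le j l2_sq_nonneg[of M] by (intro exI[of _ "K j"]) (auto intro: le_less_trans)
  qed
  ultimately show ?thesis by (rule that)
qed

section \<open>Orthonormal bases and the coefficient map\<close>

locale l2_basis = finite_measure +
  fixes \<psi> :: "nat \<Rightarrow> 'a \<Rightarrow> complex"
  assumes basis_L2: "L2 M (\<psi> k)"
    and orthonormal: "l2_inner M (\<psi> j) (\<psi> k) = (if j = k then 1 else 0)"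
    and total: "L2 M g \<Longrightarrow> (\<And>k. l2_inner M (\<psi> k) g = 0) \<Longrightarrow> AE x in M. g x = 0"
begin

text \<open>Meaningful for square-integrable \<open>g\<close>, where Bessel's inequality supplies
  the summability that \<open>Abs_ell2\<close> requires.\<close>

definition coeff_map :: "('a \<Rightarrow> complex) \<Rightarrow> ell2" where
  "coeff_map g = Abs_ell2 (\<lambda>k. l2_inner M (\<psi> k) g)"

lemma L2_combination: "L2 M (\<lambda>x. \<Sum>k\<in>A. c k * \<psi> k x)"
  by (intro L2_sum L2_scale basis_L2)

lemma inner_combination: "finite A \<Longrightarrow> l2_inner M (\<psi> j) (\<lambda>x. \<Sum>k\<in>A. c k * \<psi> k x) = (if j \<in> A then c j else 0)"
  by (subst l2_inner_sum_right)
    (simp_all add: L2_scale basis_L2 l2_inner_scale_right orthonormal if_distrib cong: if_cong)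

lemma l2_inner_combination_left:
  assumes "L2 M g"
  shows "l2_inner M (\<lambda>x. \<Sum>k\<in>A. c k * \<psi> k x) g = (\<Sum>k\<in>A. cnj (c k) * l2_inner M (\<psi> k) g)"
proof -
  have "l2_inner M g (\<lambda>x. \<Sum>k\<in>A. c k * \<psi> k x) = (\<Sum>k\<in>A. c k * l2_inner M g (\<psi> k))"
    by (subst l2_inner_sum_right) (simp_all add: L2_scale basis_L2 assms l2_inner_scale_right)
  from arg_cong[OF this, of cnj] show ?thesis by (simp add: l2_inner_cnj)
qed

lemma l2_sq_combination: "finite A \<Longrightarrow> l2_sq M (\<lambda>x. \<Sum>k\<in>A. c k * \<psi> k x) = (\<Sum>k\<in>A. (cmod (c k))\<^sup>2)"
proof -
  assume A: "finite A"
  have "complex_of_real (l2_sq M (\<lambda>x. \<Sum>k\<in>A. c k * \<psi> k x)) = (\<Sum>k\<in>A. cnj (c k) * c k)"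
    by (simp add: l2_inner_self[symmetric] l2_inner_combination_left[OF L2_combination]
        inner_combination[OF A])
  also have "\<dots> = of_real (\<Sum>k\<in>A. (cmod (c k))\<^sup>2)"
    by (simp add: complex_norm_square mult.commute del: of_real_power)
  finally show ?thesis by (simp only: of_real_eq_iff)
qed

lemma bessel:
  assumes g: "L2 M g"
  shows "l2_sq M (\<lambda>x. (\<Sum>k<n. l2_inner M (\<psi> k) g * \<psi> k x) - g x)
      = l2_sq M g - (\<Sum>k<n. (cmod (l2_inner M (\<psi> k) g))\<^sup>2)"
proof -
  have "complex_of_real (\<Sum>k<n. (cmod (l2_inner M (\<psi> k) g))\<^sup>2)
      = l2_inner M (\<lambda>x. \<Sum>k<n. l2_inner M (\<psi> k) g * \<psi> k x) g"
    unfolding l2_inner_combination_left[OF g]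
    by (simp add: complex_norm_square mult.commute del: of_real_power)
  from arg_cong[OF this, of Re]
  have "Re (l2_inner M (\<lambda>x. \<Sum>k<n. l2_inner M (\<psi> k) g * \<psi> k x) g) = (\<Sum>k<n. (cmod (l2_inner M (\<psi> k) g))\<^sup>2)"
    by (simp only: Re_complex_of_real)
  then show ?thesis
    by (simp add: l2_sq_diff[OF L2_combination g] l2_sq_combination)
qed

lemma bessel_summable:
  assumes "L2 M g"
  shows "summable (\<lambda>k. (cmod (l2_inner M (\<psi> k) g))\<^sup>2)"
proof (rule bounded_imp_summable)
  show "(\<Sum>k\<le>n. (cmod (l2_inner M (\<psi> k) g))\<^sup>2) \<le> l2_sq M g" for n
    using bessel[OF assms, of "Suc n"] l2_sq_nonneg[of M "\<lambda>x. (\<Sum>k<Suc n. l2_inner M (\<psi> k) g * \<psi> k x) - g x"]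
    by (simp add: lessThan_Suc_atMost)
qed simp

lemma coeff_map_nth: "L2 M g \<Longrightarrow> ell2_nth (coeff_map g) k = l2_inner M (\<psi> k) g"
  unfolding coeff_map_def by (simp add: ell2_nth_Abs bessel_summable)

text \<open>Surjectivity of the coefficient map. The norm identity is recorded for the preimage
  built here; totality extends it to all preimages in \<open>norm_coeff_map\<close>.\<close>

lemma riesz_fischer:
  obtains h where "L2 M h" "coeff_map h = x" "l2_sq M h = (norm x)\<^sup>2"
proof -
  define s where "s n z = (\<Sum>k<n. ell2_nth x k * \<psi> k z)" for n z
  let ?u = "\<lambda>k. (cmod (ell2_nth x k))\<^sup>2"
  have s: "L2 M (s n)" for n unfolding s_def by (rule L2_combination)
  have diff: "l2_sq M (\<lambda>z. s m z - s n z) = \<bar>sum ?u {..<m} - sum ?u {..<n}\<bar>" for m n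
  proof -
    have *: "l2_sq M (\<lambda>z. s m z - s n z) = \<bar>sum ?u {..<m} - sum ?u {..<n}\<bar>" if "n \<le> m" for m n
    proof -
      have "{..<m} - {..<n} = {n..<m}" by auto
      then have d: "sum f {..<m} - sum f {..<n} = sum f {n..<m}" for f :: "nat \<Rightarrow> 'c :: ab_group_add"
        using sum_diff[of "{..<m}" "{..<n}" f] that by simp
      show ?thesis
        unfolding s_def d by (simp add: l2_sq_combination sum_nonneg)
    qed
    show ?thesis
    proof (cases "n \<le> m")
      case False
      have "l2_sq M (\<lambda>z. s m z - s n z) = l2_sq M (\<lambda>z. s n z - s m z)"
        by (simp add: l2_sq_def norm_minus_commute)
      then show ?thesis using *[of m n] False by (simp add: abs_minus_commute)
    qed (rule *)
  qed
  obtain h where h: "L2 M h" "(\<lambda>n. l2_sq M (\<lambda>z. s n z - h z)) \<longlonglongrightarrow> 0"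
  proof (rule L2_complete[of s, OF s])
    fix e :: real assume e: "0 < e"
    have "Cauchy (\<lambda>n. sum ?u {..<n})"
      using ell2_summable[of x] by (simp add: summable_iff_convergent convergent_Cauchy)
    from CauchyD[OF this e] show "\<exists>N. \<forall>m\<ge>N. \<forall>n\<ge>N. l2_sq M (\<lambda>z. s m z - s n z) < e"
      by (simp add: diff)
  qed
  have coeff: "l2_inner M (\<psi> k) h = ell2_nth x k" for k
  proof (rule LIMSEQ_unique[OF l2_tendsto_inner[OF basis_L2 h(1) s h(2)]])
    have "\<forall>\<^sub>F n in sequentially. l2_inner M (\<psi> k) (s n) = ell2_nth x k"
      using eventually_gt_at_top[of k]
      by eventually_elim (simp add: s_def[abs_def] inner_combination)
    then show "(\<lambda>n. l2_inner M (\<psi> k) (s n)) \<longlonglongrightarrow> ell2_nth x k"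
      by (rule tendsto_eventually)
  qed
  have Th: "coeff_map h = x"
    by (rule ell2_eqI) (simp add: coeff_map_nth h coeff)
  have "(\<lambda>n. l2_sq M h - sum ?u {..<n}) \<longlonglongrightarrow> 0"
    using h(2) bessel[OF h(1)] by (simp add: s_def[abs_def] coeff)
  moreover have "(\<lambda>n. l2_sq M h - sum ?u {..<n}) \<longlonglongrightarrow> l2_sq M h - suminf ?u"
    by (intro tendsto_intros summable_LIMSEQ ell2_summable)
  ultimately have "l2_sq M h = suminf ?u"
    using LIMSEQ_unique by fastforce
  also have "\<dots> = (norm x)\<^sup>2"
    using cinner_self[of x] cinner_norm[of x] by (simp only: of_real_eq_iff)
  finally show ?thesis using that h(1) Th by blast
qed

lemma coeff_map_add: "L2 M f \<Longrightarrow> L2 M g \<Longrightarrow> coeff_map (\<lambda>x. f x + g x) = coeff_map f + coeff_map g"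
  by (rule ell2_eqI) (simp add: coeff_map_nth L2_add ell2_nth_simps l2_inner_add_right basis_L2)

lemma coeff_map_diff: "L2 M f \<Longrightarrow> L2 M g \<Longrightarrow> coeff_map (\<lambda>x. f x - g x) = coeff_map f - coeff_map g"
  by (rule ell2_eqI) (simp add: coeff_map_nth L2_diff ell2_nth_simps l2_inner_diff_right basis_L2)

lemma coeff_map_scale: "L2 M f \<Longrightarrow> coeff_map (\<lambda>x. c * f x) = scaleC c (coeff_map f)"
  by (rule ell2_eqI) (simp add: coeff_map_nth L2_scale ell2_nth_simps l2_inner_scale_right)

lemma l2_inner_cong_AE:
  assumes "L2 M f" "L2 M g" "AE x in M. f x = g x"
  shows "l2_inner M (\<psi> k) f = l2_inner M (\<psi> k) g"
  unfolding l2_inner_def using assms basis_L2[of k]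
  by (intro integral_cong_AE) (auto simp: L2_def)

lemma coeff_map_eq_iff:
  assumes "L2 M f" "L2 M g"
  shows "coeff_map f = coeff_map g \<longleftrightarrow> (AE x in M. f x = g x)"
proof
  assume "coeff_map f = coeff_map g"
  then have "l2_inner M (\<psi> k) (\<lambda>x. f x - g x) = 0" for k
    using assms by (simp add: l2_inner_diff_right basis_L2 coeff_map_nth[symmetric])
  then have "AE x in M. f x - g x = 0" by (intro total L2_diff assms) 
  then show "AE x in M. f x = g x" by simp
next
  assume "AE x in M. f x = g x"
  then show "coeff_map f = coeff_map g"
    using l2_inner_cong_AE[OF assms] by (intro ell2_eqI) (simp add: coeff_map_nth assms)
qed

text \<open>Parseval's identity: the preimage from \<open>riesz_fischer\<close> has the right norm,
  and by totality it agrees with \<open>g\<close> almost everywhere.\<close>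

lemma norm_coeff_map:
  assumes "L2 M g"
  shows "(norm (coeff_map g))\<^sup>2 = l2_sq M g"
proof -
  obtain h where h: "L2 M h" "coeff_map h = coeff_map g" "l2_sq M h = (norm (coeff_map g))\<^sup>2"
    by (rule riesz_fischer)
  then have "AE x in M. h x = g x" using coeff_map_eq_iff assms by blast
  then have "l2_sq M h = l2_sq M g"
    unfolding l2_sq_def using h(1) assms by (intro integral_cong_AE) (auto simp: L2_def)
  then show ?thesis using h(3) by simp
qed

lemma cinner_coeff_map:
  assumes f: "L2 M f" and g: "L2 M g"
  shows "cinner (coeff_map f) (coeff_map g) = l2_inner M f g"
proof -
  have Re: "coeff_map f \<bullet> coeff_map g = Re (l2_inner M f g)" if g: "L2 M g" for g
    using l2_sq_add[OF f g] norm_coeff_map[OF L2_add[OF f g]] f g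
    by (simp add: coeff_map_add dot_norm norm_coeff_map)
  show ?thesis
  proof (rule complex_eqI)
    show "Re (cinner (coeff_map f) (coeff_map g)) = Re (l2_inner M f g)"
      by (simp add: Re_cinner Re g)
    show "Im (cinner (coeff_map f) (coeff_map g)) = Im (l2_inner M f g)"
      unfolding Im_cinner
      using Re[OF L2_scale[OF g, of "- \<i>"]]
      by (simp add: coeff_map_scale[OF g, symmetric] l2_inner_scale_right[of M f "- \<i>" g, simplified])
  qed
qed

lemma coeff_map_tendsto:
  assumes "L2 M f" "\<And>n. L2 M (u n)" "((\<lambda>n. l2_sq M (\<lambda>x. u n x - f x)) \<longlongrightarrow> 0) F"
  shows "((\<lambda>n. coeff_map (u n)) \<longlongrightarrow> coeff_map f) F"
proof -
  have "l2_sq M (\<lambda>x. u n x - f x) = (norm (coeff_map (u n) - coeff_map f))\<^sup>2" for n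
    using norm_coeff_map[OF L2_diff[OF assms(2,1)]] by (simp add: coeff_map_diff assms)
  then have "((\<lambda>n. sqrt ((norm (coeff_map (u n) - coeff_map f))\<^sup>2)) \<longlongrightarrow> sqrt 0) F"
    using assms(3) by (intro tendsto_real_sqrt) simp
  then show ?thesis
    by (simp add: LIM_zero_cancel[OF tendsto_norm_zero_cancel])
qed

text \<open>An inverse of the coefficient map; the chosen function is determined only up to a null
  set.\<close>

definition repr :: "ell2 \<Rightarrow> 'a \<Rightarrow> complex" where
  "repr x = (SOME h. L2 M h \<and> coeff_map h = x)"

lemma repr: "L2 M (repr x)" "coeff_map (repr x) = x"
proof -
  have "\<exists>h. L2 M h \<and> coeff_map h = x" using riesz_fischer[of x] by blast
  from someI_ex[OF this] show "L2 M (repr x)" "coeff_map (repr x) = x"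
    by (simp_all add: repr_def)
qed

lemma repr_coeff_map: "L2 M g \<Longrightarrow> AE x in M. repr (coeff_map g) x = g x"
  using coeff_map_eq_iff[OF repr(1), of g "coeff_map g"] by (simp add: repr(2))

end

section \<open>Orthogonal polynomials on the unit circle\<close>

lemma circle_cnj_mult: "z \<in> sphere 0 1 \<Longrightarrow> cnj z * z = 1"
  using complex_norm_square[of z] by (simp add: mult.commute)

text \<open>The reversed polynomial of Szego theory, reversed at the degree of \<open>p\<close>. For
  \<open>Phi n\<close> that degree is \<open>n\<close>, so this is the usual n-th reversal.\<close>

definition star_poly :: "complex poly \<Rightarrow> complex poly" where
  "star_poly p = map_poly cnj (reflect_poly p)"

lemma coeff_star_poly: "coeff (star_poly p) i = (if i \<le> degree p then cnj (coeff p (degree p - i)) else 0)"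
  by (simp add: star_poly_def coeff_map_poly coeff_reflect_poly)

lemma degree_star_poly: "degree (star_poly p) \<le> degree p"
  by (rule degree_le) (simp add: coeff_star_poly)

lemma poly_star_poly:
  assumes "z \<in> sphere 0 1"
  shows "poly (star_poly p) z = z ^ degree p * cnj (poly p z)"
proof -
  have "z \<noteq> 0" using assms by auto
  then have z: "cnj z \<noteq> 0" "inverse (cnj z) = z" by (simp_all add: circle_cnj[OF assms])
  have "poly (star_poly p) z = cnj (poly (reflect_poly p) (cnj z))"
    unfolding star_poly_def by (subst poly_cnj) simp
  also have "\<dots> = z ^ degree p * cnj (poly p z)"
    unfolding poly_reflect_poly_nz[OF z(1)] z(2) by simp
  finally show ?thesis .
qed

section \<open>Monic orthogonal polynomials and their recursion\<close>

locale opuc =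
  fixes \<mu> :: "complex measure"
  assumes prob: "circle_prob \<mu>" and nontrivial: "nontrivial_measure \<mu>"
begin

sublocale prob_space \<mu>
  using prob by (simp add: circle_prob_def)

lemma finite_circle: "circle_finite \<mu>"
  using prob finite_measure_axioms by (simp add: circle_prob_def circle_finite_def)

lemma space_mu: "space \<mu> = sphere 0 1"
  by (rule circle_finite_space[OF finite_circle])

lemma L2_continuous: "continuous_on (sphere 0 1) f \<Longrightarrow> L2 \<mu> f"
  unfolding L2_def
  by (intro conjI circle_continuous_measurable[OF finite_circle] circle_continuous_integrable[OF finite_circle]
      continuous_intros)

lemma L2_poly: "L2 \<mu> (poly p)"
  by (intro L2_continuous continuous_intros)

lemma L2_power: "L2 \<mu> (\<lambda>z. z ^ n)"
  by (intro L2_continuous continuous_intros)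

lemma L2_powi_mult: "L2 \<mu> f \<Longrightarrow> L2 \<mu> (\<lambda>z. z powi k * f z)"
  by (rule L2_mult_bounded[of _ _ _ 1])
    (auto intro!: circle_continuous_measurable[OF finite_circle] continuous_intros
      simp: space_mu norm_power_int)

lemma l2_inner_cong:
  "(\<And>z. z \<in> sphere 0 1 \<Longrightarrow> cnj (f z) * g z = cnj (f' z) * g' z) \<Longrightarrow> l2_inner \<mu> f g = l2_inner \<mu> f' g'"
  unfolding l2_inner_def by (rule Bochner_Integration.integral_cong) (simp_all add: space_mu)

lemma l2_sq_cong: "(\<And>z. z \<in> sphere 0 1 \<Longrightarrow> cmod (f z) = cmod (g z)) \<Longrightarrow> l2_sq \<mu> f = l2_sq \<mu> g"
  unfolding l2_sq_def by (rule Bochner_Integration.integral_cong) (simp_all add: space_mu)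

text \<open>Here nontriviality enters: if a nonzero polynomial vanished almost everywhere, the
  measure would sit on its finitely many zeros on the circle and be a combination of point masses
  there.\<close>

lemma poly_null:
  assumes "l2_sq \<mu> (poly p) = 0"
  shows "p = 0"
proof (rule ccontr)
  assume p: "p \<noteq> 0"
  define F where "F = {z. poly p z = 0} \<inter> sphere 0 1"
  have F: "finite F" unfolding F_def using poly_roots_finite[OF p] by blast
  have sets: "A \<in> sets \<mu> \<longleftrightarrow> A \<in> sets borel \<and> A \<subseteq> sphere 0 1" for A
    using finite_circle by (simp add: circle_finite_def sets_circle_borel)
  have Fsub: "B \<in> sets \<mu>" if "B \<subseteq> F" for B
    unfolding sets
  proof
    have "finite B" using F that finite_subset by blast
    then show "B \<in> sets borel" by (intro borel_closed finite_imp_closed)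
  qed (use that F_def in auto)
  have ae: "AE z in \<mu>. z \<in> F"
    using assms l2_sq_eq_0_iff[OF L2_poly] AE_space[of \<mu>] by (auto simp: F_def space_mu)
  have "measure \<mu> A = (\<Sum>z\<in>F. measure \<mu> {z} * indicator A z)" if A: "A \<in> sets \<mu>" for A
  proof -
    have "measure \<mu> A = measure \<mu> (A \<inter> F)"
      by (rule finite_measure_eq_AE) (use ae A Fsub in auto)
    also have "\<dots> = (\<Sum>z\<in>A \<inter> F. measure \<mu> {z})"
      by (rule finite_measure_eq_sum_singleton) (use F Fsub in auto)
    also have "\<dots> = (\<Sum>z\<in>F. measure \<mu> {z} * indicator A z)"
      by (rule sum.mono_neutral_cong_left) (use F in \<open>auto simp: indicator_def\<close>)
    finally show ?thesis .
  qed
  then have "\<forall>A\<in>sets \<mu>. measure \<mu> A = (\<Sum>z\<in>F. measure \<mu> {z} * indicator A z)" by (rule ballI)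
  moreover have "F \<subseteq> sphere 0 1" by (simp add: F_def)
  ultimately have "\<exists>F c. finite F \<and> F \<subseteq> sphere 0 1 \<and>
      (\<forall>A\<in>sets \<mu>. measure \<mu> A = (\<Sum>z\<in>F. c z * indicator A z))"
    using F by (intro exI[of _ F] exI[of _ "\<lambda>z. measure \<mu> {z}"] conjI)
  then show False using nontrivial unfolding nontrivial_measure_def by (rule notE[rotated])
qed

lemma inner_poly_left:
  assumes "L2 \<mu> g"
  shows "l2_inner \<mu> (poly p) g = (\<Sum>i\<le>degree p. cnj (coeff p i) * l2_inner \<mu> (\<lambda>z. z ^ i) g)"
proof -
  have "l2_inner \<mu> g (poly p) = (\<Sum>i\<le>degree p. coeff p i * l2_inner \<mu> g (\<lambda>z. z ^ i))"
    unfolding poly_altdef[abs_def]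
    by (subst l2_inner_sum_right) (simp_all add: assms L2_scale L2_power l2_inner_scale_right)
  from arg_cong[OF this, of cnj] show ?thesis by (simp add: l2_inner_cnj)
qed

text \<open>The Szego recursion, with the coefficient that makes \<open>Phi (Suc n)\<close> orthogonal to \<open>1\<close>.\<close>
primrec Phi :: "nat \<Rightarrow> complex poly" where
  "Phi 0 = 1"
| "Phi (Suc n) = pCons 0 (Phi n)
     - smult (l2_inner \<mu> (\<lambda>_. 1) (poly (pCons 0 (Phi n))) / of_real (l2_sq \<mu> (poly (Phi n)))) (star_poly (Phi n))"

definition N :: "nat \<Rightarrow> real" where "N n = l2_sq \<mu> (poly (Phi n))"

text \<open>Conjugated so that the recursion takes its standard form with \<open>cnj (a n)\<close>;
  \<open>verblunsky_eq\<close> shows that these are the Verblunsky coefficients.\<close>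

definition a :: "nat \<Rightarrow> complex" where
  "a n = cnj (l2_inner \<mu> (\<lambda>_. 1) (poly (pCons 0 (Phi n))) / of_real (N n))"

lemma Phi_Suc: "Phi (Suc n) = pCons 0 (Phi n) - smult (cnj (a n)) (star_poly (Phi n))"
  by (simp add: a_def N_def)

declare Phi.simps(2) [simp del]

lemma degree_Phi: "degree (Phi n) = n" and lead_coeff_Phi: "coeff (Phi n) n = 1"
proof -
  have "degree (Phi n) = n \<and> coeff (Phi n) n = 1"
  proof (induction n)
    case (Suc n)
    then have c: "coeff (Phi (Suc n)) (Suc n) = 1"
      by (simp add: Phi_Suc coeff_star_poly)
    have "degree (Phi (Suc n)) \<le> Suc n"
      unfolding Phi_Suc
      by (intro degree_diff_le order_trans[OF degree_pCons_le] order_trans[OF degree_smult_le]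
          order_trans[OF degree_star_poly]) (use Suc in simp_all)
    moreover have "Suc n \<le> degree (Phi (Suc n))" by (rule le_degree) (simp add: c)
    ultimately show ?case using c by simp
  qed simp
  then show "degree (Phi n) = n" "coeff (Phi n) n = 1" by auto
qed

lemma N_pos: "N n > 0"
proof -
  have "Phi n \<noteq> 0" using lead_coeff_Phi[of n] by auto
  then have "N n \<noteq> 0" using poly_null by (auto simp: N_def)
  then show ?thesis using l2_sq_nonneg[of \<mu> "poly (Phi n)"] by (simp add: N_def)
qed

lemma N_0: "N 0 = 1"
  by (simp add: N_def l2_sq_def prob_space[unfolded space_mu] space_mu)

text \<open>On the circle the reversed polynomial is \<open>z ^ n * cnj (poly (Phi n) z)\<close>, so
  reversal exchanges the powers \<open>j\<close> and \<open>n - j\<close>.\<close>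

lemma inner_power_star:
  assumes "j \<le> n"
  shows "l2_inner \<mu> (\<lambda>z. z ^ j) (poly (star_poly (Phi n))) = cnj (l2_inner \<mu> (\<lambda>z. z ^ (n - j)) (poly (Phi n)))"
proof -
  have "l2_inner \<mu> (\<lambda>z. z ^ j) (poly (star_poly (Phi n))) = l2_inner \<mu> (poly (Phi n)) (\<lambda>z. z ^ (n - j))"
  proof (rule l2_inner_cong)
    fix z :: complex assume z: "z \<in> sphere 0 1"
    then have "cnj z * z = 1" by (rule circle_cnj_mult)
    then have "cnj (z ^ j) * z ^ n = z ^ (n - j)"
      using assms power_mult_distrib[of "cnj z" z j] power_add[of z j "n - j"]
      by (simp add: mult.assoc[symmetric])
    then show "cnj (z ^ j) * poly (star_poly (Phi n)) z = cnj (poly (Phi n) z) * z ^ (n - j)"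
      by (simp only: poly_star_poly[OF z] degree_Phi mult.assoc[symmetric]) (simp add: mult.commute)
  qed
  then show ?thesis by (simp add: l2_inner_cnj)
qed

lemma inner_power_shift: "l2_inner \<mu> (\<lambda>z. z ^ Suc j) (poly (pCons 0 p)) = l2_inner \<mu> (\<lambda>z. z ^ j) (poly p)"
proof (rule l2_inner_cong)
  fix z :: complex assume z: "z \<in> sphere 0 1"
  then have 1: "cnj z * z = 1" by (rule circle_cnj_mult)
  have "cnj (z ^ Suc j) * poly (pCons 0 p) z = (cnj z * z) * (cnj (z ^ j) * poly p z)" by simp
  then show "cnj (z ^ Suc j) * poly (pCons 0 p) z = cnj (z ^ j) * poly p z" by (simp only: 1 mult_1)
qed

lemma l2_sq_star: "l2_sq \<mu> (poly (star_poly (Phi n))) = N n"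
  unfolding N_def by (rule l2_sq_cong) (simp add: poly_star_poly norm_mult norm_power)

text \<open>Orthogonality is a hypothesis because this is applied inside the induction that proves
  it; only the leading term of \<open>Phi n\<close> survives.\<close>

lemma inner_Phi_self_of_orth:
  assumes "\<And>j. j < n \<Longrightarrow> l2_inner \<mu> (\<lambda>z. z ^ j) (poly (Phi n)) = 0"
  shows "l2_inner \<mu> (\<lambda>z. z ^ n) (poly (Phi n)) = of_real (N n)"
proof -
  have "of_real (N n) = (\<Sum>i\<le>n. cnj (coeff (Phi n) i) * l2_inner \<mu> (\<lambda>z. z ^ i) (poly (Phi n)))"
    using inner_poly_left[OF L2_poly, of "Phi n" "Phi n"]
    by (simp only: N_def l2_inner_self[symmetric] degree_Phi)
  also have "\<dots> = cnj (coeff (Phi n) n) * l2_inner \<mu> (\<lambda>z. z ^ n) (poly (Phi n))"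
    using assms by (subst sum.remove[of _ n]) (auto intro!: sum.neutral)
  finally show ?thesis by (simp add: lead_coeff_Phi)
qed

text \<open>For \<open>j = 0\<close> the recursion coefficient is chosen to make the two terms
  cancel; for \<open>j > 0\<close> each term vanishes by the induction hypothesis, one after a shift
  of the power and the other after reversal.\<close>

lemma Phi_orth: "j < n \<Longrightarrow> l2_inner \<mu> (\<lambda>z. z ^ j) (poly (Phi n)) = 0"
proof (induction n arbitrary: j)
  case (Suc n)
  have split: "l2_inner \<mu> (\<lambda>z. z ^ j) (poly (Phi (Suc n)))
      = l2_inner \<mu> (\<lambda>z. z ^ j) (poly (pCons 0 (Phi n)))
        - cnj (a n) * l2_inner \<mu> (\<lambda>z. z ^ j) (poly (star_poly (Phi n)))" for j
  proof -
    have "poly (Phi (Suc n)) = (\<lambda>z. poly (pCons 0 (Phi n)) z - cnj (a n) * poly (star_poly (Phi n)) z)"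
      by (simp add: Phi_Suc fun_eq_iff)
    then show ?thesis
      by (simp only: l2_inner_diff_right L2_power L2_poly L2_scale l2_inner_scale_right)
  qed
  show ?case
  proof (cases j)
    case 0
    have "l2_inner \<mu> (\<lambda>z. z ^ 0) (poly (star_poly (Phi n))) = of_real (N n)"
      unfolding inner_power_star[OF le0] by (simp add: inner_Phi_self_of_orth[OF Suc.IH])
    then show ?thesis
      using N_pos[of n] unfolding 0 split by (simp add: a_def)
  next
    case j: (Suc i)
    have "l2_inner \<mu> (\<lambda>z. z ^ j) (poly (star_poly (Phi n))) = 0"
      using Suc.prems j by (subst inner_power_star) (simp_all add: Suc.IH)
    moreover have "l2_inner \<mu> (\<lambda>z. z ^ j) (poly (pCons 0 (Phi n))) = 0"
      using Suc.prems j unfolding j inner_power_shift by (simp add: Suc.IH)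
    ultimately show ?thesis by (simp add: split)
  qed
qed simp

lemmas inner_Phi_self = inner_Phi_self_of_orth[OF Phi_orth]

lemma inner_poly_Phi: "(\<And>i. i \<ge> n \<Longrightarrow> coeff p i = 0) \<Longrightarrow> l2_inner \<mu> (poly p) (poly (Phi n)) = 0"
  unfolding inner_poly_left[OF L2_poly]
  by (rule sum.neutral) (metis Phi_orth complex_cnj_zero mult_zero_left mult_zero_right not_le)

lemma monic_orthogonal_Phi: "monic_orthogonal_polys \<mu> Phi"
proof -
  have lt: "l2_inner \<mu> (poly (Phi m)) (poly (Phi n)) = 0" if "m < n" for m n
    using that by (intro inner_poly_Phi coeff_eq_0) (simp add: degree_Phi)
  have "l2_inner \<mu> (poly (Phi m)) (poly (Phi n)) = 0" if "m \<noteq> n" for m n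
    using lt[of m n] lt[of n m] that l2_inner_cnj[of \<mu> "poly (Phi n)" "poly (Phi m)"]
    by (cases "m < n") auto
  then show ?thesis
    by (simp add: monic_orthogonal_polys_def degree_Phi lead_coeff_Phi l2_inner_def)
qed

text \<open>The difference of two monic candidates has degree below \<open>n\<close>, hence is
  orthogonal to both of them and therefore to itself; then \<open>poly_null\<close> applies.\<close>

lemma monic_orthogonal_unique:
  assumes "monic_orthogonal_polys \<mu> \<Phi>"
  shows "\<Phi> = Phi"
proof
  fix n
  have deg: "degree (\<Phi> n) = n" and lead: "coeff (\<Phi> n) n = 1" for n
    using assms unfolding monic_orthogonal_polys_def by (metis, metis)
  have orth: "l2_inner \<mu> (poly (\<Phi> m)) (poly (\<Phi> n)) = 0" if "m \<noteq> n" for m n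
    using assms that by (simp add: monic_orthogonal_polys_def l2_inner_def)
  \<comment> \<open>Orthogonality to the lower polynomials becomes orthogonality to powers, because
    the monic family is triangular with respect to the powers.\<close>
  have pow: "l2_inner \<mu> (\<lambda>z. z ^ j) (poly (\<Phi> n)) = 0" if "j < n" for j
    using that
  proof (induction j rule: less_induct)
    case (less j)
    have "0 = l2_inner \<mu> (poly (\<Phi> j)) (poly (\<Phi> n))" using less.prems by (simp add: orth)
    also have "\<dots> = (\<Sum>i\<le>j. cnj (coeff (\<Phi> j) i) * l2_inner \<mu> (\<lambda>z. z ^ i) (poly (\<Phi> n)))"
      by (simp add: inner_poly_left[OF L2_poly] deg)
    also have "\<dots> = cnj (coeff (\<Phi> j) j) * l2_inner \<mu> (\<lambda>z. z ^ j) (poly (\<Phi> n))"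
      using less by (subst sum.remove[of _ j]) (auto intro!: sum.neutral)
    finally show ?case by (simp add: lead)
  qed
  define D where "D = \<Phi> n - Phi n"
  have D: "coeff D i = 0" if "i \<ge> n" for i
    using that by (cases "i = n") (simp_all add: D_def lead lead_coeff_Phi coeff_eq_0 deg degree_Phi)
  have "l2_inner \<mu> (poly D) (poly (\<Phi> n)) = 0"
    unfolding inner_poly_left[OF L2_poly] using D pow
    by (intro sum.neutral) (metis complex_cnj_zero mult_zero_left mult_zero_right not_le)
  then have "l2_inner \<mu> (poly D) (\<lambda>z. poly (\<Phi> n) z - poly (Phi n) z) = 0"
    by (simp add: l2_inner_diff_right L2_poly inner_poly_Phi D)
  moreover have "poly D = (\<lambda>z. poly (\<Phi> n) z - poly (Phi n) z)" by (simp add: D_def fun_eq_iff)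
  ultimately have "l2_inner \<mu> (poly D) (poly D) = 0" by (simp only:)
  then have "D = 0" by (intro poly_null) (simp add: l2_inner_self)
  then show "\<Phi> n = Phi n" by (simp add: D_def)
qed

lemma monic_OPUC_eq: "monic_OPUC \<mu> = Phi"
  unfolding monic_OPUC_def
  by (rule the_equality) (rule monic_orthogonal_Phi, rule monic_orthogonal_unique)

text \<open>At 0 the shifted term of the recursion vanishes and the reversed polynomial takes the
  leading coefficient 1 as its value.\<close>

lemma verblunsky_eq: "verblunsky \<mu> = a"
proof
  fix n
  have "poly (star_poly (Phi n)) 0 = 1"
    by (simp add: poly_0_coeff_0 coeff_star_poly degree_Phi lead_coeff_Phi)
  then show "verblunsky \<mu> n = a n"
    by (simp add: verblunsky_def monic_OPUC_eq Phi_Suc)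
qed

text \<open>Pythagoras for z Phi_n, split by the recursion: the reversed polynomial has degree at
  most \<open>n\<close> and is thus orthogonal to \<open>Phi (Suc n)\<close>, while multiplication
  by z and reversal preserve the norm on the circle.\<close>

lemma N_Suc: "N (Suc n) = (1 - (cmod (a n))\<^sup>2) * N n"
proof -
  have eq: "poly (pCons 0 (Phi n)) = (\<lambda>z. poly (Phi (Suc n)) z + cnj (a n) * poly (star_poly (Phi n)) z)"
    by (simp add: Phi_Suc fun_eq_iff)
  have "l2_inner \<mu> (poly (star_poly (Phi n))) (poly (Phi (Suc n))) = 0"
    using degree_star_poly[of "Phi n"] by (intro inner_poly_Phi coeff_eq_0) (simp add: degree_Phi)
  then have orth: "l2_inner \<mu> (poly (Phi (Suc n))) (poly (star_poly (Phi n))) = 0"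
    by (metis l2_inner_cnj complex_cnj_zero)
  have "N n = l2_sq \<mu> (poly (pCons 0 (Phi n)))"
    unfolding N_def by (rule l2_sq_cong) (simp add: norm_mult)
  also have "\<dots> = N (Suc n) + (cmod (a n))\<^sup>2 * N n"
    unfolding eq by (simp add: l2_sq_add L2_poly L2_scale l2_sq_scale l2_inner_scale_right orth l2_sq_star)
      (simp add: N_def)
  finally show ?thesis by (simp add: algebra_simps)
qed

lemma cmod_a: "cmod (a n) < 1"
proof -
  have "(1 - (cmod (a n))\<^sup>2) > 0"
    using N_pos[of "Suc n"] N_pos[of n] unfolding N_Suc by (simp add: zero_less_mult_iff)
  then show ?thesis by (simp add: power2_less_1_iff abs_square_less_1)
qed

end

section \<open>Normalized polynomials and the CMV bases\<close>

lemma circle_powi_Suc: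
  fixes z :: complex
  assumes "z \<in> sphere 0 1"
  shows "z * z powi m = z powi (m + 1)"
proof -
  have "z \<noteq> 0" using assms by auto
  then show ?thesis by (simp add: power_int_add)
qed

context opuc
begin

definition \<rho> :: "nat \<Rightarrow> real" where "\<rho> n = sqrt (1 - (cmod (a n))\<^sup>2)"

definition phi :: "nat \<Rightarrow> complex \<Rightarrow> complex" where
  "phi n z = poly (Phi n) z / of_real (sqrt (N n))"

definition phis :: "nat \<Rightarrow> complex \<Rightarrow> complex" where
  "phis n z = poly (star_poly (Phi n)) z / of_real (sqrt (N n))"

lemma rho_pos: "\<rho> n > 0"
  using cmod_a[of n] by (simp add: \<rho>_def abs_square_less_1)

lemma rho_square: "complex_of_real (\<rho> n) * of_real (\<rho> n) = 1 - a n * cnj (a n)"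
proof -
  have "\<rho> n * \<rho> n = 1 - (cmod (a n))\<^sup>2"
    using cmod_a[of n] by (simp add: \<rho>_def abs_square_le_1 less_imp_le)
  then have "complex_of_real (\<rho> n) * of_real (\<rho> n) = of_real (1 - (cmod (a n))\<^sup>2)"
    by (simp only: of_real_mult[symmetric])
  then show ?thesis by (simp add: complex_norm_square del: of_real_power)
qed

lemma sqrt_N_Suc: "sqrt (N (Suc n)) = \<rho> n * sqrt (N n)"
  by (simp add: N_Suc \<rho>_def real_sqrt_mult)

lemma L2_phi: "L2 \<mu> (phi n)" and L2_phis: "L2 \<mu> (phis n)"
  unfolding phi_def[abs_def] phis_def[abs_def]
  by (intro L2_continuous continuous_intros; use N_pos[of n] in simp)+

lemma phis_phi:
  assumes "z \<in> sphere 0 1"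
  shows "phis n z = z ^ n * cnj (phi n z)"
  by (simp add: phis_def phi_def poly_star_poly[OF assms] degree_Phi)

lemma szego_1:
  "of_real (\<rho> n) * phi (Suc n) z = z * phi n z - cnj (a n) * phis n z"
  using N_pos[of n] rho_pos[of n]
  by (simp add: phi_def phis_def Phi_Suc sqrt_N_Suc field_simps)

text \<open>The reversal of \<open>szego_1\<close>. Together with \<open>szego_3\<close> it
  expresses \<open>phis n\<close> and \<open>phi (Suc n)\<close> through \<open>z * phi n\<close>
  and \<open>phis (Suc n)\<close>; the coefficient matrix is the entrywise conjugate of
  \<open>Theta (a n)\<close>, and the antilinear first slot of the inner product undoes the
  conjugation.\<close>

lemma szego_2:
  assumes z: "z \<in> sphere 0 1"
  shows "phis n z = a n * (z * phi n z) + of_real (\<rho> n) * phis (Suc n) z"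
proof -
  have zz: "cnj z * z = 1" by (rule circle_cnj_mult[OF z])
  then have zn: "cnj (z ^ n) * z ^ n = 1" by (simp flip: power_mult_distrib)
  have "of_real (\<rho> n) * phis (Suc n) z = z ^ Suc n * cnj (of_real (\<rho> n) * phi (Suc n) z)"
    by (simp add: phis_phi[OF z])
  also have "\<dots> = (cnj z * z) * (z ^ n * cnj (phi n z)) - a n * z * (cnj (z ^ n) * z ^ n) * phi n z"
    unfolding szego_1 by (simp add: phis_phi[OF z] algebra_simps)
  also have "\<dots> = phis n z - a n * (z * phi n z)"
    unfolding zz zn by (simp add: phis_phi[OF z])
  finally show ?thesis by simp
qed

text \<open>Obtained by eliminating \<open>phis n\<close> from \<open>szego_1\<close> and
  \<open>szego_2\<close>; the relation between \<open>\<rho> n\<close> and \<open>a n\<close> allows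
  one factor \<open>\<rho> n\<close> to be cancelled.\<close>

lemma szego_3:
  assumes z: "z \<in> sphere 0 1"
  shows "phi (Suc n) z = of_real (\<rho> n) * (z * phi n z) - cnj (a n) * phis (Suc n) z"
proof -
  have "of_real (\<rho> n) * (phi (Suc n) z + cnj (a n) * phis (Suc n) z)
      = (1 - a n * cnj (a n)) * (z * phi n z)"
    using szego_1[of n z] szego_2[OF z, of n] by algebra
  also have "\<dots> = of_real (\<rho> n) * (of_real (\<rho> n) * (z * phi n z))"
    by (simp add: rho_square flip: mult.assoc)
  finally have "phi (Suc n) z + cnj (a n) * phis (Suc n) z = of_real (\<rho> n) * (z * phi n z)"
    using rho_pos[of n] by simp
  then show ?thesis by (simp add: algebra_simps)
qed

lemma l2_sq_phi: "l2_sq \<mu> (phi n) = 1" and l2_sq_phis: "l2_sq \<mu> (phis n) = 1"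
proof -
  have "phi n = (\<lambda>z. (1 / of_real (sqrt (N n))) * poly (Phi n) z)" by (simp add: phi_def fun_eq_iff)
  then have "l2_sq \<mu> (phi n) = (cmod (1 / of_real (sqrt (N n))))\<^sup>2 * N n"
    by (simp only: l2_sq_scale N_def)
  also have "\<dots> = 1"
    using N_pos[of n] by (simp add: norm_divide power_divide)
  finally show "l2_sq \<mu> (phi n) = 1" .
  moreover have "l2_sq \<mu> (phis n) = l2_sq \<mu> (phi n)"
    by (rule l2_sq_cong) (simp add: phis_phi norm_mult norm_power)
  ultimately show "l2_sq \<mu> (phis n) = 1" by simp
qed

lemma inner_poly_phi: "(\<And>i. i \<ge> n \<Longrightarrow> coeff p i = 0) \<Longrightarrow> l2_inner \<mu> (poly p) (phi n) = 0"
  using l2_inner_scale_right[of \<mu> "poly p" "1 / of_real (sqrt (N n))" "poly (Phi n)"]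
  by (simp add: phi_def[abs_def] inner_poly_Phi)

lemma inner_power_phis:
  assumes "j \<le> n"
  shows "l2_inner \<mu> (\<lambda>z. z ^ j) (phis n) = (if j = 0 then of_real (sqrt (N n)) else 0)"
proof -
  have "l2_inner \<mu> (\<lambda>z. z ^ j) (phis n)
      = 1 / of_real (sqrt (N n)) * l2_inner \<mu> (\<lambda>z. z ^ j) (poly (star_poly (Phi n)))"
    unfolding l2_inner_scale_right[symmetric] by (simp add: phis_def[abs_def])
  also have "\<dots> = (if j = 0 then of_real (N n / sqrt (N n)) else 0)"
    using assms by (simp add: inner_power_star inner_Phi_self Phi_orth)
  finally show ?thesis
    using N_pos[of n] by (simp only: real_div_sqrt less_imp_le)
qed

text \<open>Reproducing property: on polynomials of degree at most \<open>n\<close>, pairing with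
  \<open>phis n\<close> is evaluation at 0 up to conjugation and the factor
  \<open>sqrt (N n)\<close>. The later inner products of reversed polynomials all come from
  it.\<close>

lemma inner_poly_phis:
  assumes "degree p \<le> n"
  shows "l2_inner \<mu> (poly p) (phis n) = cnj (coeff p 0) * of_real (sqrt (N n))"
proof -
  have "l2_inner \<mu> (poly p) (phis n)
      = (\<Sum>i\<le>degree p. cnj (coeff p i) * (if i = 0 then of_real (sqrt (N n)) else 0))"
    unfolding inner_poly_left[OF L2_phis] using assms by (intro sum.cong) (simp_all add: inner_power_phis)
  also have "\<dots> = cnj (coeff p 0) * of_real (sqrt (N n))"
    by (subst sum.remove[of _ 0]) simp_all
  finally show ?thesis .
qed

text \<open>The CMV basis \<open>psi\<close> orthonormalizes \<open>1, z, z\<^sup>-\<^sup>1, z\<^sup>2, \<dots>\<close>, and the alternate basis \<open>xi\<close>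
  orthonormalizes \<open>1, z\<^sup>-\<^sup>1, z, z\<^sup>-\<^sup>2, \<dots>\<close>; \<open>L\<close> and \<open>M\<close> are the transition matrices between them.\<close>

definition psi :: "nat \<Rightarrow> complex \<Rightarrow> complex" where
  "psi i z = z powi (- int (i div 2)) * (if even i then phis i z else phi i z)"

definition xi :: "nat \<Rightarrow> complex \<Rightarrow> complex" where
  "xi i z = z powi (- int (Suc i div 2)) * (if even i then phi i z else phis i z)"

lemma L2_psi: "L2 \<mu> (psi i)" and L2_xi: "L2 \<mu> (xi i)"
  unfolding psi_def[abs_def] xi_def[abs_def]
  by (intro L2_powi_mult; cases "even i"; simp add: L2_phi L2_phis)+

lemma l2_sq_psi: "l2_sq \<mu> (psi i) = 1"
proof -
  have "l2_sq \<mu> (psi i) = l2_sq \<mu> (if even i then phis i else phi i)"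
    by (rule l2_sq_cong) (simp add: psi_def norm_mult norm_power_int)
  then show ?thesis by (simp add: l2_sq_phi l2_sq_phis)
qed

text \<open>Moving the powers of z to one side leaves a polynomial \<open>r\<close> against
  \<open>phis k\<close> or \<open>phi k\<close>. For even \<open>k\<close> the polynomial vanishes
  at 0 and has degree at most \<open>k\<close>; for odd \<open>k\<close> its degree is below
  \<open>k\<close>.\<close>

lemma psi_orth_less:
  assumes "j < k"
  shows "l2_inner \<mu> (psi j) (psi k) = 0"
proof -
  define s t where "s = j div 2" and "t = k div 2"
  have st: "s \<le> t" using assms by (simp add: s_def t_def div_le_mono)
  have js: "2 * s \<le> j" "j \<le> 2 * s + 1" unfolding s_def by linarith+
  define q where "q = smult (1 / of_real (sqrt (N j))) (if even j then star_poly (Phi j) else Phi j)"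
  define r where "r = monom 1 (t - s) * q"
  have q: "(if even j then phis j z else phi j z) = poly q z" for z
    by (simp add: q_def phis_def phi_def)
  have "degree q \<le> j"
    unfolding q_def using degree_star_poly[of "Phi j"]
    by (intro order_trans[OF degree_smult_le]) (simp add: degree_Phi)
  then have qz: "coeff q i = 0" if "i > j" for i using that by (intro coeff_eq_0) simp
  have r: "coeff r i = (if i < t - s then 0 else coeff q (i - (t - s)))" for i
    by (simp add: r_def coeff_monom_mult)
  have "l2_inner \<mu> (psi j) (psi k) = l2_inner \<mu> (poly r) (if even k then phis k else phi k)"
  proof (rule l2_inner_cong)
    fix z :: complex assume z: "z \<in> sphere 0 1"
    have "cnj (z powi (- int s)) * z powi (- int t) = z powi (int s - int t)"
      by (subst circle_cnj_powi[OF z], subst power_int_add[symmetric]) (use z in auto)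
    also have "\<dots> = cnj (z powi int (t - s))"
      using st by (subst circle_cnj_powi[OF z]) (simp add: of_nat_diff)
    finally have e: "cnj (z powi (- int s)) * z powi (- int t) = cnj (z ^ (t - s))" by simp
    have "cnj (psi j z) * psi k z
        = (cnj (z powi (- int s)) * z powi (- int t)) * (cnj (poly q z) * (if even k then phis k else phi k) z)"
      unfolding psi_def s_def[symmetric] t_def[symmetric] q by simp
    then show "cnj (psi j z) * psi k z = cnj (poly r z) * (if even k then phis k else phi k) z"
      unfolding e by (simp add: r_def poly_monom)
  qed
  also have "\<dots> = 0"
  proof (cases "even k")
    case True
    then have "k = 2 * t" by (simp add: t_def)
    with assms js have lt: "s < t" and le: "j + (t - s) \<le> k" by linarith+
    have "degree r \<le> k"
      by (rule degree_le) (use le in \<open>auto simp: r intro!: qz\<close>)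
    then show ?thesis using True lt by (simp add: inner_poly_phis r)
  next
    case False
    then have "k = 2 * t + 1" by (simp add: t_def)
    with assms js st have le: "j + (t - s) < k" by linarith
    have "coeff r i = 0" if "i \<ge> k" for i
      using that le by (auto simp: r intro!: qz)
    then show ?thesis using False by (simp add: inner_poly_phi)
  qed
  finally show ?thesis .
qed

lemma psi_orthonormal: "l2_inner \<mu> (psi j) (psi k) = (if j = k then 1 else 0)"
proof (cases j k rule: linorder_cases)
  case greater
  then show ?thesis using psi_orth_less[of k j] l2_inner_cnj[of \<mu> "psi k" "psi j"] by simp
qed (simp_all add: psi_orth_less l2_inner_self l2_sq_psi)

lemma Theta_a: "Theta (a n) 0 0 = cnj (a n)" "Theta (a n) 0 1 = of_real (\<rho> n)"
  "Theta (a n) 1 0 = of_real (\<rho> n)" "Theta (a n) 1 1 = - a n"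
  by (simp_all add: Theta_def \<rho>_def)

lemma l2_inner_comb2:
  assumes "\<And>z. z \<in> sphere 0 1 \<Longrightarrow> f z = c * g z + d * h z" "L2 \<mu> g" "L2 \<mu> h" "L2 \<mu> u"
  shows "l2_inner \<mu> f u = cnj c * l2_inner \<mu> g u + cnj d * l2_inner \<mu> h u"
proof -
  have "l2_inner \<mu> f u = l2_inner \<mu> (\<lambda>z. c * g z + d * h z) u"
    by (rule l2_inner_cong) (simp add: assms(1))
  then show ?thesis
    by (simp add: l2_inner_add_left L2_scale assms l2_inner_scale_left)
qed

text \<open>The blocks of \<open>cmv_M\<close> carry the odd coefficients: the two rows of a block
  are \<open>szego_2\<close> and \<open>szego_3\<close> at index \<open>2 * k + 1\<close>,
  multiplied by a common power of z.\<close>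

lemma seq_apply_M_psi:
  assumes g: "L2 \<mu> g"
  shows "seq_apply (cmv_M a) (\<lambda>k. l2_inner \<mu> (psi k) g) = (\<lambda>k. l2_inner \<mu> (xi k) g)"
proof
  fix i
  show "seq_apply (cmv_M a) (\<lambda>k. l2_inner \<mu> (psi k) g) i = l2_inner \<mu> (xi i) g"
  proof (cases i)
    case 0
    have "psi 0 = xi 0"
      using degree_Phi[of 0] by (simp add: psi_def xi_def phi_def phis_def fun_eq_iff star_poly_def)
    then show ?thesis by (simp add: 0 seq_apply_M)
  next
    case (Suc j)
    have e: "z powi (- int k) = z powi (- int (Suc k)) * z" if "z \<in> sphere 0 1" for z :: complex and k
    proof -
      have "z \<noteq> 0" using that by auto
      then show ?thesis using power_int_add[of z "- int (Suc k)" 1] by simp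
    qed
    show ?thesis
    proof (cases j rule: even_odd_cases)
      case (1 k)
      have "xi (Suc (2 * k)) z = a (2 * k + 1) * psi (Suc (2 * k)) z + of_real (\<rho> (2 * k + 1)) * psi (Suc (2 * k + 1)) z"
        if z: "z \<in> sphere 0 1" for z
        using szego_2[OF z, of "Suc (2 * k)"]
        by (simp add: xi_def psi_def e[OF z, of k] algebra_simps)
      from l2_inner_comb2[OF this L2_psi L2_psi g] show ?thesis
        unfolding Suc 1 seq_apply_M by (simp only: Theta_a complex_cnj_complex_of_real)
    next
      case (2 k)
      have "xi (Suc (2 * k + 1)) z = of_real (\<rho> (2 * k + 1)) * psi (Suc (2 * k)) z + (- cnj (a (2 * k + 1))) * psi (Suc (2 * k + 1)) z"
        if z: "z \<in> sphere 0 1" for z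
      proof -
        have "xi (Suc (2 * k + 1)) z = z powi (- int (Suc k)) * phi (Suc (Suc (2 * k))) z"
          by (simp add: xi_def)
        then show ?thesis
          unfolding szego_3[OF z, of "Suc (2 * k)"] by (simp add: psi_def e[OF z, of k] algebra_simps)
      qed
      from l2_inner_comb2[OF this L2_psi L2_psi g] show ?thesis
        unfolding Suc 2 seq_apply_M
        by (simp only: Theta_a complex_cnj_complex_of_real complex_cnj_minus complex_cnj_cnj)
    qed
  qed
qed

text \<open>The blocks of \<open>cmv_L\<close> carry the even coefficients. The factor z on the
  right is moved to the left slot as \<open>inverse z\<close>, after which the rows are again
  \<open>szego_2\<close> and \<open>szego_3\<close>, now at index \<open>2 * k\<close>.\<close>

lemma seq_apply_L_xi:
  assumes g: "L2 \<mu> g"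
  shows "seq_apply (cmv_L a) (\<lambda>k. l2_inner \<mu> (xi k) g) = (\<lambda>k. l2_inner \<mu> (psi k) (\<lambda>z. z * g z))"
proof
  fix i
  have shift: "l2_inner \<mu> (psi i) (\<lambda>z. z * g z) = l2_inner \<mu> (\<lambda>z. inverse z * psi i z) g" for i
    by (rule l2_inner_cong) (simp add: circle_cnj[symmetric] mult_ac)
  have e: "inverse z * (z powi (- int k) * w) = z powi (- int (Suc k)) * w" "z powi (- int k) = z powi (- int (Suc k)) * z"
    if "z \<in> sphere 0 1" for z w :: complex and k
  proof -
    have "z \<noteq> 0" using that by auto
    then show "z powi (- int k) = z powi (- int (Suc k)) * z"
      using power_int_add[of z "- int (Suc k)" 1] by simp
    with \<open>z \<noteq> 0\<close> show "inverse z * (z powi (- int k) * w) = z powi (- int (Suc k)) * w" by simp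
  qed
  show "seq_apply (cmv_L a) (\<lambda>k. l2_inner \<mu> (xi k) g) i = l2_inner \<mu> (psi i) (\<lambda>z. z * g z)"
  proof (cases i rule: even_odd_cases)
    case (1 k)
    have "inverse z * psi (2 * k) z = a (2 * k) * xi (2 * k) z + of_real (\<rho> (2 * k)) * xi (2 * k + 1) z"
      if z: "z \<in> sphere 0 1" for z
    proof -
      have "inverse z * psi (2 * k) z = z powi (- int (Suc k)) * phis (2 * k) z"
        by (simp add: psi_def e(1)[OF z])
      also have "\<dots> = a (2 * k) * xi (2 * k) z + of_real (\<rho> (2 * k)) * xi (2 * k + 1) z"
        unfolding szego_2[OF z, of "2 * k"] by (simp add: xi_def e(2)[OF z, of k] algebra_simps)
      finally show ?thesis .
    qed
    from l2_inner_comb2[OF this L2_xi L2_xi g] show ?thesis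
      unfolding 1 seq_apply_L shift by (simp only: Theta_a complex_cnj_complex_of_real)
  next
    case (2 k)
    have "inverse z * psi (2 * k + 1) z = of_real (\<rho> (2 * k)) * xi (2 * k) z + (- cnj (a (2 * k))) * xi (2 * k + 1) z"
      if z: "z \<in> sphere 0 1" for z
    proof -
      have "inverse z * psi (2 * k + 1) z = z powi (- int (Suc k)) * phi (Suc (2 * k)) z"
        by (simp add: psi_def e(1)[OF z])
      also have "\<dots> = of_real (\<rho> (2 * k)) * xi (2 * k) z + (- cnj (a (2 * k))) * xi (2 * k + 1) z"
        unfolding szego_3[OF z, of "2 * k"] by (simp add: xi_def e(2)[OF z, of k] algebra_simps)
      finally show ?thesis .
    qed
    from l2_inner_comb2[OF this L2_xi L2_xi g] show ?thesis
      unfolding 2 seq_apply_L shift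
      by (simp only: Theta_a complex_cnj_complex_of_real complex_cnj_minus complex_cnj_cnj)
  qed
qed

lemma seq_apply_LM_psi:
  assumes g: "L2 \<mu> g"
  shows "seq_apply (cmv_L a) (seq_apply (cmv_M a) (\<lambda>k. l2_inner \<mu> (psi k) g))
      = (\<lambda>k. l2_inner \<mu> (psi k) (\<lambda>z. z * g z))"
  by (simp only: seq_apply_M_psi[OF g] seq_apply_L_xi[OF g])

text \<open>Multiplication by z acts on the coefficients as the CMV matrix, which sends the zero
  sequence to itself. For negative powers the two factors are undone by those with conjugated
  coefficients.\<close>

lemma psi_coeffs_powi_zero:
  assumes g: "L2 \<mu> g" and zero: "\<And>k. l2_inner \<mu> (psi k) g = 0"
  shows "l2_inner \<mu> (psi k) (\<lambda>z. z powi m * g z) = 0"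
proof -
  have zp: "(\<lambda>k. l2_inner \<mu> (psi k) (\<lambda>z. z * (z powi m * g z))) = (\<lambda>k. l2_inner \<mu> (psi k) (\<lambda>z. z powi (m + 1) * g z))" for m
    by (intro ext l2_inner_cong) (simp add: circle_powi_Suc[symmetric])
  have a1: "cmod (a j) \<le> 1" for j using cmod_a[of j] by simp
  have z0: "seq_apply A (\<lambda>_. 0) = (\<lambda>_. 0)" for A by (simp add: seq_apply_def fun_eq_iff)
  note LM = seq_apply_LM_psi[OF L2_powi_mult[OF g], unfolded zp]
  have up: "(\<lambda>k. l2_inner \<mu> (psi k) (\<lambda>z. z powi (m + 1) * g z)) = (\<lambda>_. 0)"
    if "(\<lambda>k. l2_inner \<mu> (psi k) (\<lambda>z. z powi m * g z)) = (\<lambda>_. 0)" for m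
    unfolding LM[symmetric] that z0 ..
  have down: "(\<lambda>k. l2_inner \<mu> (psi k) (\<lambda>z. z powi (m - 1) * g z)) = (\<lambda>_. 0)"
    if "(\<lambda>k. l2_inner \<mu> (psi k) (\<lambda>z. z powi m * g z)) = (\<lambda>_. 0)" for m
  proof -
    have "seq_apply (cmv_L a) (seq_apply (cmv_M a) (\<lambda>k. l2_inner \<mu> (psi k) (\<lambda>z. z powi (m - 1) * g z))) = (\<lambda>_. 0)"
      using LM[of "m - 1"] that by simp
    from arg_cong[OF this, of "\<lambda>f. seq_apply (cmv_M (cnj \<circ> a)) (seq_apply (cmv_L (cnj \<circ> a)) f)"]
    show ?thesis
      by (simp only: seq_apply_L_inverse[OF a1] seq_apply_M_inverse[OF a1] z0)
  qed
  have "(\<lambda>k. l2_inner \<mu> (psi k) (\<lambda>z. z powi m * g z)) = (\<lambda>_. 0)"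
  proof (induction m rule: int_induct[of _ 0])
    case base
    show ?case by (simp add: zero)
  qed (use up down in blast)+
  then show ?thesis by (rule fun_cong)
qed

lemma psi_total:
  assumes g: "L2 \<mu> g" and zero: "\<And>k. l2_inner \<mu> (psi k) g = 0"
  shows "AE z in \<mu>. g z = 0"
proof (rule circle_total[OF finite_circle])
  show "integrable \<mu> g"
    using L2_inner_integrable[OF L2_continuous[OF continuous_on_const[of _ 1]] g] by simp
  \<comment> \<open>Because \<open>psi 0\<close> is constantly 1, the coefficient at index 0 of z^k
    g is its moment of order \<open>k\<close>.\<close>
  have psi0: "psi 0 z = 1" for z
    by (simp add: psi_def phis_def N_0 star_poly_def)
  show "(\<integral>z. z powi k * g z \<partial>\<mu>) = 0" for k :: int
    using psi_coeffs_powi_zero[OF g zero, of 0 k] by (simp add: l2_inner_def psi0)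
qed

sublocale l2_basis \<mu> psi
  by unfold_locales (simp_all add: L2_psi psi_orthonormal psi_total)

section \<open>The CMV operator as multiplication by z\<close>

lemma cmv_op_unitary_a: "unitary_op (cmv_op a)"
  using cmod_a by (intro cmv_op_unitary less_imp_le)

lemma L2_z_mult: "L2 \<mu> g \<Longrightarrow> L2 \<mu> (\<lambda>z. z * g z)"
  using L2_powi_mult[of g 1] by simp

lemma cmv_op_coeff_map:
  assumes g: "L2 \<mu> g"
  shows "cmv_op a (coeff_map g) = coeff_map (\<lambda>z. z * g z)"
proof (rule ell2_eqI)
  have a1: "cmod (a j) \<le> 1" for j using cmod_a[of j] by simp
  have "ell2_nth (coeff_map g) = (\<lambda>k. l2_inner \<mu> (psi k) g)"
    by (simp add: coeff_map_nth g fun_eq_iff)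
  then show "ell2_nth (cmv_op a (coeff_map g)) i = ell2_nth (coeff_map (\<lambda>z. z * g z)) i" for i
    by (simp add: ell2_nth_cmv_op_LM[OF a1] seq_apply_LM_psi[OF g] coeff_map_nth L2_z_mult g)
qed

lemma cmv_power_coeff_map:
  assumes g: "L2 \<mu> g"
  shows "op_power_int (cmv_op a) n (coeff_map g) = coeff_map (\<lambda>z. z powi n * g z)"
proof -
  have step: "cmv_op a (coeff_map (\<lambda>z. z powi k * g z)) = coeff_map (\<lambda>z. z powi (k + 1) * g z)" for k
  proof -
    have L2: "L2 \<mu> (\<lambda>z. z powi k * g z)" "L2 \<mu> (\<lambda>z. z powi (k + 1) * g z)"
      by (rule L2_powi_mult[OF g])+
    have "AE z in \<mu>. z * (z powi k * g z) = z powi (k + 1) * g z"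
      by (rule AE_I2) (simp add: space_mu circle_powi_Suc[symmetric])
    then show ?thesis
      using coeff_map_eq_iff[OF L2_z_mult[OF L2(1)] L2(2)] by (simp add: cmv_op_coeff_map L2)
  qed
  have "bij (cmv_op a)" using cmv_op_unitary_a by (simp add: unitary_op_def)
  from op_power_int_orbit[where f = "\<lambda>k. coeff_map (\<lambda>z. z powi k * g z)", OF this step, of n 0]
  show ?thesis by simp
qed

lemma coeff_map_psi: "coeff_map (psi k) = ell2_unit k"
  by (rule ell2_eqI) (simp add: coeff_map_nth L2_psi psi_orthonormal ell2_nth_unit)

end

section \<open>Uniqueness of the spectral resolution\<close>

locale pvm =
  fixes E :: "complex set \<Rightarrow> ell2 \<Rightarrow> ell2"
  assumes pvm: "projection_valued_measure E"
begin

abbreviation \<nu> :: "ell2 \<Rightarrow> complex measure" where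
  "\<nu> x \<equiv> scalar_spectral_measure E x"

lemma E_projection: "A \<in> sets circle_borel \<Longrightarrow> orth_projection (E A)"
  using pvm unfolding projection_valued_measure_def by (elim conjE) (rule bspec)

lemma E_linear: "A \<in> sets circle_borel \<Longrightarrow> clinear_op (E A)"
  and E_idem: "A \<in> sets circle_borel \<Longrightarrow> E A (E A x) = E A x"
  and E_adjoint: "A \<in> sets circle_borel \<Longrightarrow> cinner (E A x) y = cinner x (E A y)"
  using E_projection[of A] unfolding orth_projection_def by blast+

lemma E_Int: "A \<in> sets circle_borel \<Longrightarrow> B \<in> sets circle_borel \<Longrightarrow> E A (E B x) = E (A \<inter> B) x"
  using pvm unfolding projection_valued_measure_def by (metis comp_apply)

lemma E_sphere: "E (sphere 0 1) x = x"
  using pvm unfolding projection_valued_measure_def by (elim conjE) (simp only: id_apply)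

lemma E_sums:
  fixes A :: "nat \<Rightarrow> complex set"
  shows "range A \<subseteq> sets circle_borel \<Longrightarrow> disjoint_family A \<Longrightarrow> (\<lambda>n. E (A n) x) sums E (\<Union>n. A n) x"
  using pvm unfolding projection_valued_measure_def by blast

lemma E_form: "A \<in> sets circle_borel \<Longrightarrow> cinner x (E A x) = of_real ((norm (E A x))\<^sup>2)"
  unfolding cinner_norm[symmetric] by (simp only: E_adjoint E_idem)

lemma sphere_sets [simp]: "sphere 0 1 \<in> sets circle_borel"
  by (simp add: sets_circle_borel)

lemma compl_sets: "A \<in> sets circle_borel \<Longrightarrow> sphere 0 1 - A \<in> sets circle_borel"
  by (auto simp: sets_circle_borel)

lemma sets_nu: "sets (\<nu> x) = sets circle_borel"
  unfolding scalar_spectral_measure_def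
  using sets.sigma_sets_eq[of circle_borel] sets.space_closed[of circle_borel]
  by (simp add: sets_measure_of space_circle_borel)

text \<open>\<open>measure_of\<close> has the prescribed values only once positivity and countable
  additivity are established. Additivity comes from the strongly convergent series for
  \<open>E\<close>, nonnegativity from \<open>E A\<close> being idempotent and self-adjoint.\<close>

lemma emeasure_nu:
  assumes A: "A \<in> sets circle_borel"
  shows "emeasure (\<nu> x) A = ennreal ((norm (E A x))\<^sup>2)"
proof -
  let ?m = "\<lambda>A. ennreal (Re (cinner x (E A x)))"
  have disj: "disjoint_family (\<lambda>_::nat. {}::complex set)" by (simp add: disjoint_family_on_def)
  \<comment> \<open>The empty set is split into infinitely many empty sets: a summable constant
    sequence must be zero.\<close>
  have "(\<lambda>_::nat. E {} x) sums E (\<Union>n::nat. {}) x"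
    by (rule E_sums[OF _ disj]) simp
  then have "(\<lambda>_::nat. E {} x) \<longlonglongrightarrow> 0"
    by (rule summable_LIMSEQ_zero[OF sums_summable])
  then have "E {} x = 0" by (simp only: LIMSEQ_const_iff)
  then have pos: "positive (sets circle_borel) ?m" by (simp add: positive_def)
  have add: "countably_additive (sets circle_borel) ?m"
  proof (rule countably_additiveI)
    fix B :: "nat \<Rightarrow> complex set"
    assume B: "range B \<subseteq> sets circle_borel" "disjoint_family B" "(\<Union>i. B i) \<in> sets circle_borel"
    have "(\<lambda>n. E (B n) x) sums E (\<Union>n. B n) x"
      by (rule E_sums) (use B in blast)+
    then have "(\<lambda>n. cinner x (\<Sum>i<n. E (B i) x)) \<longlonglongrightarrow> cinner x (E (\<Union>n. B n) x)"
      unfolding sums_def by (intro tendsto_cinner tendsto_const)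
    moreover have "cinner x (\<Sum>i<n. E (B i) x) = (\<Sum>i<n. cinner x (E (B i) x))" for n
      by (induction n) (simp_all add: cinner_add_right)
    ultimately have "(\<lambda>n. cinner x (E (B n) x)) sums cinner x (E (\<Union>n. B n) x)"
      by (simp add: sums_def)
    then have "(\<lambda>n. Re (cinner x (E (B n) x))) sums Re (cinner x (E (\<Union>n. B n) x))"
      by (rule sums_Re)
    moreover have "0 \<le> Re (cinner x (E (B n) x))" for n
    proof -
      have "B n \<in> sets circle_borel" using B(1) by blast
      then show ?thesis by (simp add: E_form del: of_real_power)
    qed
    ultimately show "(\<Sum>i. ?m (B i)) = ?m (\<Union>i. B i)"
      by (intro suminf_ennreal_eq) auto
  qed
  have "sigma_algebra (sphere 0 1) (sets circle_borel)"
    using sets.sigma_algebra_axioms[of circle_borel] by (simp add: space_circle_borel)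
  from emeasure_measure_of_sigma[OF this pos add A] show ?thesis
    using E_form[OF A, of x] by (simp add: scalar_spectral_measure_def del: of_real_power)
qed

lemma circle_finite_nu: "circle_finite (\<nu> x)"
proof -
  have "space (\<nu> x) = sphere 0 1"
    using sets_nu[of x] by (metis sets_eq_imp_space_eq space_circle_borel)
  then have "finite_measure (\<nu> x)"
    by (intro finite_measureI) (simp add: emeasure_nu)
  then show ?thesis by (simp add: circle_finite_def sets_nu)
qed

lemma measure_nu: "A \<in> sets circle_borel \<Longrightarrow> measure (\<nu> x) A = (norm (E A x))\<^sup>2"
  by (simp add: measure_def emeasure_nu)

lemma space_nu: "space (\<nu> x) = sphere 0 1"
  by (rule circle_finite_space[OF circle_finite_nu])

lemma E_empty: "E {} x = 0"
  using measure_nu[of "{}" x] by simp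

text \<open>The remainder \<open>d\<close> is annihilated by \<open>E\<close> on \<open>A\<close>
  and on its complement, so its scalar measure, whose total mass is the square norm of
  \<open>d\<close>, vanishes.\<close>

lemma E_compl:
  assumes A: "A \<in> sets circle_borel"
  shows "E A x + E (sphere 0 1 - A) x = x"
proof -
  let ?B = "sphere 0 1 - A"
  note B = compl_sets[OF A]
  define d where "d = x - (E A x + E ?B x)"
  have AB: "A \<inter> ?B = {}" "?B \<inter> A = {}" by auto
  have A0: "E A d = 0" and B0: "E ?B d = 0"
    by (simp_all add: d_def clinear_op_diff[OF E_linear] clinear_op_add[OF E_linear] A B E_idem E_Int AB E_empty)
  have "(norm d)\<^sup>2 = measure (\<nu> d) (sphere 0 1)"
    using measure_nu[of "sphere 0 1" d] by (simp add: E_sphere)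
  also have "sphere 0 1 = A \<union> ?B" using A by (auto simp: sets_circle_borel)
  also have "measure (\<nu> d) (A \<union> ?B) = measure (\<nu> d) A + measure (\<nu> d) ?B"
  proof (rule finite_measure.finite_measure_Union)
    show "finite_measure (\<nu> d)" using circle_finite_nu[of d] by (simp add: circle_finite_def)
  qed (use A B AB sets_nu in auto)
  also have "\<dots> = 0" by (simp add: measure_nu A B A0 B0)
  finally show ?thesis by (simp add: d_def)
qed

lemma nu_restrict:
  assumes A: "A \<in> sets circle_borel"
  shows "\<nu> (E A x) = density (\<nu> x) (indicator A)"
proof (rule measure_eqI)
  fix B assume "B \<in> sets (\<nu> (E A x))"
  then have B: "B \<in> sets circle_borel" by (simp add: sets_nu)
  have "emeasure (\<nu> (E A x)) B = emeasure (\<nu> x) (A \<inter> B)"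
    using A B by (simp add: emeasure_nu E_Int Int_commute)
  also have "\<dots> = emeasure (density (\<nu> x) (indicator A)) B"
  proof -
    have AB: "A \<in> sets (\<nu> x)" "B \<in> sets (\<nu> x)" using A B by (simp_all add: sets_nu)
    then show ?thesis
      by (subst emeasure_density) (simp_all flip: indicator_inter_arith)
  qed
  finally show "emeasure (\<nu> (E A x)) B = emeasure (density (\<nu> x) (indicator A)) B" .
qed (simp add: sets_nu)

end

locale unitary_pvm = pvm +
  fixes U :: "ell2 \<Rightarrow> ell2"
  assumes unitary: "unitary_op U"
    and resolution: "cinner x (U x) = (\<integral>z. z \<partial>scalar_spectral_measure E x)"
begin

lemma U_linear: "clinear_op U" and U_norm: "norm (U x) = norm x"
  using unitary by (simp_all add: unitary_op_def)

text \<open>For \<open>x\<close> and \<open>y\<close> in complementary spectral subspaces, the scalar measure of \<open>x + c y\<close> is the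
  same for every unimodular \<open>c\<close>, so the cross terms in the quadratic form of \<open>U\<close> vanish.\<close>
lemma cross_term_zero:
  assumes A: "A \<in> sets circle_borel"
  shows "cinner (E (sphere 0 1 - A) y) (U (E A x)) = 0"
    and "cinner (E A x) (U (E (sphere 0 1 - A) y)) = 0"
proof -
  define x' y' where "x' = E A x" and "y' = E (sphere 0 1 - A) y"
  note A' = compl_sets[OF A]
  have AA: "(sphere 0 1 - A) \<inter> (B \<inter> A) = {}" for B by auto
  have orth: "cinner (E B x') (E B y') = 0" if B: "B \<in> sets circle_borel" for B
  proof -
    have BA: "B \<inter> A \<in> sets circle_borel" using A B by blast
    have "cinner (E B y') (E B x') = cinner y (E (sphere 0 1 - A) (E B (E B (E A x))))"
      by (simp add: x'_def y'_def E_adjoint A' B)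
    also have "\<dots> = 0"
      using A B A' BA by (simp add: E_Int E_empty AA)
    finally have "cnj (cinner (E B y') (E B x')) = 0" by simp
    then show ?thesis by (simp only: cinner_cnj)
  qed
  have same: "\<nu> (x' + scaleC c y') = \<nu> (x' + y')" if c: "cmod c = 1" for c
  proof (rule measure_eqI)
    fix B assume "B \<in> sets (\<nu> (x' + scaleC c y'))"
    then have B: "B \<in> sets circle_borel" by (simp add: sets_nu)
    have "(norm (E B (x' + scaleC c y')))\<^sup>2 = (norm (E B x'))\<^sup>2 + (norm (E B y'))\<^sup>2"
      if c: "cmod c = 1" for c
    proof -
      have cc: "cnj c * c = 1" using complex_norm_square[of c] c by (simp add: mult.commute)
      have "cinner (E B y') (E B x') = 0"
        using orth[OF B] by (metis cinner_cnj complex_cnj_zero)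
      then have "complex_of_real ((norm (E B (x' + scaleC c y')))\<^sup>2)
          = of_real ((norm (E B x'))\<^sup>2) + (cnj c * c) * of_real ((norm (E B y'))\<^sup>2)"
        unfolding cinner_norm[symmetric]
        by (simp add: clinear_op_add[OF E_linear[OF B]] clinear_op_scaleC[OF E_linear[OF B]]
            cinner_add_left cinner_add_right cinner_scaleC_left cinner_scaleC_right orth[OF B])
      then have "complex_of_real ((norm (E B (x' + scaleC c y')))\<^sup>2)
          = of_real ((norm (E B x'))\<^sup>2 + (norm (E B y'))\<^sup>2)"
        unfolding cc by simp
      then show ?thesis by (simp only: of_real_eq_iff)
    qed
    from this[OF c] this[of 1] show "emeasure (\<nu> (x' + scaleC c y')) B = emeasure (\<nu> (x' + y')) B"
      by (simp add: emeasure_nu B scaleC_one)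
  qed (simp add: sets_nu)
  define p q where "p = cinner x' (U y')" and "q = cinner y' (U x')"
  define r where "r = cinner x' (U x') + cinner y' (U y')"
  have form: "r + c * p + cnj c * q = cinner (x' + y') (U (x' + y'))" if c: "cmod c = 1" for c
  proof -
    have cc: "cnj c * c = 1" using complex_norm_square[of c] c by (simp add: mult.commute)
    have "cinner (x' + scaleC c y') (U (x' + scaleC c y'))
        = cinner x' (U x') + c * p + cnj c * q + (cnj c * c) * cinner y' (U y')"
      by (simp add: clinear_op_add[OF U_linear] clinear_op_scaleC[OF U_linear] p_def q_def
          cinner_add_left cinner_add_right cinner_scaleC_left cinner_scaleC_right algebra_simps)
    then show ?thesis
      using resolution[of "x' + scaleC c y'"] resolution[of "x' + y'"] unfolding cc same[OF c] r_def by simp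
  qed
  \<comment> \<open>Comparing c = 1 with c = -1 gives \<open>p + q = 0\<close>; comparing c = \<i>
    with c = -\<i> gives \<open>p - q = 0\<close>.\<close>
  have "r + p + q = r - p - q" using form[of 1] form[of "- 1"] by simp
  then have 1: "p + q = 0" by (simp add: complex_eq_iff)
  have "r + \<i> * p - \<i> * q = r - \<i> * p + \<i> * q" using form[of \<i>] form[of "- \<i>"] by simp
  then have "p - q = 0" by (simp add: complex_eq_iff)
  with 1 have "p = 0" "q = 0" by (simp_all add: complex_eq_iff)
  then show "cinner (E (sphere 0 1 - A) y) (U (E A x)) = 0" "cinner (E A x) (U (E (sphere 0 1 - A) y)) = 0"
    by (simp_all add: p_def q_def x'_def y'_def)
qed

lemma U_commutes:
  assumes A: "A \<in> sets circle_borel"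
  shows "E A (U x) = U (E A x)"
proof -
  let ?B = "sphere 0 1 - A"
  note B = compl_sets[OF A]
  have 1: "E ?B (U (E A x)) = 0"
    by (rule cinner_ext) (use cross_term_zero(1)[OF A, of _ x] in \<open>simp add: E_adjoint[OF B]\<close>)
  have 2: "E A (U (E ?B x)) = 0"
    by (rule cinner_ext) (use cross_term_zero(2)[OF A, of _ x] in \<open>simp add: E_adjoint[OF A]\<close>)
  have "E A (U x) = E A (U (E A x + E ?B x))" by (simp add: E_compl[OF A])
  also have "\<dots> = E A (U (E A x)) + E ?B (U (E A x))"
    by (simp add: clinear_op_add[OF U_linear] clinear_op_add[OF E_linear[OF A]] 1 2)
  also have "\<dots> = U (E A x)" by (rule E_compl[OF A])
  finally show ?thesis .
qed

lemma form_restricted: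
  assumes A: "A \<in> sets circle_borel"
  shows "cinner (E A x) (E A (U x)) = (\<integral>z. indicator A z * z \<partial>\<nu> x)"
proof -
  have "cinner (E A x) (E A (U x)) = (\<integral>z. z \<partial>\<nu> (E A x))"
    by (simp add: U_commutes[OF A] resolution)
  also have "\<dots> = (\<integral>z. z \<partial>density (\<nu> x) (\<lambda>z. ennreal (indicator A z)))"
    by (simp add: nu_restrict[OF A] ennreal_indicator)
  also have "\<dots> = (\<integral>z. indicator A z *\<^sub>R z \<partial>\<nu> x)"
  proof (rule integral_density)
    show "(\<lambda>z. z) \<in> borel_measurable (\<nu> x)"
      by (intro circle_continuous_measurable[OF circle_finite_nu] continuous_intros)
    show "indicator A \<in> borel_measurable (\<nu> x)"
      by (rule borel_measurable_indicator) (simp add: sets_nu A)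
  qed simp
  also have "\<dots> = (\<integral>z. indicator A z * z \<partial>\<nu> x)"
    by (rule Bochner_Integration.integral_cong) (auto simp: indicator_def)
  finally show ?thesis .
qed

text \<open>On the circle \<open>2 + 2 * Re z\<close> is |1 + z|^2. The identity comes from
  expanding the norm of \<open>E A (x + U x)\<close>: commutation with \<open>U\<close> makes both
  square terms equal, and \<open>form_restricted\<close> evaluates the cross term.\<close>

lemma nu_add_U: "\<nu> (x + U x) = density (\<nu> x) (\<lambda>z. ennreal (2 + 2 * Re z))"
proof (rule measure_eqI)
  fix A assume "A \<in> sets (\<nu> (x + U x))"
  then have A: "A \<in> sets circle_borel" by (simp add: sets_nu)
  interpret \<nu>: finite_measure "\<nu> x" using circle_finite_nu[of x] by (simp add: circle_finite_def)
  have Re: "Re z \<ge> - 1" if "z \<in> space (\<nu> x)" for z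
    using that abs_Re_le_cmod[of z] by (simp add: space_nu)
  have int: "integrable (\<nu> x) (\<lambda>z::complex. z)"
    by (intro circle_continuous_integrable[OF circle_finite_nu] continuous_intros)
  have Asets: "A \<in> sets (\<nu> x)" using A by (simp add: sets_nu)
  have intA: "integrable (\<nu> x) (\<lambda>z. indicator A z * z)"
    using integrable_mult_indicator[OF Asets int]
    by (rule Bochner_Integration.integrable_cong[THEN iffD1, rotated 2]) (auto simp: indicator_def)
  have intR: "integrable (\<nu> x) (\<lambda>z. (2 + 2 * Re z) * indicator A z)"
    using integrable_real_mult_indicator[OF Asets, of "\<lambda>z. 2 + 2 * Re z"] int by auto
  have "(\<integral>z. (2 + 2 * Re z) * indicator A z \<partial>\<nu> x)
      = (\<integral>z. 2 * indicator A z + 2 * Re (indicator A z * z) \<partial>\<nu> x)"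
    by (rule Bochner_Integration.integral_cong) (auto simp: indicator_def)
  also have "\<dots> = 2 * measure (\<nu> x) A + 2 * Re (\<integral>z. indicator A z * z \<partial>\<nu> x)"
  proof -
    have "integrable (\<nu> x) (\<lambda>z. 2 * Re (indicator A z * z))"
      by (intro integrable_mult_right integrable_Re intA)
    moreover have "integrable (\<nu> x) (\<lambda>z. 2 * indicator A z :: real)"
      using Asets by (intro integrable_mult_right integrable_real_indicator) (simp_all add: less_top[symmetric])
    ultimately show ?thesis
      using Asets sets.sets_into_space[OF Asets]
      by (simp only: Bochner_Integration.integral_add integral_mult_right_zero integral_Re[OF intA])
        (simp add: Int_absorb2 Int_absorb1)
  qed
  also have "\<dots> = 2 * (norm (E A x))\<^sup>2 + 2 * Re (cinner (E A x) (E A (U x)))"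
    by (simp add: measure_nu A form_restricted)
  also have "\<dots> = (norm (E A (x + U x)))\<^sup>2"
    by (simp add: clinear_op_add[OF E_linear[OF A]] Re_cinner dot_norm U_commutes[OF A] U_norm field_simps)
  finally have "(\<integral>z. (2 + 2 * Re z) * indicator A z \<partial>\<nu> x) = (norm (E A (x + U x)))\<^sup>2" .
  moreover have "(\<integral>\<^sup>+z. ennreal (2 + 2 * Re z) * indicator A z \<partial>\<nu> x)
      = (\<integral>\<^sup>+z. ennreal ((2 + 2 * Re z) * indicator A z) \<partial>\<nu> x)"
    by (intro nn_integral_cong) (auto simp: indicator_def)
  moreover have "\<dots> = ennreal (\<integral>z. (2 + 2 * Re z) * indicator A z \<partial>\<nu> x)"
    by (rule nn_integral_eq_integral[OF intR]) (use Re in \<open>auto simp: indicator_def intro!: AE_I2\<close>, force)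
  ultimately show "emeasure (\<nu> (x + U x)) A = emeasure (density (\<nu> x) (\<lambda>z. ennreal (2 + 2 * Re z))) A"
    using int Asets by (simp add: emeasure_nu[OF A] emeasure_density)
qed (simp add: sets_nu)

lemma integral_nu_add_U:
  fixes f :: "complex \<Rightarrow> complex"
  assumes f: "continuous_on (sphere 0 1) f"
  shows "(\<integral>z. f z \<partial>\<nu> (x + U x)) = (\<integral>z. (2 + z + cnj z) * f z \<partial>\<nu> x)"
proof -
  have "(\<integral>z. f z \<partial>\<nu> (x + U x)) = (\<integral>z. (2 + 2 * Re z) *\<^sub>R f z \<partial>\<nu> x)"
    unfolding nu_add_U
  proof (rule integral_density)
    show "f \<in> borel_measurable (\<nu> x)" "(\<lambda>z. 2 + 2 * Re z) \<in> borel_measurable (\<nu> x)"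
      by (intro circle_continuous_measurable[OF circle_finite_nu] continuous_intros f)+
    show "AE z in \<nu> x. 0 \<le> 2 + 2 * Re z"
    proof (rule AE_I2)
      fix z assume "z \<in> space (\<nu> x)"
      then show "0 \<le> 2 + 2 * Re z" using abs_Re_le_cmod[of z] by (simp add: space_nu)
    qed
  qed
  also have "\<dots> = (\<integral>z. (2 + z + cnj z) * f z \<partial>\<nu> x)"
    by (rule Bochner_Integration.integral_cong)
      (simp_all add: scaleR_conv_of_real complex_add_cnj add.assoc)
  finally show ?thesis .
qed

text \<open>The case \<open>n\<close> at the vector \<open>x + U x\<close>, whose scalar measure is \<open>|1 + z|\<^sup>2\<close> times that of \<open>x\<close>,
  gives the case \<open>n + 1\<close> at \<open>x\<close>.\<close>
lemma spectral_moments: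
  "cinner x ((U ^^ n) x) = (\<integral>z. z ^ n \<partial>\<nu> x)"
proof -
  \<comment> \<open>Two consecutive exponents are carried along because the comparison at
    \<open>x + U x\<close> involves the exponents \<open>n\<close>, \<open>n + 1\<close> and
    \<open>n + 2\<close> at once.\<close>
  have "(\<forall>x. cinner x ((U ^^ n) x) = (\<integral>z. z ^ n \<partial>\<nu> x)) \<and>
      (\<forall>x. cinner x ((U ^^ Suc n) x) = (\<integral>z. z ^ Suc n \<partial>\<nu> x))"
  proof (induction n)
    case 0
    have "cinner x x = (\<integral>z. 1 \<partial>\<nu> x)" for x
      using measure_nu[of "sphere 0 1" x] by (simp add: E_sphere cinner_norm space_nu scaleR_conv_of_real)
    then show ?case by (simp add: resolution)
  next
    case (Suc n)
    have "cinner x ((U ^^ Suc (Suc n)) x) = (\<integral>z. z ^ Suc (Suc n) \<partial>\<nu> x)" for x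
    proof -
      have lin: "clinear_op (U ^^ m)" for m
        using unitary_op_funpow[OF unitary, of m] by (simp add: unitary_op_def)
      have shift: "(U ^^ m) (U x) = U ((U ^^ m) x)" for m x by (simp add: funpow_swap1)
      have "cinner (x + U x) ((U ^^ Suc n) (x + U x))
          = cinner x ((U ^^ Suc n) x) + cinner x ((U ^^ Suc (Suc n)) x)
            + (cinner (U x) (U ((U ^^ n) x)) + cinner (U x) (U ((U ^^ Suc n) x)))"
        by (simp only: clinear_op_add[OF lin] shift cinner_add_left cinner_add_right)
          (simp add: shift)
      then have L: "cinner (x + U x) ((U ^^ Suc n) (x + U x))
          = 2 * cinner x ((U ^^ Suc n) x) + cinner x ((U ^^ Suc (Suc n)) x) + cinner x ((U ^^ n) x)"
        by (simp add: unitary_op_cinner[OF unitary])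
      have "cinner (x + U x) ((U ^^ Suc n) (x + U x)) = (\<integral>z. (2 + z + cnj z) * z ^ Suc n \<partial>\<nu> x)"
        using Suc by (simp only: integral_nu_add_U continuous_intros)
      also have "\<dots> = (\<integral>z. 2 * z ^ Suc n + (z ^ Suc (Suc n) + z ^ n) \<partial>\<nu> x)"
      proof (rule Bochner_Integration.integral_cong)
        fix z assume "z \<in> space (\<nu> x)"
        then have "cnj z * z = 1" by (intro circle_cnj_mult) (simp add: space_nu)
        then show "(2 + z + cnj z) * z ^ Suc n = 2 * z ^ Suc n + (z ^ Suc (Suc n) + z ^ n)"
          by (simp add: distrib_right mult.assoc[symmetric])
      qed simp
      also have "\<dots> = 2 * (\<integral>z. z ^ Suc n \<partial>\<nu> x) + ((\<integral>z. z ^ Suc (Suc n) \<partial>\<nu> x) + (\<integral>z. z ^ n \<partial>\<nu> x))"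
      proof -
        have i: "integrable (\<nu> x) (\<lambda>z. z ^ m)" for m
          by (intro circle_continuous_integrable[OF circle_finite_nu] continuous_intros)
        show ?thesis
          by (simp only: i Bochner_Integration.integral_add Bochner_Integration.integrable_add integrable_mult_right integral_mult_right_zero)
      qed
      finally show ?thesis using L Suc by simp
    qed
    with Suc show ?case by blast
  qed
  then show ?thesis by blast
qed

end

text \<open>Equal moments give equal scalar measures, these give equal quadratic forms of
  \<open>E1 A\<close> and \<open>E2 A\<close>, and polarization gives equal operators.\<close>

lemma spectral_resolution_unique:
  assumes U: "unitary_op U" and E1: "spectral_resolution U E1" and E2: "spectral_resolution U E2"
    and A: "A \<in> sets circle_borel"
  shows "E1 A = E2 A"
proof -
  interpret E1: unitary_pvm E1 U using U E1 by unfold_locales (simp_all add: spectral_resolution_def)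
  interpret E2: unitary_pvm E2 U using U E2 by unfold_locales (simp_all add: spectral_resolution_def)
  have "scalar_spectral_measure E1 x = scalar_spectral_measure E2 x" for x
  proof (rule circle_measure_eqI[OF E1.circle_finite_nu E2.circle_finite_nu])
    fix k :: int
    have nat: "(\<integral>z. z ^ n \<partial>scalar_spectral_measure E1 x) = (\<integral>z. z ^ n \<partial>scalar_spectral_measure E2 x)" for n
      by (simp only: E1.spectral_moments[symmetric] E2.spectral_moments[symmetric])
    show "(\<integral>z. z powi k \<partial>scalar_spectral_measure E1 x) = (\<integral>z. z powi k \<partial>scalar_spectral_measure E2 x)"
    proof (cases "k \<ge> 0")
      case True
      then show ?thesis using nat[of "nat k"] by (simp add: power_int_def)
    next
      case False
      \<comment> \<open>Negative moments are conjugates of positive ones, so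
        \<open>spectral_moments\<close> for natural exponents suffices.\<close>
      have "(\<integral>z. z powi k \<partial>M) = cnj (\<integral>z. z ^ nat (- k) \<partial>M)" if "circle_finite M" for M
        unfolding Bochner_Integration.integral_cnj[symmetric]
      proof (rule Bochner_Integration.integral_cong)
        fix z assume "z \<in> space M"
        then have "z \<in> sphere 0 1" by (simp only: circle_finite_space[OF that])
        then show "z powi k = cnj (z ^ nat (- k))"
          using False by (simp add: power_int_def circle_cnj)
      qed simp
      then show ?thesis by (simp add: nat E1.circle_finite_nu E2.circle_finite_nu)
    qed
  qed
  then have "cinner x (E1 A x) = cinner x (E2 A x)" for x
    using E1.measure_nu[OF A, of x] E2.measure_nu[OF A, of x]
    by (simp only: E1.E_form[OF A] E2.E_form[OF A])
  then show ?thesis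
    by (intro clinear_op_eqI E1.E_linear E2.E_linear A)
qed

lemma spectral_projection_eq:
  assumes "unitary_op U" "spectral_resolution U E" "A \<in> sets circle_borel"
  shows "spectral_projection U A = E A"
  unfolding spectral_projection_def
  by (rule the_equality) (use assms spectral_resolution_unique in blast)+

section \<open>The spectral resolution of the CMV operator\<close>

context opuc
begin

text \<open>Multiplication by the indicator of \<open>A\<close>, transported to sequences;
  \<open>spec_proj_coeff_map\<close> shows that the choice made by \<open>repr\<close> does not
  matter.\<close>

definition spec_proj :: "complex set \<Rightarrow> ell2 \<Rightarrow> ell2" where
  "spec_proj A x = coeff_map (\<lambda>z. indicator A z * repr x z)"

lemma sets_mu: "sets \<mu> = sets circle_borel"
  using finite_circle by (simp add: circle_finite_def)

lemma spec_proj_coeff_map: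
  assumes g: "L2 \<mu> g" and A: "A \<in> sets circle_borel"
  shows "spec_proj A (coeff_map g) = coeff_map (\<lambda>z. indicator A z * g z)"
proof -
  have "A \<in> sets \<mu>" using A by (simp add: sets_mu)
  then have "L2 \<mu> (\<lambda>z. indicator A z * repr (coeff_map g) z)" "L2 \<mu> (\<lambda>z. indicator A z * g z)"
    by (simp_all add: L2_indicator repr g)
  moreover have "AE z in \<mu>. indicator A z * repr (coeff_map g) z = indicator A z * g z"
    using repr_coeff_map[OF g] by eventually_elim simp
  ultimately show ?thesis unfolding spec_proj_def by (simp add: coeff_map_eq_iff)
qed

lemma orth_projection_spec_proj:
  assumes A: "A \<in> sets circle_borel"
  shows "orth_projection (spec_proj A)"
proof -
  have ind: "L2 \<mu> (\<lambda>z. indicator A z * g z)" if "L2 \<mu> g" for g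
    using that A by (simp add: L2_indicator sets_mu)
  have rep: "\<exists>g. L2 \<mu> g \<and> x = coeff_map g" for x
    using repr by metis
  have add: "spec_proj A (x + y) = spec_proj A x + spec_proj A y" for x y
  proof -
    obtain f g where "L2 \<mu> f" "x = coeff_map f" "L2 \<mu> g" "y = coeff_map g" using rep by blast
    then show ?thesis
      by (simp add: coeff_map_add[symmetric] spec_proj_coeff_map A ind L2_add distrib_left)
  qed
  have scale: "spec_proj A (scaleC c x) = scaleC c (spec_proj A x)" for c x
  proof -
    obtain g where "L2 \<mu> g" "x = coeff_map g" using rep by blast
    then show ?thesis
      by (simp add: coeff_map_scale[symmetric] spec_proj_coeff_map A ind L2_scale mult.left_commute)
  qed
  have idem: "spec_proj A (spec_proj A x) = spec_proj A x" for x
  proof -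
    obtain g where "L2 \<mu> g" "x = coeff_map g" using rep by blast
    then show ?thesis
      by (simp add: spec_proj_coeff_map A ind mult.assoc[symmetric] indicator_inter_arith[symmetric])
  qed
  have adj: "cinner (spec_proj A x) y = cinner x (spec_proj A y)" for x y
  proof -
    obtain f g where fg: "L2 \<mu> f" "x = coeff_map f" "L2 \<mu> g" "y = coeff_map g" using rep by blast
    have "l2_inner \<mu> (\<lambda>z. indicator A z * f z) g = l2_inner \<mu> f (\<lambda>z. indicator A z * g z)"
      by (rule l2_inner_cong) (simp add: indicator_def)
    then show ?thesis
      by (simp add: fg spec_proj_coeff_map A ind cinner_coeff_map)
  qed
  show ?thesis
    using add scale idem adj by (simp add: orth_projection_def clinear_op_def)
qed

lemma spec_proj_sums:
  fixes A :: "nat \<Rightarrow> complex set"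
  assumes A: "range A \<subseteq> sets circle_borel" and disj: "disjoint_family A"
  shows "(\<lambda>n. spec_proj (A n) x) sums spec_proj (\<Union>n. A n) x"
proof -
  define g where "g = repr x"
  have g: "L2 \<mu> g" and x: "x = coeff_map g" by (simp_all add: g_def repr)
  have gm [measurable]: "g \<in> borel_measurable \<mu>" using g by (rule L2_measurable)
  have An: "A n \<in> sets \<mu>" for n using A by (auto simp: sets_mu)
  then have U: "(\<Union>n. A n) \<in> sets \<mu>" "(\<Union>i<n. A i) \<in> sets \<mu>" for n by auto
  define s where "s n z = indicator (\<Union>i<n. A i) z * g z" for n z
  define h where "h z = indicator (\<Union>n. A n) z * g z" for z
  have s: "L2 \<mu> (s n)" and h: "L2 \<mu> h" for n
    unfolding s_def[abs_def] h_def[abs_def] by (intro L2_indicator g U)+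
  have partial: "(\<Sum>i<n. spec_proj (A i) x) = coeff_map (s n)" for n
  proof (induction n)
    case 0
    have "coeff_map (\<lambda>z. 0) = 0"
      by (rule ell2_eqI) (simp add: coeff_map_nth L2_zero l2_inner_zero ell2_nth_simps)
    then show ?case by (simp add: s_def[abs_def])
  next
    case (Suc n)
    have "indicator (\<Union>i<Suc n. A i) z = (indicator (\<Union>i<n. A i) z + indicator (A n) z :: complex)" for z
    proof -
      have "(\<Union>i<n. A i) \<inter> A n = {}"
      proof (rule equals0I)
        fix w assume "w \<in> (\<Union>i<n. A i) \<inter> A n"
        then obtain i where i: "i < n" "w \<in> A i" "w \<in> A n" by blast
        then have "A i \<inter> A n = {}" by (intro disjoint_family_onD[OF disj]) auto
        with i show False by blast
      qed
      then show ?thesis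
        by (auto simp: indicator_def less_Suc_eq)
    qed
    then have "s (Suc n) = (\<lambda>z. s n z + indicator (A n) z * g z)"
      by (simp add: s_def fun_eq_iff distrib_right)
    then show ?case
      using Suc An[of n] s by (simp add: coeff_map_add L2_indicator g x spec_proj_coeff_map sets_mu)
  qed
  \<comment> \<open>Dominated convergence: each point lies in at most one \<open>A k\<close>, so the
    difference is eventually 0 there, and it is bounded by |g|^2 throughout.\<close>
  have "(\<lambda>n. l2_sq \<mu> (\<lambda>z. s n z - h z)) \<longlonglongrightarrow> (\<integral>z. 0 \<partial>\<mu>)"
    unfolding l2_sq_def
  proof (rule integral_dominated_convergence[where w = "\<lambda>z. (cmod (g z))\<^sup>2"])
    show "(\<lambda>z. (cmod (s n z - h z))\<^sup>2) \<in> borel_measurable \<mu>" for n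
      using L2_measurable[OF s, of n] L2_measurable[OF h] by measurable
    show "integrable \<mu> (\<lambda>z. (cmod (g z))\<^sup>2)" using g by (rule L2_integrable)
    show "AE z in \<mu>. norm ((cmod (s n z - h z))\<^sup>2) \<le> (cmod (g z))\<^sup>2" for n
      by (rule AE_I2) (auto simp: s_def h_def indicator_def)
    show "AE z in \<mu>. (\<lambda>n. (cmod (s n z - h z))\<^sup>2) \<longlonglongrightarrow> 0"
    proof (rule AE_I2)
      fix z
      show "(\<lambda>n. (cmod (s n z - h z))\<^sup>2) \<longlonglongrightarrow> 0"
      proof (cases "z \<in> (\<Union>n. A n)")
        case True
        then obtain k where k: "z \<in> A k" by blast
        have "\<forall>\<^sub>F n in sequentially. (cmod (s n z - h z))\<^sup>2 = 0"
          using eventually_gt_at_top[of k]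
          by eventually_elim (use k in \<open>auto simp: s_def h_def indicator_def\<close>)
        then show ?thesis by (rule tendsto_eventually)
      qed (simp add: s_def h_def)
    qed
  qed simp
  then have "(\<lambda>n. coeff_map (s n)) \<longlonglongrightarrow> coeff_map h"
    by (intro coeff_map_tendsto h s) simp
  moreover have "coeff_map h = spec_proj (\<Union>n. A n) x"
    using U(1) by (simp add: x spec_proj_coeff_map g sets_mu h_def[abs_def])
  ultimately show ?thesis by (simp add: sums_def partial)
qed

lemma projection_valued_measure_spec_proj: "projection_valued_measure spec_proj"
  unfolding projection_valued_measure_def
proof (intro conjI ballI allI impI)
  show "spec_proj (sphere 0 1) = id"
  proof
    fix x
    have "coeff_map (\<lambda>z. indicator (sphere 0 1) z * repr x z) = coeff_map (repr x)"
    proof (rule coeff_map_eq_iff[THEN iffD2])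
      show "L2 \<mu> (\<lambda>z. indicator (sphere 0 1) z * repr x z)"
        using sets.top[of \<mu>] by (intro L2_indicator repr) (simp add: space_mu)
      show "AE z in \<mu>. indicator (sphere 0 1) z * repr x z = repr x z"
        by (rule AE_I2) (simp add: space_mu)
    qed (rule repr)
    then show "spec_proj (sphere 0 1) x = id x" by (simp add: spec_proj_def repr)
  qed
  show "spec_proj (A \<inter> B) = spec_proj A \<circ> spec_proj B"
    if A: "A \<in> sets circle_borel" and B: "B \<in> sets circle_borel" for A B
  proof
    fix x
    have "spec_proj A (spec_proj B x) = coeff_map (\<lambda>z. indicator A z * (indicator B z * repr x z))"
      unfolding spec_proj_def[of B] using B by (intro spec_proj_coeff_map A L2_indicator repr) (simp add: sets_mu)
    then show "spec_proj (A \<inter> B) x = (spec_proj A \<circ> spec_proj B) x"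
      by (simp add: spec_proj_def[of "A \<inter> B"] indicator_inter_arith mult.assoc)
  qed
  show "orth_projection (spec_proj A)" if "A \<in> sets circle_borel" for A
    using that by (rule orth_projection_spec_proj)
  show "(\<lambda>n. spec_proj (A n) x) sums spec_proj (\<Union>n. A n) x"
    if "range A \<subseteq> sets circle_borel" "disjoint_family A" for A :: "nat \<Rightarrow> complex set" and x
    using that by (rule spec_proj_sums)
qed

lemma scalar_measure_spec_proj:
  assumes g: "L2 \<mu> g"
  shows "scalar_spectral_measure spec_proj (coeff_map g) = density \<mu> (\<lambda>z. ennreal ((cmod (g z))\<^sup>2))"
proof -
  interpret P: pvm spec_proj by unfold_locales (rule projection_valued_measure_spec_proj)
  have gm [measurable]: "g \<in> borel_measurable \<mu>" using g by (rule L2_measurable)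
  show ?thesis
  proof (rule measure_eqI)
    fix A assume "A \<in> sets (scalar_spectral_measure spec_proj (coeff_map g))"
    then have A: "A \<in> sets circle_borel" and A': "A \<in> sets \<mu>" by (simp_all add: P.sets_nu sets_mu)
    have "(norm (spec_proj A (coeff_map g)))\<^sup>2 = l2_sq \<mu> (\<lambda>z. indicator A z * g z)"
      by (simp add: spec_proj_coeff_map g A norm_coeff_map L2_indicator A')
    then have "emeasure (scalar_spectral_measure spec_proj (coeff_map g)) A
        = ennreal (\<integral>z. (cmod (indicator A z * g z))\<^sup>2 \<partial>\<mu>)"
      by (simp add: P.emeasure_nu[OF A] l2_sq_def)
    also have "\<dots> = (\<integral>\<^sup>+z. ennreal ((cmod (indicator A z * g z))\<^sup>2) \<partial>\<mu>)"
      by (rule nn_integral_eq_integral[symmetric]) (simp_all add: L2_integrable[OF L2_indicator[OF g A']])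
    also have "\<dots> = (\<integral>\<^sup>+z. ennreal ((cmod (g z))\<^sup>2) * indicator A z \<partial>\<mu>)"
      by (rule nn_integral_cong) (simp add: indicator_def)
    also have "\<dots> = emeasure (density \<mu> (\<lambda>z. ennreal ((cmod (g z))\<^sup>2))) A"
      using A' by (simp add: emeasure_density)
    finally show "emeasure (scalar_spectral_measure spec_proj (coeff_map g)) A
        = emeasure (density \<mu> (\<lambda>z. ennreal ((cmod (g z))\<^sup>2))) A" .
  qed (simp add: P.sets_nu sets_mu)
qed

lemma integral_density_L2:
  fixes f :: "complex \<Rightarrow> complex"
  assumes g: "L2 \<mu> g" and f: "continuous_on (sphere 0 1) f"
  shows "(\<integral>z. f z \<partial>density \<mu> (\<lambda>z. ennreal ((cmod (g z))\<^sup>2))) = l2_inner \<mu> g (\<lambda>z. f z * g z)"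
proof -
  have gm [measurable]: "g \<in> borel_measurable \<mu>" using g by (rule L2_measurable)
  have "(\<integral>z. f z \<partial>density \<mu> (\<lambda>z. ennreal ((cmod (g z))\<^sup>2))) = (\<integral>z. (cmod (g z))\<^sup>2 *\<^sub>R f z \<partial>\<mu>)"
    by (rule integral_density) (auto intro: circle_continuous_measurable[OF finite_circle f])
  also have "\<dots> = l2_inner \<mu> g (\<lambda>z. f z * g z)"
    unfolding l2_inner_def
    by (rule Bochner_Integration.integral_cong)
      (simp_all add: scaleR_conv_of_real complex_norm_square mult_ac del: of_real_power)
  finally show ?thesis .
qed

lemma spectral_resolution_spec_proj: "spectral_resolution (cmv_op a) spec_proj"
  unfolding spectral_resolution_def
proof (intro conjI allI)
  fix x
  have "cinner x (cmv_op a x) = l2_inner \<mu> (repr x) (\<lambda>z. z * repr x z)"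
    using cmv_op_coeff_map[OF repr(1), of x] cinner_coeff_map[OF repr(1) L2_z_mult[OF repr(1)], of x x]
    by (simp add: repr(2))
  also have "\<dots> = (\<integral>z. z \<partial>scalar_spectral_measure spec_proj x)"
    using integral_density_L2[OF repr(1), of "\<lambda>z. z" x] scalar_measure_spec_proj[OF repr(1), of x]
    by (simp add: repr(2) continuous_on_id)
  finally show "cinner x (cmv_op a x) = (\<integral>z. z \<partial>scalar_spectral_measure spec_proj x)" .
qed (rule projection_valued_measure_spec_proj)

lemma spectral_projection_cmv:
  "A \<in> sets circle_borel \<Longrightarrow> spectral_projection (cmv_op a) A = spec_proj A"
  by (rule spectral_projection_eq[OF cmv_op_unitary_a spectral_resolution_spec_proj])

end

section \<open>Normalized Lebesgue measure on the circle\<close>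

definition circle_uniform :: "complex measure" where
  "circle_uniform = distr (uniform_measure lborel {0..<2 * pi}) circle_borel cis"

lemma measurable_cis_circle: "sets M = sets borel \<Longrightarrow> cis \<in> measurable M circle_borel"
  unfolding circle_borel_def
  by (rule measurable_restrict_space2)
    (auto simp: measurable_cong_sets[of M borel] intro!: borel_measurable_continuous_onI continuous_intros)

lemma sets_circle_uniform: "sets circle_uniform = sets circle_borel"
  by (simp add: circle_uniform_def)

lemma prob_space_circle_uniform: "prob_space circle_uniform"
  unfolding circle_uniform_def
  by (intro prob_space.prob_space_distr prob_space_uniform_measure measurable_cis_circle) simp_all

lemma circle_finite_uniform: "circle_finite circle_uniform"
  using prob_space_circle_uniform
  by (simp add: circle_finite_def sets_circle_uniform prob_space_def)

lemma emeasure_circle_uniform: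
  assumes A: "A \<in> sets circle_borel"
  shows "emeasure circle_uniform A = emeasure lborel ({0..<2 * pi} \<inter> cis -` A) / ennreal (2 * pi)"
proof -
  have "cis \<in> measurable borel circle_borel" by (rule measurable_cis_circle) simp
  from measurable_sets[OF this A] have "cis -` A \<in> sets borel" by simp
  then show ?thesis
    unfolding circle_uniform_def using A
    by (subst emeasure_distr) (simp_all add: measurable_cis_circle)
qed

lemma emeasure_circle_lebesgue:
  assumes A: "A \<in> sets circle_borel"
  shows "emeasure circle_lebesgue A = emeasure lborel ({0..<2 * pi} \<inter> cis -` A)"
proof -
  have m: "cis \<in> measurable borel circle_borel" by (rule measurable_cis_circle) simp
  then have "cis \<in> measurable (restrict_space lborel {0..<2 * pi}) circle_borel"
    by (intro measurable_restrict_space1) simp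
  then show ?thesis
    unfolding circle_lebesgue_def using A measurable_sets[OF m A]
    by (subst emeasure_distr)
      (auto simp: space_restrict_space emeasure_restrict_space Int_commute)
qed

lemma circle_uniform_null_iff:
  "A \<in> sets circle_borel \<Longrightarrow> emeasure circle_uniform A = 0 \<longleftrightarrow> emeasure circle_lebesgue A = 0"
  by (simp add: emeasure_circle_uniform emeasure_circle_lebesgue ennreal_divide_eq_0_iff)

lemma circle_uniform_moments:
  "(\<integral>z. z powi k \<partial>circle_uniform) = (if k = 0 then 1 else 0)"
proof (cases "k = 0")
  case True
  then show ?thesis
    using prob_space.prob_space[OF prob_space_circle_uniform] by simp
next
  case False
  define c where "c = \<i> * complex_of_int k"
  have c: "c \<noteq> 0" using False by (simp add: c_def)
  have cis: "cis \<theta> powi k = exp (c * of_real \<theta>)" for \<theta>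
    unfolding cis_power_int by (simp add: cis_conv_exp c_def mult_ac)
  have "(\<integral>z. z powi k \<partial>circle_uniform) = (\<integral>\<theta>. cis \<theta> powi k \<partial>uniform_measure lborel {0..<2 * pi})"
    unfolding circle_uniform_def
    by (rule integral_distr)
      (auto intro!: measurable_cis_circle circle_continuous_measurable[OF circle_finite_uniform, unfolded
        measurable_cong_sets[OF sets_circle_uniform refl]] continuous_intros)
  also have "uniform_measure lborel {0..<2 * pi} = density lborel (\<lambda>\<theta>. ennreal (indicator {0..<2 * pi} \<theta> / (2 * pi)))"
    unfolding uniform_measure_def
    by (rule density_cong) (auto simp: divide_ennreal[symmetric] ennreal_indicator)
  also have "(\<integral>\<theta>. cis \<theta> powi k \<partial>density lborel (\<lambda>\<theta>. ennreal (indicator {0..<2 * pi} \<theta> / (2 * pi))))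
      = (\<integral>\<theta>. (indicator {0..<2 * pi} \<theta> / (2 * pi)) *\<^sub>R (cis \<theta> powi k) \<partial>lborel)"
    unfolding cis
    by (rule integral_density) (auto intro!: borel_measurable_continuous_onI continuous_intros)
  \<comment> \<open>The half-open interval is closed up at \<open>2 * pi\<close>, a null set,
    because the fundamental theorem is applied on a closed interval.\<close>
  also have "\<dots> = (\<integral>\<theta>. (1 / (2 * pi)) *\<^sub>R (indicator {0..2 * pi} \<theta> *\<^sub>R exp (c * of_real \<theta>)) \<partial>lborel)"
  proof (rule integral_cong_AE)
    show "AE \<theta> in lborel. (indicator {0..<2 * pi} \<theta> / (2 * pi)) *\<^sub>R (cis \<theta> powi k)
        = (1 / (2 * pi)) *\<^sub>R (indicator {0..2 * pi} \<theta> *\<^sub>R exp (c * of_real \<theta>))"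
      using AE_lborel_singleton[of "2 * pi"]
      by eventually_elim (auto simp: cis indicator_def)
  qed (auto simp: cis intro!: borel_measurable_continuous_onI continuous_intros borel_measurable_scaleR)
  also have "\<dots> = (1 / (2 * pi)) *\<^sub>R (exp (c * of_real (2 * pi)) / c - exp (c * of_real 0) / c)"
    unfolding integral_scaleR_right
  proof (subst integral_FTC_atLeastAtMost[where F = "\<lambda>\<theta>. exp (c * of_real \<theta>) / c"])
    show "((\<lambda>\<theta>. exp (c * of_real \<theta>) / c) has_vector_derivative exp (c * of_real x)) (at x within {0..2 * pi})" for x
      by (rule has_vector_derivative_real_field) (use c in \<open>auto intro!: derivative_eq_intros\<close>)
  qed (auto intro!: continuous_intros)
  also have "exp (c * of_real (2 * pi)) = 1"
    unfolding exp_eq_1 by (auto simp: c_def)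
  finally show ?thesis using False by simp
qed

text \<open>Since \<open>cis\<close> is injective on the half-open interval, every single point has
  measure 0. A combination of point masses would then have all weights 0, against total mass
  1.\<close>

lemma nontrivial_circle_uniform: "nontrivial_measure circle_uniform"
  unfolding nontrivial_measure_def
proof
  assume "\<exists>F c. finite F \<and> F \<subseteq> sphere 0 1 \<and>
      (\<forall>A\<in>sets circle_uniform. measure circle_uniform A = (\<Sum>z\<in>F. c z * indicator A z))"
  then obtain F and c :: "complex \<Rightarrow> real" where F: "finite F" "F \<subseteq> sphere 0 1"
    and eq: "\<And>A. A \<in> sets circle_borel \<Longrightarrow> measure circle_uniform A = (\<Sum>z\<in>F. c z * indicator A z)"
    by (auto simp: sets_circle_uniform)
  have "c z = 0" if z: "z \<in> F" for z
  proof -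
    have zs: "{z} \<in> sets circle_borel" using F z by (auto simp: sets_circle_borel)
    have "inj_on cis {0..<2 * pi}"
    proof (rule inj_onI)
      fix x y assume x: "x \<in> {0..<2 * pi}" and y: "y \<in> {0..<2 * pi}" and "cis x = cis y"
      then have "sin x = sin y \<and> cos x = cos y" by (simp add: complex_eq_iff)
      then obtain n :: int where n: "x = y + 2 * pi * n" using sin_cos_eq_iff by blast
      then have "\<bar>2 * pi * real_of_int n\<bar> < 2 * pi * 1" using x y by auto
      then have "\<bar>real_of_int n\<bar> < 1" by (simp add: abs_mult)
      then show "x = y" using n by simp
    qed
    then have "\<exists>t. {0..<2 * pi} \<inter> cis -` {z} \<subseteq> {t}"
      unfolding inj_on_def by auto
    then have "countable ({0..<2 * pi} \<inter> cis -` {z})"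
      by (meson countable_finite finite.emptyI finite_insert finite_subset)
    then have "emeasure lborel ({0..<2 * pi} \<inter> cis -` {z}) = 0"
      by (rule emeasure_lborel_countable)
    then have "measure circle_uniform {z} = 0"
      by (simp add: measure_def emeasure_circle_uniform[OF zs])
    moreover have "measure circle_uniform {z} = c z"
      using F z unfolding eq[OF zs] by (subst sum.remove[of _ z]) (auto intro!: sum.neutral)
    ultimately show ?thesis by simp
  qed
  then have "measure circle_uniform (sphere 0 1) = 0"
    by (subst eq) (auto simp: sets_circle_borel)
  moreover have "measure circle_uniform (sphere 0 1) = 1"
    using prob_space.prob_space[OF prob_space_circle_uniform] circle_finite_space[OF circle_finite_uniform] by simp
  ultimately show False by simp
qed

text \<open>Its Verblunsky coefficients turn out to be 0, so the free operator is the CMV operator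
  of this measure and everything proved in the locale applies to it.\<close>

interpretation uniform: opuc circle_uniform
  by unfold_locales
    (simp_all add: circle_prob_def sets_circle_uniform prob_space_circle_uniform nontrivial_circle_uniform)

lemma uniform_Phi: "uniform.Phi n = monom 1 n"
proof -
  have "(\<integral>z. cnj (z ^ m) * z ^ n \<partial>circle_uniform) = 0" if "m \<noteq> n" for m n :: nat
  proof -
    have "(\<integral>z. cnj (z ^ m) * z ^ n \<partial>circle_uniform) = (\<integral>z. z powi (int n - int m) \<partial>circle_uniform)"
    proof (rule Bochner_Integration.integral_cong)
      fix z assume "z \<in> space circle_uniform"
      then have z: "z \<in> sphere 0 1" by (simp add: uniform.space_mu)
      have "z powi (int n - int m) = cnj (z powi int m) * z powi int n"
        by (subst circle_cnj_powi[OF z], subst power_int_add[symmetric]) (use z in auto)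
      then show "cnj (z ^ m) * z ^ n = z powi (int n - int m)" by simp
    qed simp
    then show ?thesis using that by (simp add: circle_uniform_moments)
  qed
  then have "monic_orthogonal_polys circle_uniform (monom 1)"
    by (simp add: monic_orthogonal_polys_def degree_monom_eq poly_monom)
  from uniform.monic_orthogonal_unique[OF this] show ?thesis by simp
qed

lemma uniform_a: "uniform.a = (\<lambda>_. 0)"
proof
  fix n
  have "verblunsky circle_uniform n = 0"
    by (simp add: verblunsky_def uniform.monic_OPUC_eq uniform_Phi poly_monom)
  then show "uniform.a n = 0" by (simp add: uniform.verblunsky_eq)
qed

lemma uniform_N: "uniform.N n = 1"
  by (induction n) (simp_all add: uniform.N_0 uniform.N_Suc uniform_a)

lemma uniform_psi:
  assumes z: "z \<in> sphere 0 1"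
  shows "uniform.psi i z = z powi (if even i then - int (i div 2) else int (Suc i div 2))"
proof -
  have "z \<noteq> 0" using z by auto
  have "cnj z * z = 1" by (rule circle_cnj_mult[OF z])
  then have zz: "z ^ i * cnj z ^ i = 1" by (simp add: mult.commute flip: power_mult_distrib)
  show ?thesis
  proof (cases "even i")
    case True
    then show ?thesis
      by (simp add: uniform.psi_def uniform.phis_phi[OF z] uniform.phi_def uniform_Phi uniform_N poly_monom zz)
  next
    case False
    then obtain k where k: "i = 2 * k + 1" by (rule oddE)
    have "z powi (- int k) * z ^ i = z powi (- int k + int i)"
      using power_int_add[of z "- int k" "int i"] \<open>z \<noteq> 0\<close> by (simp only: power_int_of_nat simp_thms)
    then show ?thesis
      using False by (simp add: uniform.psi_def uniform.phi_def uniform_Phi uniform_N poly_monom k add.commute)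
  qed
qed

section \<open>The limit of the reversed orthonormal polynomials\<close>

context opuc
begin

lemma N_decseq: "decseq N"
proof (rule decseq_SucI)
  fix n
  have "(1 - (cmod (a n))\<^sup>2) * N n \<le> 1 * N n"
    using N_pos[of n] by (intro mult_right_mono) auto
  then show "N (Suc n) \<le> N n" by (simp add: N_Suc)
qed

text \<open>Square-summability enters here: it makes the product of the positive factors
  \<open>1 - (cmod (a n))^2\<close> converge to a nonzero limit.\<close>

lemma N_limit:
  assumes "summable (\<lambda>n. (cmod (a n))\<^sup>2)"
  obtains l where "l > 0" "N \<longlonglongrightarrow> l"
proof -
  let ?f = "\<lambda>n. 1 - (cmod (a n))\<^sup>2"
  have pos: "?f n > 0" for n using cmod_a[of n] by (simp add: abs_square_less_1)
  have "abs_convergent_prod ?f"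
    using assms by (intro summable_imp_abs_convergent_prod) simp
  then have "convergent_prod ?f" by (rule abs_convergent_prod_imp_convergent_prod)
  then obtain l where l: "(\<lambda>n. \<Prod>i\<le>n. ?f i) \<longlonglongrightarrow> l" "l \<noteq> 0"
    using pos by (subst (asm) convergent_prod_iff_nz_lim) (auto simp: less_imp_neq[symmetric])
  have "N (Suc n) = (\<Prod>i\<le>n. ?f i)" for n
    by (induction n) (simp_all add: N_Suc N_0)
  then have "N \<longlonglongrightarrow> l" using l(1) by (simp add: LIMSEQ_imp_Suc)
  moreover have "l \<ge> 0" using LIMSEQ_le_const[OF \<open>N \<longlonglongrightarrow> l\<close>, of 0] N_pos less_imp_le by blast
  then have "l > 0" using l(2) by simp
  ultimately show ?thesis by (intro that)
qed

text \<open>The reproducing property, since \<open>phis m\<close> has value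
  \<open>1 / sqrt (N m)\<close> at 0.\<close>

lemma inner_phis:
  assumes "m \<le> n"
  shows "l2_inner \<mu> (phis m) (phis n) = of_real (sqrt (N n) / sqrt (N m))"
proof -
  let ?p = "smult (1 / of_real (sqrt (N m))) (star_poly (Phi m))"
  have p: "phis m = poly ?p" by (simp add: phis_def fun_eq_iff)
  have "degree ?p \<le> n"
    using degree_star_poly[of "Phi m"] assms
    by (intro order_trans[OF degree_smult_le]) (simp add: degree_Phi)
  then show ?thesis
    unfolding p by (subst inner_poly_phis) (simp_all add: coeff_star_poly degree_Phi lead_coeff_Phi)
qed

lemma phis_limit:
  assumes "summable (\<lambda>n. (cmod (a n))\<^sup>2)"
  obtains F where "L2 \<mu> F" "(\<lambda>n. l2_sq \<mu> (\<lambda>z. phis n z - F z)) \<longlonglongrightarrow> 0"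
proof -
  obtain l where l: "l > 0" "N \<longlonglongrightarrow> l" using N_limit[OF assms] by blast
  define s where "s n = sqrt (N n)" for n
  have s_ge: "s n \<ge> sqrt l" for n
    using decseq_ge[OF N_decseq l(2), of n] by (simp add: s_def)
  have cauchy: "Cauchy s"
    unfolding s_def[abs_def] by (rule LIMSEQ_imp_Cauchy[OF tendsto_real_sqrt[OF l(2)]])
  \<comment> \<open>For unit vectors the square distance is 2 minus twice the inner product, here
    \<open>2 - 2 * (s n / s m)\<close>; the positive lower bound \<open>sqrt l\<close> keeps the
    denominator under control.\<close>
  have less: "l2_sq \<mu> (\<lambda>z. phis m z - phis n z) \<le> 2 * \<bar>s m - s n\<bar> / sqrt l" if "m \<le> n" for m n
  proof -
    have sm: "s m > 0" using N_pos[of m] by (simp add: s_def)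
    have "l2_sq \<mu> (\<lambda>z. phis m z - phis n z) = 2 - 2 * (s n / s m)"
      by (simp add: l2_sq_diff L2_phis l2_sq_phis inner_phis[OF that] s_def)
    also have "\<dots> = 2 * (s m - s n) / s m" using sm by (simp add: field_simps)
    also have "\<dots> \<le> 2 * \<bar>s m - s n\<bar> / s m" using sm by (intro divide_right_mono mult_left_mono abs_ge_self) auto
    also have "\<dots> \<le> 2 * \<bar>s m - s n\<bar> / sqrt l" using s_ge l by (intro divide_left_mono) (auto intro: mult_pos_pos sm)
    finally show ?thesis .
  qed
  have le: "l2_sq \<mu> (\<lambda>z. phis m z - phis n z) \<le> 2 * \<bar>s m - s n\<bar> / sqrt l" for m n
  proof (cases "m \<le> n")
    case False
    have "l2_sq \<mu> (\<lambda>z. phis m z - phis n z) = l2_sq \<mu> (\<lambda>z. phis n z - phis m z)"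
      by (simp add: l2_sq_def norm_minus_commute)
    then show ?thesis using less[of n m] False by (simp add: abs_minus_commute)
  qed (rule less)
  show ?thesis
  proof (rule L2_complete[of phis, OF L2_phis])
    fix e :: real assume "e > 0"
    then have "e * sqrt l / 2 > 0" using l by simp
    from CauchyD[OF cauchy this] obtain K where K: "\<And>m n. m \<ge> K \<Longrightarrow> n \<ge> K \<Longrightarrow> \<bar>s m - s n\<bar> < e * sqrt l / 2"
      by auto
    have "l2_sq \<mu> (\<lambda>z. phis m z - phis n z) < e" if "m \<ge> K" "n \<ge> K" for m n
    proof -
      have "2 * \<bar>s m - s n\<bar> / sqrt l < e" using K[OF that] l by (simp add: field_simps)
      with le[of m n] show ?thesis by linarith
    qed
    then show "\<exists>K. \<forall>m\<ge>K. \<forall>n\<ge>K. l2_sq \<mu> (\<lambda>z. phis m z - phis n z) < e" by blast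
  qed (rule that)
qed

text \<open>z^k phis_n has degree at most \<open>n + k\<close> and vanishes at 0, so the reproducing
  property of \<open>phis (n + k)\<close> gives 0.\<close>

lemma inner_phis_shift:
  assumes "k > 0"
  shows "l2_inner \<mu> (phis (n + k)) (\<lambda>z. z ^ k * phis n z) = 0"
proof -
  let ?p = "monom 1 k * smult (1 / of_real (sqrt (N n))) (star_poly (Phi n))"
  have p: "(\<lambda>z. z ^ k * phis n z) = poly ?p" by (simp add: phis_def fun_eq_iff poly_monom)
  have "degree ?p \<le> n + k"
    using degree_star_poly[of "Phi n"]
    by (intro order_trans[OF degree_mult_le] order_trans[OF add_mono[OF degree_monom_le degree_smult_le]])
      (simp add: degree_Phi)
  then have "l2_inner \<mu> (poly ?p) (phis (n + k)) = 0"
    using assms by (subst inner_poly_phis) (simp_all add: coeff_monom_mult)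
  then show ?thesis unfolding p by (metis l2_inner_cnj complex_cnj_zero)
qed

lemma density_phis_limit:
  assumes F: "L2 \<mu> F" and lim: "(\<lambda>n. l2_sq \<mu> (\<lambda>z. phis n z - F z)) \<longlonglongrightarrow> 0"
  shows "density \<mu> (\<lambda>z. ennreal ((cmod (F z))\<^sup>2)) = circle_uniform"
proof (rule circle_measure_eqI[OF _ circle_finite_uniform])
  have Fm [measurable]: "F \<in> borel_measurable \<mu>" using F by (rule L2_measurable)
  have "emeasure (density \<mu> (\<lambda>z. ennreal ((cmod (F z))\<^sup>2))) (sphere 0 1) = (\<integral>\<^sup>+z. ennreal ((cmod (F z))\<^sup>2) \<partial>\<mu>)"
    using sets.top[of \<mu>] by (subst emeasure_density) (auto simp: space_mu intro!: nn_integral_cong)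
  also have "\<dots> = ennreal (l2_sq \<mu> F)"
    unfolding l2_sq_def by (rule nn_integral_eq_integral) (simp_all add: L2_integrable F)
  finally have "finite_measure (density \<mu> (\<lambda>z. ennreal ((cmod (F z))\<^sup>2)))"
    by (intro finite_measureI) (simp add: space_mu)
  then show "circle_finite (density \<mu> (\<lambda>z. ennreal ((cmod (F z))\<^sup>2)))"
    by (simp add: circle_finite_def sets_mu)
  have T: "(\<lambda>n. coeff_map (phis (n + k))) \<longlonglongrightarrow> coeff_map F" for k
    by (rule LIMSEQ_ignore_initial_segment[OF coeff_map_tendsto[OF F L2_phis lim]])
  have pow: "L2 \<mu> (\<lambda>z. z ^ k * g z)" if "L2 \<mu> g" for k g
    using L2_powi_mult[OF that, of "int k"] by simp
  have Tk: "(\<lambda>n. coeff_map (\<lambda>z. z ^ k * phis n z)) \<longlonglongrightarrow> coeff_map (\<lambda>z. z ^ k * F z)" for k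
  proof (rule coeff_map_tendsto[OF pow[OF F] pow[OF L2_phis]])
    have "l2_sq \<mu> (\<lambda>z. z ^ k * phis n z - z ^ k * F z) = l2_sq \<mu> (\<lambda>z. phis n z - F z)" for n
      by (rule l2_sq_cong) (simp add: norm_mult norm_power flip: right_diff_distrib)
    then show "(\<lambda>n. l2_sq \<mu> (\<lambda>z. z ^ k * phis n z - z ^ k * F z)) \<longlonglongrightarrow> 0" using lim by simp
  qed
  \<comment> \<open>Both slots converge as \<open>n\<close> grows, with the left index running ahead
    by \<open>k\<close>; the inner products along the way are constant in \<open>n\<close>.\<close>
  have nat: "l2_inner \<mu> F (\<lambda>z. z ^ k * F z) = (if k = 0 then 1 else 0)" for k
  proof -
    have "(\<lambda>n. cinner (coeff_map (phis (n + k))) (coeff_map (\<lambda>z. z ^ k * phis n z)))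
        \<longlonglongrightarrow> cinner (coeff_map F) (coeff_map (\<lambda>z. z ^ k * F z))"
      by (rule tendsto_cinner[OF T Tk])
    moreover have "cinner (coeff_map (phis (n + k))) (coeff_map (\<lambda>z. z ^ k * phis n z)) = (if k = 0 then 1 else 0)" for n
      using inner_phis_shift[of k n] by (simp add: cinner_coeff_map L2_phis pow l2_inner_self l2_sq_phis)
    ultimately show ?thesis
      by (simp add: cinner_coeff_map F pow LIMSEQ_const_iff)
  qed
  have neg: "l2_inner \<mu> F (\<lambda>z. z powi (- int k) * F z) = cnj (l2_inner \<mu> F (\<lambda>z. z ^ k * F z))" for k
  proof -
    have "l2_inner \<mu> F (\<lambda>z. z powi (- int k) * F z) = l2_inner \<mu> (\<lambda>z. z ^ k * F z) F"
      by (rule l2_inner_cong) (simp add: circle_cnj power_int_minus power_inverse)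
    then show ?thesis by (simp add: l2_inner_cnj)
  qed
  fix k :: int
  have "(\<integral>z. z powi k \<partial>density \<mu> (\<lambda>z. ennreal ((cmod (F z))\<^sup>2))) = l2_inner \<mu> F (\<lambda>z. z powi k * F z)"
    by (rule integral_density_L2[OF F]) (intro continuous_intros)
  also have "\<dots> = (if k = 0 then 1 else 0)"
  proof (cases "k \<ge> 0")
    case True
    then show ?thesis using nat[of "nat k"] by (simp add: power_int_def)
  next
    case False
    then show ?thesis using neg[of "nat (- k)"] nat[of "nat (- k)"] by simp
  qed
  finally show "(\<integral>z. z powi k \<partial>density \<mu> (\<lambda>z. ennreal ((cmod (F z))\<^sup>2))) = (\<integral>z. z powi k \<partial>circle_uniform)"
    by (simp add: circle_uniform_moments)
qed

end

section \<open>The wave operators\<close>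

context opuc
begin

lemma coeff_map_cong: "(\<And>z. z \<in> sphere 0 1 \<Longrightarrow> f z = g z) \<Longrightarrow> coeff_map f = coeff_map g"
  unfolding coeff_map_def by (intro arg_cong[of _ _ Abs_ell2] ext l2_inner_cong) simp

text \<open>A sequence is read as a function in the free basis, multiplied by \<open>G\<close>, and
  expanded again in the CMV basis of the given measure.\<close>

definition wave_op :: "(complex \<Rightarrow> complex) \<Rightarrow> ell2 \<Rightarrow> ell2" where
  "wave_op G x = coeff_map (\<lambda>z. G z * uniform.repr x z)"

end

text \<open>Both the limit function and its conjugate satisfy these assumptions, so each property of
  the two wave operators is proved once.\<close>

locale opuc_density = opuc +
  fixes G :: "complex \<Rightarrow> complex"
  assumes G_L2: "L2 \<mu> G"
    and G_density: "density \<mu> (\<lambda>z. ennreal ((cmod (G z))\<^sup>2)) = circle_uniform"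
begin

lemma G_measurable [measurable]: "G \<in> borel_measurable \<mu>"
  using G_L2 by (rule L2_measurable)

lemma measurable_uniform_iff: "h \<in> borel_measurable circle_uniform \<longleftrightarrow> h \<in> borel_measurable \<mu>"
  by (rule arg_cong[where f = "\<lambda>X. h \<in> X"]) (rule measurable_cong_sets, simp_all add: sets_mu sets_circle_uniform)

lemma L2_uniform_iff:
  assumes h: "h \<in> borel_measurable \<mu>"
  shows "L2 circle_uniform h \<longleftrightarrow> L2 \<mu> (\<lambda>z. G z * h z)"
proof -
  have [measurable]: "h \<in> borel_measurable \<mu>" by fact
  have "integrable circle_uniform (\<lambda>z. (cmod (h z))\<^sup>2)
      \<longleftrightarrow> integrable \<mu> (\<lambda>z. (cmod (G z))\<^sup>2 *\<^sub>R (cmod (h z))\<^sup>2)"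
    unfolding G_density[symmetric] by (rule integrable_density) auto
  then show ?thesis
    by (simp add: L2_def h measurable_uniform_iff norm_mult power_mult_distrib)
qed

lemma l2_sq_uniform:
  assumes h: "L2 circle_uniform h"
  shows "l2_sq \<mu> (\<lambda>z. G z * h z) = l2_sq circle_uniform h"
proof -
  have [measurable]: "h \<in> borel_measurable \<mu>"
    using L2_measurable[OF h] by (simp add: measurable_uniform_iff)
  have "l2_sq circle_uniform h = (\<integral>z. (cmod (G z))\<^sup>2 *\<^sub>R (cmod (h z))\<^sup>2 \<partial>\<mu>)"
    unfolding l2_sq_def G_density[symmetric] by (rule integral_density) auto
  then show ?thesis by (simp add: l2_sq_def norm_mult power_mult_distrib)
qed

lemma L2_G_mult: "L2 circle_uniform h \<Longrightarrow> L2 \<mu> (\<lambda>z. G z * h z)"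
  using L2_uniform_iff L2_measurable measurable_uniform_iff by blast

text \<open>Two representatives of the same sequence agree only almost everywhere for normalized
  Lebesgue measure. After multiplication by \<open>G\<close> they agree almost everywhere for
  \<open>\<mu>\<close>, because this multiplication preserves the square norm.\<close>

lemma wave_op_coeff_map:
  assumes h: "L2 circle_uniform h"
  shows "wave_op G (uniform.coeff_map h) = coeff_map (\<lambda>z. G z * h z)"
proof -
  let ?r = "uniform.repr (uniform.coeff_map h)"
  have r: "L2 circle_uniform ?r" by (rule uniform.repr)
  have "l2_sq \<mu> (\<lambda>z. G z * ?r z - G z * h z) = l2_sq circle_uniform (\<lambda>z. ?r z - h z)"
    using l2_sq_uniform[OF L2_diff[OF r h]] by (simp add: right_diff_distrib)
  also have "\<dots> = 0"
    using uniform.repr_coeff_map[OF h] by (subst l2_sq_eq_0_iff[OF L2_diff[OF r h]]) simp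
  finally have "AE z in \<mu>. G z * ?r z = G z * h z"
    by (simp add: l2_sq_eq_0_iff[OF L2_diff[OF L2_G_mult[OF r] L2_G_mult[OF h]]])
  then show ?thesis
    unfolding wave_op_def by (subst coeff_map_eq_iff) (simp_all add: L2_G_mult r h)
qed

lemma wave_op_linear: "clinear_op (wave_op G)"
proof -
  have rep: "\<exists>h. L2 circle_uniform h \<and> x = uniform.coeff_map h" for x
    using uniform.repr by metis
  have "wave_op G (x + y) = wave_op G x + wave_op G y" for x y
  proof -
    obtain f g where "L2 circle_uniform f" "x = uniform.coeff_map f"
      "L2 circle_uniform g" "y = uniform.coeff_map g" using rep by blast
    then show ?thesis
      by (simp add: wave_op_coeff_map L2_G_mult L2_add distrib_left flip: uniform.coeff_map_add coeff_map_add)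
  qed
  moreover have "wave_op G (scaleC c x) = scaleC c (wave_op G x)" for c x
  proof -
    obtain f where "L2 circle_uniform f" "x = uniform.coeff_map f" using rep by blast
    then show ?thesis
      by (simp add: wave_op_coeff_map L2_G_mult L2_scale mult.left_commute
          flip: uniform.coeff_map_scale coeff_map_scale)
  qed
  ultimately show ?thesis by (simp add: clinear_op_def)
qed

lemma norm_wave_op: "norm (wave_op G x) = norm x"
proof -
  have r: "L2 circle_uniform (uniform.repr x)" by (rule uniform.repr)
  have "(norm (wave_op G x))\<^sup>2 = l2_sq circle_uniform (uniform.repr x)"
    by (simp add: wave_op_def norm_coeff_map L2_G_mult r l2_sq_uniform)
  also have "\<dots> = (norm x)\<^sup>2"
    using uniform.norm_coeff_map[OF r] by (simp add: uniform.repr)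
  finally show ?thesis by (simp add: power2_eq_iff_nonneg)
qed

lemma emeasure_uniform_null_iff:
  assumes B: "B \<in> sets circle_borel"
  shows "emeasure circle_uniform B = 0 \<longleftrightarrow> (AE z in \<mu>. z \<in> B \<longrightarrow> G z = 0)"
proof -
  have B': "B \<in> sets \<mu>" using B by (simp add: sets_mu)
  have "emeasure circle_uniform B = (\<integral>\<^sup>+z. ennreal ((cmod (G z))\<^sup>2) * indicator B z \<partial>\<mu>)"
    unfolding G_density[symmetric] using B' by (simp add: emeasure_density)
  then have "emeasure circle_uniform B = 0 \<longleftrightarrow> (AE z in \<mu>. ennreal ((cmod (G z))\<^sup>2) * indicator B z = 0)"
    using B' by (simp add: nn_integral_0_iff_AE)
  also have "\<dots> \<longleftrightarrow> (AE z in \<mu>. z \<in> B \<longrightarrow> G z = 0)"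
    by (rule arg_cong[where f = "\<lambda>P. almost_everywhere \<mu> P"]) (auto simp: fun_eq_iff indicator_def)
  finally show ?thesis .
qed

text \<open>Off \<open>S\<close>, a Lebesgue-null set, \<open>G\<close> must vanish. Conversely the
  part of \<open>S\<close> where \<open>G\<close> vanishes is Lebesgue-null, so the absolutely
  continuous part does not charge it, and the singular part does not charge \<open>S\<close> at
  all.\<close>

lemma support_AE:
  assumes dec: "circle_decomposition \<mu> w \<mu>\<^sub>s" and S: "S \<in> sets circle_borel"
    and S0: "emeasure \<mu>\<^sub>s S = 0" and S1: "emeasure circle_lebesgue (sphere 0 1 - S) = 0"
  shows "AE z in \<mu>. G z \<noteq> 0 \<longleftrightarrow> z \<in> S"
proof -
  have Sc: "sphere 0 1 - S \<in> sets circle_borel" using S by (auto simp: sets_circle_borel)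
  have "AE z in \<mu>. z \<in> sphere 0 1 - S \<longrightarrow> G z = 0"
    by (rule iffD1[OF emeasure_uniform_null_iff[OF Sc] iffD2[OF circle_uniform_null_iff[OF Sc] S1]])
  moreover have "AE z in \<mu>. z \<notin> {z \<in> space \<mu>. G z = 0} \<inter> S"
  proof (rule AE_not_in)
    define B where "B = {z \<in> space \<mu>. G z = 0}"
    have B: "B \<in> sets circle_borel" unfolding sets_mu[symmetric] B_def by measurable
    then have BS: "B \<inter> S \<in> sets circle_borel" using S by blast
    \<comment> \<open>Normalized Lebesgue measure has density |G|^2, hence gives no mass to the zero
      set of \<open>G\<close>.\<close>
    have "emeasure circle_uniform B = 0"
      unfolding emeasure_uniform_null_iff[OF B] by (rule AE_I2) (simp add: B_def)
    then have "emeasure lborel ({0..<2 * pi} \<inter> cis -` B) = 0"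
      using circle_uniform_null_iff[OF B] emeasure_circle_lebesgue[OF B] by simp
    moreover have "{0..<2 * pi} \<inter> cis -` B \<in> sets lborel"
      using measurable_sets[OF measurable_cis_circle[of borel] B] by simp
    ultimately have null: "{0..<2 * pi} \<inter> cis -` B \<in> null_sets lborel" by auto
    have "(\<integral>\<^sup>+\<theta>\<in>{0..<2 * pi}. ennreal (w \<theta> / (2 * pi)) * indicator (B \<inter> S) (cis \<theta>) \<partial>lborel) = (\<integral>\<^sup>+\<theta>. 0 \<partial>(lborel :: real measure))"
    proof (rule nn_integral_cong_AE)
      show "AE \<theta> in lborel. ennreal (w \<theta> / (2 * pi)) * indicator (B \<inter> S) (cis \<theta>) * indicator {0..<2 * pi} \<theta> = 0"
        using AE_not_in[OF null] by eventually_elim (auto simp: indicator_def)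
    qed
    moreover have "emeasure \<mu>\<^sub>s (B \<inter> S) \<le> emeasure \<mu>\<^sub>s S"
      using dec S by (intro emeasure_mono) (auto simp: circle_decomposition_def)
    ultimately have "emeasure \<mu> (B \<inter> S) = 0"
      using dec BS S0 by (simp add: circle_decomposition_def)
    then show "{z \<in> space \<mu>. G z = 0} \<inter> S \<in> null_sets \<mu>"
      using BS by (auto simp: null_sets_def sets_mu B_def)
  qed
  ultimately show ?thesis
    using AE_space by eventually_elim (auto simp: space_mu)
qed

lemma range_wave_op:
  assumes S: "S \<in> sets circle_borel" and ae: "AE z in \<mu>. G z \<noteq> 0 \<longleftrightarrow> z \<in> S"
  shows "range (wave_op G) = range (spec_proj S)"
proof -
  have S': "S \<in> sets \<mu>" using S by (simp add: sets_mu)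
  have "wave_op G x \<in> range (spec_proj S)" for x
  proof -
    let ?g = "\<lambda>z. G z * uniform.repr x z"
    have g: "L2 \<mu> ?g" by (intro L2_G_mult uniform.repr)
    have "AE z in \<mu>. indicator S z * ?g z = ?g z"
      using ae by eventually_elim (auto simp: indicator_def)
    then have "spec_proj S (wave_op G x) = wave_op G x"
      unfolding wave_op_def spec_proj_coeff_map[OF g S]
      by (subst coeff_map_eq_iff) (simp_all add: L2_indicator g S')
    then show ?thesis by (metis rangeI)
  qed
  moreover have "spec_proj S y \<in> range (wave_op G)" for y
  proof -
    have [measurable]: "repr y \<in> borel_measurable \<mu>" by (rule L2_measurable[OF repr(1)])
    have Sg: "L2 \<mu> (\<lambda>z. indicator S z * repr y z)" by (intro L2_indicator repr S')
    \<comment> \<open>The preimage under multiplication by \<open>G\<close>. Division by zero does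
      no harm: almost everywhere on \<open>S\<close> the function \<open>G\<close> is nonzero, and
      off \<open>S\<close> the numerator is 0.\<close>
    define h where "h z = indicator S z * repr y z / G z" for z
    have hm: "h \<in> borel_measurable \<mu>" unfolding h_def[abs_def] using S' by measurable
    have ae_eq: "AE z in \<mu>. G z * h z = indicator S z * repr y z"
      using ae by eventually_elim (auto simp: h_def indicator_def)
    have "L2 \<mu> (\<lambda>z. G z * h z)"
      unfolding L2_def
    proof
      show "(\<lambda>z. G z * h z) \<in> borel_measurable \<mu>" using hm by measurable
      show "integrable \<mu> (\<lambda>z. (cmod (G z * h z))\<^sup>2)"
      proof (rule integrable_cong_AE_imp[OF L2_integrable[OF Sg]])
        show "(\<lambda>z. (cmod (G z * h z))\<^sup>2) \<in> borel_measurable \<mu>" using hm by measurable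
        show "AE z in \<mu>. (cmod (indicator S z * repr y z))\<^sup>2 = (cmod (G z * h z))\<^sup>2"
          using ae_eq by eventually_elim simp
      qed
    qed
    then have h: "L2 circle_uniform h" by (simp add: L2_uniform_iff[OF hm])
    have "wave_op G (uniform.coeff_map h) = spec_proj S y"
      unfolding wave_op_coeff_map[OF h] spec_proj_def
      using ae_eq by (subst coeff_map_eq_iff) (simp_all add: L2_G_mult h Sg)
    then show ?thesis by (metis rangeI)
  qed
  ultimately show ?thesis by blast
qed

end

text \<open>The position of \<open>z\<^sup>m\<close> in the free CMV basis \<open>1, z, z\<^sup>-\<^sup>1, z\<^sup>2, \<dots>\<close>.\<close>
definition zigzag :: "int \<Rightarrow> nat" where
  "zigzag m = (if m \<le> 0 then nat (- 2 * m) else nat (2 * m - 1))"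

lemma uniform_psi_zigzag: "z \<in> sphere 0 1 \<Longrightarrow> uniform.psi (zigzag m) z = z powi m"
proof -
  assume z: "z \<in> sphere 0 1"
  have "(if even (zigzag m) then - int (zigzag m div 2) else int (Suc (zigzag m) div 2)) = m"
  proof (cases "m \<le> 0")
    case True
    then have "zigzag m = 2 * nat (- m)" by (simp add: zigzag_def nat_mult_distrib)
    then show ?thesis using True by simp
  next
    case False
    then obtain k where k: "m = int (Suc k)"
      by (metis not_le zero_less_imp_eq_int gr0_implies_Suc)
    then have "zigzag m = 2 * k + 1" by (simp add: zigzag_def nat_eq_iff)
    then show ?thesis using k by simp
  qed
  then show ?thesis using uniform_psi[OF z, of "zigzag m"] by simp
qed

lemma zigzag_surj: "\<exists>m. zigzag m = j"
proof (cases j rule: even_odd_cases)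
  case (1 k)
  then have "zigzag (- int k) = j" by (simp add: zigzag_def nat_mult_distrib)
  then show ?thesis ..
next
  case (2 k)
  then have "zigzag (int k + 1) = j" by (simp add: zigzag_def nat_eq_iff)
  then show ?thesis ..
qed

lemma uniform_coeff_map_powi: "uniform.coeff_map (\<lambda>z. z powi m) = ell2_unit (zigzag m)"
proof -
  have "uniform.coeff_map (\<lambda>z. z powi m) = uniform.coeff_map (uniform.psi (zigzag m))"
    by (rule uniform.coeff_map_cong) (simp add: uniform_psi_zigzag)
  then show ?thesis by (simp add: uniform.coeff_map_psi)
qed

lemma L2_uniform_powi: "L2 circle_uniform (\<lambda>z. z powi m)"
  by (intro uniform.L2_continuous continuous_intros)

lemma free_power_unit: "op_power_int (cmv_op (\<lambda>_. 0)) n (ell2_unit (zigzag m)) = ell2_unit (zigzag (m + n))"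
proof -
  have "op_power_int (cmv_op (\<lambda>_. 0)) n (ell2_unit (zigzag m)) = uniform.coeff_map (\<lambda>z. z powi n * z powi m)"
    using uniform.cmv_power_coeff_map[OF L2_uniform_powi, of n m] by (simp add: uniform_a uniform_coeff_map_powi)
  also have "\<dots> = uniform.coeff_map (\<lambda>z. z powi (m + n))"
  proof (rule uniform.coeff_map_cong)
    fix z :: complex assume "z \<in> sphere 0 1"
    then have "z \<noteq> 0" by auto
    then show "z powi n * z powi m = z powi (m + n)" by (simp add: power_int_add mult.commute)
  qed
  finally show ?thesis by (simp add: uniform_coeff_map_powi)
qed

context opuc_density
begin

lemma wave_op_unit: "wave_op G (ell2_unit (zigzag k)) = coeff_map (\<lambda>z. z powi k * G z)"
  unfolding uniform_coeff_map_powi[symmetric] wave_op_coeff_map[OF L2_uniform_powi]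
  by (simp add: mult.commute)

text \<open>The free factor moves the unit vector at \<open>zigzag k\<close> to the one at
  \<open>zigzag (k - n)\<close>, and every index is of the form \<open>zigzag k\<close>; hence the
  hypothesis covers all unit vectors.\<close>

lemma strong_limit_wave_op:
  assumes unit: "\<And>k. ((\<lambda>n. op_power_int (cmv_op a) n (ell2_unit (zigzag (k - n)))) \<longlongrightarrow> coeff_map (\<lambda>z. z powi k * G z)) F"
  shows "strong_limit (\<lambda>n. op_power_int (cmv_op a) n \<circ> op_power_int (cmv_op (\<lambda>_. 0)) (- n)) (wave_op G) F"
proof (rule strong_limit_unitI)
  fix n
  have "unitary_op (op_power_int (cmv_op a) n \<circ> op_power_int (cmv_op (\<lambda>_. 0)) (- n))"
    by (intro unitary_op_comp unitary_op_power_int cmv_op_unitary_a cmv_op_unitary) simp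
  then show "clinear_op (op_power_int (cmv_op a) n \<circ> op_power_int (cmv_op (\<lambda>_. 0)) (- n))"
    "\<And>x. norm ((op_power_int (cmv_op a) n \<circ> op_power_int (cmv_op (\<lambda>_. 0)) (- n)) x) = norm x"
    unfolding unitary_op_def by blast+
next
  fix j
  obtain k where "zigzag k = j" using zigzag_surj by blast
  with unit[of k] show "((\<lambda>n. (op_power_int (cmv_op a) n \<circ> op_power_int (cmv_op (\<lambda>_. 0)) (- n)) (ell2_unit j)) \<longlongrightarrow> wave_op G (ell2_unit j)) F"
    by (auto simp: free_power_unit wave_op_unit)
qed (rule wave_op_linear norm_wave_op)+

end

section \<open>Convergence of the wave operators on powers of z\<close>

context opuc
begin

lemma phi_phis:
  assumes "z \<in> sphere 0 1"
  shows "phi n z = z ^ n * cnj (phis n z)"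
proof -
  have "cnj z * z = 1" by (rule circle_cnj_mult[OF assms])
  then have "z ^ n * cnj z ^ n = 1" by (simp add: mult.commute flip: power_mult_distrib)
  then show ?thesis by (simp add: phis_phi[OF assms])
qed

text \<open>Nonpositive exponents sit at even positions, where \<open>psi\<close> is a power of z
  times \<open>phis\<close>; the powers combine to z^k independently of \<open>n\<close>.\<close>

lemma cmv_power_unit_ge:
  assumes "n \<ge> k"
  shows "op_power_int (cmv_op a) n (ell2_unit (zigzag (k - n))) = coeff_map (\<lambda>z. z powi k * phis (2 * nat (n - k)) z)"
proof -
  have zz: "zigzag (k - n) = 2 * nat (n - k)" using assms by (simp add: zigzag_def nat_mult_distrib)
  have "op_power_int (cmv_op a) n (ell2_unit (zigzag (k - n))) = coeff_map (\<lambda>z. z powi n * psi (zigzag (k - n)) z)"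
    using cmv_power_coeff_map[OF L2_psi] by (simp add: coeff_map_psi)
  also have "\<dots> = coeff_map (\<lambda>z. z powi k * phis (2 * nat (n - k)) z)"
  proof (rule coeff_map_cong)
    fix z :: complex assume "z \<in> sphere 0 1"
    then have "z \<noteq> 0" by auto
    then have "z powi k = z powi n * z powi (- int (nat (n - k)))"
      using assms by (simp flip: power_int_add)
    then show "z powi n * psi (zigzag (k - n)) z = z powi k * phis (2 * nat (n - k)) z"
      by (simp add: zz psi_def)
  qed
  finally show ?thesis .
qed

text \<open>Positive exponents sit at odd positions, where \<open>psi\<close> contains
  \<open>phi\<close>. Writing it as z^(2m+1) times the conjugate of \<open>phis\<close>, with
  \<open>k - n = m + 1\<close>, collects the total power n - m + (2m + 1) = k.\<close>

lemma cmv_power_unit_less: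
  assumes "n < k"
  shows "op_power_int (cmv_op a) n (ell2_unit (zigzag (k - n)))
      = coeff_map (\<lambda>z. z powi k * cnj (phis (2 * nat (k - n) - 1) z))"
proof -
  obtain m where m: "k - n = int (Suc m)"
    using assms by (metis diff_gt_0_iff_gt zero_less_imp_eq_int gr0_implies_Suc)
  have zz: "zigzag (k - n) = 2 * m + 1" "2 * nat (k - n) - 1 = 2 * m + 1"
    unfolding m by (simp_all add: zigzag_def nat_eq_iff)
  have "op_power_int (cmv_op a) n (ell2_unit (zigzag (k - n))) = coeff_map (\<lambda>z. z powi n * psi (zigzag (k - n)) z)"
    using cmv_power_coeff_map[OF L2_psi] by (simp add: coeff_map_psi)
  also have "\<dots> = coeff_map (\<lambda>z. z powi k * cnj (phis (2 * nat (k - n) - 1) z))"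
  proof (rule coeff_map_cong)
    fix z :: complex assume z: "z \<in> sphere 0 1"
    then have "z \<noteq> 0" by auto
    have "k = n + (- int m + int (2 * m + 1))" using m by simp
    then have "z powi k = z powi n * (z powi (- int m) * z powi int (2 * m + 1))"
      using \<open>z \<noteq> 0\<close> by (simp only: power_int_add simp_thms)
    then have k: "z powi k = z powi n * (z powi (- int m) * z ^ (2 * m + 1))"
      by (simp only: power_int_of_nat)
    show "z powi n * psi (zigzag (k - n)) z = z powi k * cnj (phis (2 * nat (k - n) - 1) z)"
      unfolding zz k by (simp add: psi_def phi_phis[OF z])
  qed
  finally show ?thesis .
qed

lemma wave_operators:
  assumes sum: "summable (\<lambda>n. (cmod (a n))\<^sup>2)"
  obtains F where "opuc_density \<mu> F" "opuc_density \<mu> (\<lambda>z. cnj (F z))"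
    "strong_limit (\<lambda>n. op_power_int (cmv_op a) n \<circ> op_power_int (cmv_op (\<lambda>_. 0)) (- n)) (wave_op F) at_top"
    "strong_limit (\<lambda>n. op_power_int (cmv_op a) n \<circ> op_power_int (cmv_op (\<lambda>_. 0)) (- n)) (wave_op (\<lambda>z. cnj (F z))) at_bot"
proof -
  obtain F where F: "L2 \<mu> F" and lim: "(\<lambda>n. l2_sq \<mu> (\<lambda>z. phis n z - F z)) \<longlonglongrightarrow> 0"
    using phis_limit[OF sum] by blast
  have dens: "density \<mu> (\<lambda>z. ennreal ((cmod (F z))\<^sup>2)) = circle_uniform"
    by (rule density_phis_limit[OF F lim])
  interpret F: opuc_density \<mu> F by unfold_locales (fact F, fact dens)
  interpret F': opuc_density \<mu> "\<lambda>z. cnj (F z)" by unfold_locales (simp_all add: L2_cnj F dens)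
  have p: "((\<lambda>n. op_power_int (cmv_op a) n (ell2_unit (zigzag (k - n)))) \<longlongrightarrow> coeff_map (\<lambda>z. z powi k * F z)) at_top" for k
  proof (rule Lim_transform_eventually)
    have "filterlim (\<lambda>n::int. 2 * nat (n - k)) at_top at_top"
      unfolding filterlim_at_top
    proof
      fix Z :: nat
      show "\<forall>\<^sub>F n in at_top. Z \<le> 2 * nat (n - k)"
        using eventually_ge_at_top[of "k + int Z"] by eventually_elim linarith
    qed
    from filterlim_compose[OF lim this]
    have "((\<lambda>n. l2_sq \<mu> (\<lambda>z. phis (2 * nat (n - k)) z - F z)) \<longlongrightarrow> 0) at_top" .
    moreover have "l2_sq \<mu> (\<lambda>z. z powi k * phis (2 * nat (n - k)) z - z powi k * F z)
        = l2_sq \<mu> (\<lambda>z. phis (2 * nat (n - k)) z - F z)" for n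
      by (rule l2_sq_cong) (simp add: norm_mult norm_power_int flip: right_diff_distrib)
    ultimately show "((\<lambda>n. coeff_map (\<lambda>z. z powi k * phis (2 * nat (n - k)) z)) \<longlongrightarrow> coeff_map (\<lambda>z. z powi k * F z)) at_top"
      by (intro coeff_map_tendsto L2_powi_mult F L2_phis) simp
    show "\<forall>\<^sub>F n in at_top. coeff_map (\<lambda>z. z powi k * phis (2 * nat (n - k)) z)
        = op_power_int (cmv_op a) n (ell2_unit (zigzag (k - n)))"
      using eventually_ge_at_top[of k] by eventually_elim (simp add: cmv_power_unit_ge)
  qed
  have m: "((\<lambda>n. op_power_int (cmv_op a) n (ell2_unit (zigzag (k - n)))) \<longlongrightarrow> coeff_map (\<lambda>z. z powi k * cnj (F z))) at_bot" for k
  proof (rule Lim_transform_eventually)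
    have "filterlim (\<lambda>n::int. 2 * nat (k - n) - 1) at_top at_bot"
      unfolding filterlim_at_top
    proof
      fix Z :: nat
      show "\<forall>\<^sub>F n in at_bot. Z \<le> 2 * nat (k - n) - 1"
        using eventually_le_at_bot[of "k - int Z - 1"] by eventually_elim linarith
    qed
    from filterlim_compose[OF lim this]
    have "((\<lambda>n. l2_sq \<mu> (\<lambda>z. phis (2 * nat (k - n) - 1) z - F z)) \<longlongrightarrow> 0) at_bot" .
    moreover have "l2_sq \<mu> (\<lambda>z. z powi k * cnj (phis (2 * nat (k - n) - 1) z) - z powi k * cnj (F z))
        = l2_sq \<mu> (\<lambda>z. phis (2 * nat (k - n) - 1) z - F z)" for n
      by (rule l2_sq_cong) (simp add: norm_mult norm_power_int flip: right_diff_distrib complex_cnj_diff)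
    ultimately show "((\<lambda>n. coeff_map (\<lambda>z. z powi k * cnj (phis (2 * nat (k - n) - 1) z))) \<longlongrightarrow> coeff_map (\<lambda>z. z powi k * cnj (F z))) at_bot"
      by (intro coeff_map_tendsto L2_powi_mult L2_cnj F L2_phis) simp
    show "\<forall>\<^sub>F n in at_bot. coeff_map (\<lambda>z. z powi k * cnj (phis (2 * nat (k - n) - 1) z))
        = op_power_int (cmv_op a) n (ell2_unit (zigzag (k - n)))"
      using eventually_le_at_bot[of "k - 1"] by eventually_elim (simp add: cmv_power_unit_less)
  qed
  show ?thesis
    by (rule that[OF F.opuc_density_axioms F'.opuc_density_axioms F.strong_limit_wave_op[OF p] F'.strong_limit_wave_op[OF m]])
qed

end

theorem theorem3p11:
  fixes \<mu> :: "complex measure" and \<alpha> :: "nat \<Rightarrow> complex"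
  assumes "circle_prob \<mu>" and "nontrivial_measure \<mu>"
    and "\<alpha> = verblunsky \<mu>"
    and "summable (\<lambda>n. (cmod (\<alpha> n))\<^sup>2)"
  defines "C \<equiv> cmv_op \<alpha>" and "C\<^sub>0 \<equiv> cmv_op (\<lambda>_. 0)"
  shows "\<exists>\<Omega>\<^sub>p \<Omega>\<^sub>m :: ell2 \<Rightarrow> ell2.
     strong_limit (\<lambda>n. op_power_int C n \<circ> op_power_int C\<^sub>0 (- n)) \<Omega>\<^sub>p at_top \<and>
     strong_limit (\<lambda>n. op_power_int C n \<circ> op_power_int C\<^sub>0 (- n)) \<Omega>\<^sub>m at_bot \<and>
     (\<forall>w \<mu>\<^sub>s S.
        circle_decomposition \<mu> w \<mu>\<^sub>s \<longrightarrow>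
        S \<in> sets circle_borel \<longrightarrow>
        emeasure \<mu>\<^sub>s S = 0 \<longrightarrow>
        emeasure circle_lebesgue (sphere 0 1 - S) = 0 \<longrightarrow>
        range \<Omega>\<^sub>p = range (spectral_projection C S) \<and>
        range \<Omega>\<^sub>m = range (spectral_projection C S))"
proof -
  interpret opuc \<mu> by unfold_locales (fact assms)+
  have \<alpha>: "\<alpha> = a" using assms(3) by (simp add: verblunsky_eq)
  obtain F where F: "opuc_density \<mu> F" "opuc_density \<mu> (\<lambda>z. cnj (F z))"
    and lim: "strong_limit (\<lambda>n. op_power_int C n \<circ> op_power_int C\<^sub>0 (- n)) (wave_op F) at_top"
      "strong_limit (\<lambda>n. op_power_int C n \<circ> op_power_int C\<^sub>0 (- n)) (wave_op (\<lambda>z. cnj (F z))) at_bot"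
    using wave_operators assms(4) unfolding C_def C\<^sub>0_def \<alpha> by blast
  have range: "range (wave_op G) = range (spectral_projection C S)"
    if G: "opuc_density \<mu> G" and dec: "circle_decomposition \<mu> w \<mu>\<^sub>s" and S: "S \<in> sets circle_borel"
      and null: "emeasure \<mu>\<^sub>s S = 0" "emeasure circle_lebesgue (sphere 0 1 - S) = 0" for G w \<mu>\<^sub>s S
  proof -
    interpret G: opuc_density \<mu> G by fact
    show ?thesis
      unfolding C_def \<alpha> spectral_projection_cmv[OF S]
      by (rule G.range_wave_op[OF S G.support_AE[OF dec S null]])
  qed
  show ?thesis
    by (intro exI[of _ "wave_op F"] exI[of _ "wave_op (\<lambda>z. cnj (F z))"] conjI allI impI lim)
      (rule range[OF F(1)] range[OF F(2)], assumption+)+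
qed

end
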